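(* Let $(\mathcal E,[\ ,\ ])$ be a $\mathbb Z^n$-graded Lie algebra and $\theta\in\mathbb Z^n$ with $\langle\theta,\theta\rangle+1\equiv0\pmod 2$. (i) Let $C_\lambda\in\bigl(\bigoplus_{k\theta+c=0}A^{(k,c)}(\mathcal E)\bigr)_\lambda$ satisfy $\mathbb DC_\lambda=0$. For each $P\in\mathcal S^\theta(\mathcal E)$, the unique solution $P_\lambda\in\mathcal E^\theta_\lambda$ of $$\frac{d}{d\lambda}P_\lambda+\eta(C_\lambda)(P_\lambda)=0,\qquad P_0=P,$$ is a formal deformation of $P$; it is said to be associated to the cocycle $C_\lambda$. (ii) Formal deformations (of the same $P\in\mathcal S^\theta(\mathcal E)$) which are associated to cohomologous cocycles are equivalent. (iii) If $\mathbb H^0(\mathcal E)=0$ and $P_\lambda$ is associated to $C_\lambda$, then each deformation equivalent to $P_\lambda$ is associated to a cocycle cohomologous to $C_\lambda$. (iv) For a given $P\in\mathcal S^\theta(\mathcal E)$, the image of the map $\eta_{P\#}:\mathbb H(\mathcal E)\to H(\mathcal E,\partial_P)$ induced by $\eta_P$ lies in the center of $H(\mathcal E,\partial_P)$. If $H^\theta(\mathcal E,\partial_P)\subset\operatorname{im}\eta_{P\#}$, then each deformation of $P$ is associated to some cocycle.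
   Context: All vector spaces are over a field $\mathbb K$ of characteristic $0$. For $x,y\in\mathbb Z^m$ put $\langle x,y\rangle=\sum_i x^iy^i$. A $\mathbb Z^m$-graded Lie algebra is an $m$-graded space with bilinear bracket adding degrees, with $[X,Y]=-(-1)^{\langle x,y\rangle}[Y,X]$ and $[X,[Y,Z]]=[[X,Y],Z]+(-1)^{\langle x,y\rangle}[Y,[X,Z]]$ for homogeneous elements of degrees $x,y,z$. The Lie algebra $A(\mathcal E)$. For an $m$-graded space $U$: $M^{(k,\kappa)}(U)$ is the space of $(k+1)$-linear maps $K:U\times\dots\times U\to U$ with $K(U^{x_0}\times\dots\times U^{x_k})\subseteq U^{x_0+\dots+x_k+\kappa}$ ($M^{(-1,\kappa)}(U)=U^\kappa$; zero for $k<-1$). For $K_i\in M^{(k_i,\kappa_i)}(U)$, $(j(K_1)K_2)(X_0,\dots,X_{k_1+k_2})=\sum_{i=0}^{k_2}(-1)^{k_1i+\langle\kappa_1,\kappa_2+x_0+\dots+x_{i-1}\rangle}K_2(X_0,\dots,K_1(X_i,\dots,X_{i+k_1}),\dots,X_{k_1+k_2})$ (zero if $k_2=-1$). For $\mathbf x=(x_0,\dots,x_k)$ and a permutation $\sigma$ of $\{0,\dots,k\}$, $\operatorname{sign}(\sigma,\mathbf x)=\prod_{i<j,\ \sigma i>\sigma j}\bigl(-(-1)^{\langle x_{\sigma i},x_{\sigma j}\rangle}\bigr)$; $(\alpha K)(X_0,\dots,X_k)=\frac1{(k+1)!}\sum_\sigma\operatorname{sign}(\sigma,\mathbf x)K(X_{\sigma0},\dots,X_{\sigma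 k})$; $A^{(k,\kappa)}(U)=\alpha(M^{(k,\kappa)}(U))$, $A(U)=\bigoplus A^{(k,\kappa)}(U)$. For $K_i\in A^{(k_i,\kappa_i)}(U)$: $i(K_1)K_2=\frac{(k_1+k_2+1)!}{(k_1+1)!(k_2+1)!}\alpha(j(K_1)K_2)$ (zero if $k_2=-1$) and $[K_1,K_2]^{\wedge}=i(K_1)K_2-(-1)^{k_1k_2+\langle\kappa_1,\kappa_2\rangle}i(K_2)K_1$. $A(U)$ is an $(m+1)$-graded Lie algebra. Structures and cohomology. $\mathcal S^\theta(\mathcal E)=\{P\in\mathcal E^\theta:[P,P]=0\}$. For such $P$, $\partial_P=[P,\cdot]$ is a differential on $\mathcal E$, with cohomology $H(\mathcal E,\partial_P)=\bigoplus_xH^x(\mathcal E,\partial_P)$, $H^x(\mathcal E,\partial_P)=(\mathcal E^x\cap\ker\partial_P)/\partial_P\mathcal E^{x-\theta}$, which is a $\mathbb Z^n$-graded Lie algebra with the induced bracket. The bracket $[\ ,\ ]$ of $\mathcal E$ is an element of $A^{(1,0)}(\mathcal E)$ with $[[\ ,\ ],[\ ,\ ]]^\wedge=0$; put $\mathbb DC=[[\ ,\ ],C]^\wedge$ on $A(\mathcal E)$ and $\mathbb H(\mathcal E)=H(A(\mathcal E),\mathbb D)$ ($\mathbb Z^{n+1}$-graded; $\mathbb H^0$ is the part of multidegree $0\in\mathbb Z^{n+1}$). Formal power series. A subscript $\lambda$ on a vector space denotes formal power series in $\lambda$ with coefficients in that space; $\mathcal E_\lambda=\bigoplus_x\mathcal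 E^x_\lambda$ with the $\lambda$-bilinearly extended bracket; $\mathbb D$ and evaluation of multilinear maps are extended $\lambda$-linearly. A formal deformation of $P\in\mathcal S^\theta(\mathcal E)$ is $P_\lambda\in\mathcal E^\theta_\lambda$ with $[P_\lambda,P_\lambda]=0$ and $P_0=P$. An equivalence is an automorphism $\varphi_\lambda=\sum_k\lambda^k\varphi_k$ of the graded Lie algebra $\mathcal E_\lambda$ with $\varphi_k\in A^{(0,0)}(\mathcal E)$ (linear maps of degree $0$) and $\varphi_0=\operatorname{id}$; deformations $P_\lambda,P'_\lambda$ of $P$ are equivalent if $P'_\lambda=\varphi_\lambda(P_\lambda)$ for some equivalence. A cocycle means an element $C_\lambda$ as in (i) with $\mathbb DC_\lambda=0$; two cocycles $C_\lambda,C'_\lambda$ are cohomologous if $C'_\lambda-C_\lambda=\mathbb DA_\lambda$ for some $A_\lambda\in\bigl(\bigoplus_{(k+1)\theta+c=0}A^{(k,c)}(\mathcal E)\bigr)_\lambda$. The map $\eta$. For $C\in A^{(k,c)}(\mathcal E)$ let $\eta(C)$ be the polynomial map $\eta(C)(X)=\frac1{(k+1)!}C(X,\dots,X)$ on $\mathcal E$ (extended linearly in $C$, and $\lambda$-linearly), and for $P\in\mathcal S^\theta(\mathcal E)$ put $\eta_P(C)=\eta(C)(P)$; $\eta_P$ maps $\mathbb D$-cocycles to $\partial_P$-cocycles and $\mathbb D$-coboundaries to $\partial_P$-coboundaries. The center of a graded Lie algebra consists of the $Z$ with $[Z,Y]=0$ for all $Y$. *)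

theory Defs
  imports
    "HOL-Analysis.Finite_Cartesian_Product"
    "HOL-Combinatorics.Permutations"
    "HOL-Computational_Algebra.Formal_Power_Series"
    "HOL-Library.Function_Algebras"
    "HOL-Library.Product_Plus"
begin

section \<open>Graded spaces\<close>

text \<open>
  A graded space is given by its family of homogeneous parts inside an ambient abelian group.
  The internal direct sum of the parts with index in \<open>I\<close> consists of all finite sums.
\<close>

definition direct_sum :: "'g set \<Rightarrow> ('g \<Rightarrow> 'v::comm_monoid_add set) \<Rightarrow> 'v set" where
  "direct_sum I G = {v. \<exists>S f. finite S \<and> S \<subseteq> I \<and> (\<forall>g\<in>S. f g \<in> G g) \<and> v = sum f S}"

definition hdecomp :: "('g \<Rightarrow> 'v::comm_monoid_add set) \<Rightarrow> 'v \<Rightarrow> ('g \<Rightarrow> 'v) \<Rightarrow> bool" where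
  "hdecomp G v f \<longleftrightarrow>
     (\<forall>g. f g \<in> G g) \<and> finite {g. f g \<noteq> 0} \<and> v = (\<Sum>g | f g \<noteq> 0. f g)"

definition hcomp :: "('g \<Rightarrow> 'v::comm_monoid_add set) \<Rightarrow> 'v \<Rightarrow> 'g \<Rightarrow> 'v" where
  "hcomp G v = (THE f. hdecomp G v f)"

definition hsupp :: "('g \<Rightarrow> 'v::comm_monoid_add set) \<Rightarrow> 'v \<Rightarrow> 'g set" where
  "hsupp G v = {g. hcomp G v g \<noteq> 0}"


section \<open>Multigraded Lie algebras\<close>

definition ip :: "int ^ 'n \<Rightarrow> int ^ 'n \<Rightarrow> int" where
  "ip x y = (\<Sum>i\<in>UNIV. vec_nth x i * vec_nth y i)"

text \<open>
  The underlying space is the whole type \<open>'e\<close>, with scalar multiplication \<open>scl\<close>,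
  homogeneous parts \<open>gr x\<close> and bracket \<open>brk\<close>.
\<close>

record ('k, 'e, 'n) graded_algebra =
  scl :: "'k \<Rightarrow> 'e \<Rightarrow> 'e"
  gr :: "int ^ 'n::finite \<Rightarrow> 'e set"
  brk :: "'e \<Rightarrow> 'e \<Rightarrow> 'e"

locale graded_lie_algebra =
  fixes L :: "('k::field_char_0, 'e::ab_group_add, 'n::finite) graded_algebra"
  assumes vector_space: "vector_space (scl L)"
    and subspace: "module.subspace (scl L) (gr L x)"
    and direct: "\<exists>!f. hdecomp (gr L) X f"
    and linear_left: "Vector_Spaces.linear (scl L) (scl L) (\<lambda>X. brk L X Y)"
    and linear_right: "Vector_Spaces.linear (scl L) (scl L) (\<lambda>Y. brk L X Y)"
    and degree: "\<lbrakk>X \<in> gr L x; Y \<in> gr L y\<rbrakk> \<Longrightarrow> brk L X Y \<in> gr L (x + y)"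
    and antisym: "\<lbrakk>X \<in> gr L x; Y \<in> gr L y\<rbrakk> \<Longrightarrow>
      brk L X Y = - scl L ((-1) powi ip x y) (brk L Y X)"
    and jacobi: "\<lbrakk>X \<in> gr L x; Y \<in> gr L y; Z \<in> gr L z\<rbrakk> \<Longrightarrow>
      brk L X (brk L Y Z) =
        brk L (brk L X Y) Z + scl L ((-1) powi ip x y) (brk L Y (brk L X Z))"


section \<open>The graded Lie algebra of alternating multilinear maps\<close>

text \<open>
  A \<open>(k+1)\<close>-linear map is encoded as a function on lists which vanishes on all lists of length
  different from \<open>k + 1\<close>; for \<open>k = -1\<close> it amounts to its value at the empty list. Maps with
  different numbers of arguments thus live in the single type \<^typ>\<open>'e list \<Rightarrow> 'e\<close>, with pointwise
  operations, and their sum there is direct.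
\<close>

definition multilin ::
    "('k::field_char_0, 'e::ab_group_add, 'n::finite) graded_algebra
      \<Rightarrow> int \<times> (int ^ 'n) \<Rightarrow> ('e list \<Rightarrow> 'e) set" where
  "multilin L = (\<lambda>(k, c). {K.
     (\<forall>Xs. int (length Xs) \<noteq> k + 1 \<longrightarrow> K Xs = 0) \<and>
     (\<forall>Xs i. int (length Xs) = k + 1 \<and> i < length Xs \<longrightarrow>
        Vector_Spaces.linear (scl L) (scl L) (\<lambda>X. K (Xs[i := X]))) \<and>
     (\<forall>xs Xs. int (length Xs) = k + 1 \<and> list_all2 (\<lambda>x X. X \<in> gr L x) xs Xs \<longrightarrow>
        K Xs \<in> gr L (sum_list xs + c))})"

text \<open>
  Formulas with signs depending on the degrees of the arguments are given for homogeneous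
  arguments \<open>Xs\<close> of degrees \<open>xs\<close>, in the form \<open>f xs Xs\<close>, and extended multilinearly.
\<close>

definition homog_ext ::
    "('k, 'e::ab_group_add, 'n::finite) graded_algebra
      \<Rightarrow> ((int ^ 'n) list \<Rightarrow> 'e list \<Rightarrow> 'e) \<Rightarrow> 'e list \<Rightarrow> 'e" where
  "homog_ext L f Xs =
     (\<Sum>xs \<in> listset (map (hsupp (gr L)) Xs). f xs (map2 (hcomp (gr L)) Xs xs))"

definition perm_sign :: "(nat \<Rightarrow> nat) \<Rightarrow> (int ^ 'n) list \<Rightarrow> 'k::field_char_0" where
  "perm_sign \<sigma> xs =
     (\<Prod>(i, j) \<in> {(i, j). i < j \<and> j < length xs \<and> \<sigma> i > \<sigma> j}.
        - ((-1) powi ip (xs ! \<sigma> i) (xs ! \<sigma> j)))"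

definition alt ::
    "('k::field_char_0, 'e::ab_group_add, 'n::finite) graded_algebra
      \<Rightarrow> ('e list \<Rightarrow> 'e) \<Rightarrow> 'e list \<Rightarrow> 'e" where
  "alt L K = homog_ext L (\<lambda>xs Xs.
     scl L (1 / fact (length Xs))
       (\<Sum>\<sigma> | \<sigma> permutes {..<length Xs}.
          scl L (perm_sign \<sigma> xs) (K (map (\<lambda>i. Xs ! \<sigma> i) [0..<length Xs]))))"

definition cochains ::
    "('k::field_char_0, 'e::ab_group_add, 'n::finite) graded_algebra
      \<Rightarrow> int \<times> (int ^ 'n) \<Rightarrow> ('e list \<Rightarrow> 'e) set" where
  "cochains L g = alt L ` multilin L g"

text \<open>
  \<open>insert_op L (k1, c1) (k2, c2) K1 K2\<close> is \<open>j(K1) K2\<close> and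
  \<open>alt_insert L (k1, c1) (k2, c2) K1 K2\<close> is \<open>i(K1) K2\<close>,
  for \<open>Ki\<close> homogeneous of degree \<open>(ki, ci)\<close>.
\<close>

definition insert_op ::
    "('k::field_char_0, 'e::ab_group_add, 'n::finite) graded_algebra
      \<Rightarrow> int \<times> (int ^ 'n) \<Rightarrow> int \<times> (int ^ 'n)
      \<Rightarrow> ('e list \<Rightarrow> 'e) \<Rightarrow> ('e list \<Rightarrow> 'e) \<Rightarrow> 'e list \<Rightarrow> 'e" where
  "insert_op L = (\<lambda>(k1, c1) (k2, c2) K1 K2 Xs.
     if k2 < 0 \<or> int (length Xs) \<noteq> k1 + k2 + 1 then 0
     else homog_ext L (\<lambda>xs Ys. \<Sum>i = 0..nat k2.
       scl L ((-1) powi (k1 * int i + ip c1 (c2 + sum_list (take i xs))))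
         (K2 (take i Ys @ K1 (take (nat (k1 + 1)) (drop i Ys)) # drop (i + nat (k1 + 1)) Ys))) Xs)"

definition alt_insert ::
    "('k::field_char_0, 'e::ab_group_add, 'n::finite) graded_algebra
      \<Rightarrow> int \<times> (int ^ 'n) \<Rightarrow> int \<times> (int ^ 'n)
      \<Rightarrow> ('e list \<Rightarrow> 'e) \<Rightarrow> ('e list \<Rightarrow> 'e) \<Rightarrow> 'e list \<Rightarrow> 'e" where
  "alt_insert L = (\<lambda>(k1, c1) (k2, c2) K1 K2 Xs.
     if k2 < 0 then 0
     else scl L (fact (nat (k1 + k2 + 1)) / (fact (nat (k1 + 1)) * fact (nat (k2 + 1))))
       (alt L (insert_op L (k1, c1) (k2, c2) K1 K2) Xs))"

definition cochain_brk_hom ::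
    "('k::field_char_0, 'e::ab_group_add, 'n::finite) graded_algebra
      \<Rightarrow> int \<times> (int ^ 'n) \<Rightarrow> int \<times> (int ^ 'n)
      \<Rightarrow> ('e list \<Rightarrow> 'e) \<Rightarrow> ('e list \<Rightarrow> 'e) \<Rightarrow> 'e list \<Rightarrow> 'e" where
  "cochain_brk_hom L = (\<lambda>(k1, c1) (k2, c2) K1 K2 Xs.
     alt_insert L (k1, c1) (k2, c2) K1 K2 Xs
     - scl L ((-1) powi (k1 * k2 + ip c1 c2)) (alt_insert L (k2, c2) (k1, c1) K2 K1 Xs))"

definition cochain_brk ::
    "('k::field_char_0, 'e::ab_group_add, 'n::finite) graded_algebra
      \<Rightarrow> ('e list \<Rightarrow> 'e) \<Rightarrow> ('e list \<Rightarrow> 'e) \<Rightarrow> 'e list \<Rightarrow> 'e" where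
  "cochain_brk L K1 K2 =
     (\<Sum>g1 \<in> hsupp (cochains L) K1. \<Sum>g2 \<in> hsupp (cochains L) K2.
        cochain_brk_hom L g1 g2 (hcomp (cochains L) K1 g1) (hcomp (cochains L) K2 g2))"

definition brk_cochain ::
    "('k, 'e::ab_group_add, 'n::finite) graded_algebra \<Rightarrow> 'e list \<Rightarrow> 'e" where
  "brk_cochain L Xs = (if length Xs = 2 then brk L (Xs ! 0) (Xs ! 1) else 0)"

definition DD ::
    "('k::field_char_0, 'e::ab_group_add, 'n::finite) graded_algebra
      \<Rightarrow> ('e list \<Rightarrow> 'e) \<Rightarrow> 'e list \<Rightarrow> 'e" where
  "DD L C = cochain_brk L (brk_cochain L) C"


section \<open>Cohomology\<close>

text \<open>
  Cohomology of the graded space \<open>G\<close> with respect to a differential \<open>d\<close> of degree \<open>t\<close>.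
  The elements of the part \<open>coh_part G d t x\<close> of degree \<open>x\<close> are cosets, and the direct sum of
  these parts is formed externally, as finitely supported families of cosets.
\<close>

definition coh_part ::
    "('g::ab_group_add \<Rightarrow> 'v::ab_group_add set) \<Rightarrow> ('v \<Rightarrow> 'v) \<Rightarrow> 'g \<Rightarrow> 'g \<Rightarrow> 'v set set" where
  "coh_part G d t x = (\<lambda>z. (+) z ` d ` G (x - t)) ` {z \<in> G x. d z = 0}"

definition coh_zero ::
    "('g::ab_group_add \<Rightarrow> 'v::ab_group_add set) \<Rightarrow> ('v \<Rightarrow> 'v) \<Rightarrow> 'g \<Rightarrow> 'g \<Rightarrow> 'v set" where
  "coh_zero G d t x = d ` G (x - t)"

definition cohomology ::
    "('g::ab_group_add \<Rightarrow> 'v::ab_group_add set) \<Rightarrow> ('v \<Rightarrow> 'v) \<Rightarrow> 'g \<Rightarrow> ('g \<Rightarrow> 'v set) set" where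
  "cohomology G d t =
     {\<xi>. (\<forall>x. \<xi> x \<in> coh_part G d t x) \<and> finite {x. \<xi> x \<noteq> coh_zero G d t x}}"

definition coh_summand ::
    "('g::ab_group_add \<Rightarrow> 'v::ab_group_add set) \<Rightarrow> ('v \<Rightarrow> 'v) \<Rightarrow> 'g \<Rightarrow> 'g \<Rightarrow> ('g \<Rightarrow> 'v set) set" where
  "coh_summand G d t x = {\<xi> \<in> cohomology G d t. \<forall>y. y \<noteq> x \<longrightarrow> \<xi> y = coh_zero G d t y}"

definition cocycles ::
    "('g \<Rightarrow> 'v::ab_group_add set) \<Rightarrow> ('v \<Rightarrow> 'v) \<Rightarrow> 'v set" where
  "cocycles G d = {z \<in> direct_sum UNIV G. d z = 0}"

definition coh_class ::
    "('g::ab_group_add \<Rightarrow> 'v::ab_group_add set) \<Rightarrow> ('v \<Rightarrow> 'v) \<Rightarrow> 'g \<Rightarrow> 'v \<Rightarrow> 'g \<Rightarrow> 'v set" where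
  "coh_class G d t z = (\<lambda>x. (+) (hcomp G z x) ` d ` G (x - t))"

text \<open>
  The bracket on \<open>H(E, \<partial>\<^sub>P)\<close> and the map induced by \<open>\<eta>\<^sub>P\<close> are defined through representing
  cocycles. Their values do not depend on the representatives, since brackets and \<open>\<eta>\<^sub>P\<close> map cocycles
  to cocycles and coboundaries to coboundaries.
\<close>

definition coh_rep ::
    "('g::ab_group_add \<Rightarrow> 'v::ab_group_add set) \<Rightarrow> ('v \<Rightarrow> 'v) \<Rightarrow> 'g \<Rightarrow> ('g \<Rightarrow> 'v set) \<Rightarrow> 'v" where
  "coh_rep G d t \<xi> = (SOME z. z \<in> cocycles G d \<and> coh_class G d t z = \<xi>)"

definition mc_elements ::
    "('k, 'e::ab_group_add, 'n::finite) graded_algebra \<Rightarrow> int ^ 'n \<Rightarrow> 'e set" where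
  "mc_elements L \<theta> = {P \<in> gr L \<theta>. brk L P P = 0}"

abbreviation HP ::
    "('k, 'e::ab_group_add, 'n::finite) graded_algebra \<Rightarrow> int ^ 'n \<Rightarrow> 'e
      \<Rightarrow> (int ^ 'n \<Rightarrow> 'e set) set" where
  "HP L \<theta> P \<equiv> cohomology (gr L) (brk L P) \<theta>"

abbreviation HHH ::
    "('k::field_char_0, 'e::ab_group_add, 'n::finite) graded_algebra
      \<Rightarrow> (int \<times> (int ^ 'n) \<Rightarrow> ('e list \<Rightarrow> 'e) set) set" where
  "HHH L \<equiv> cohomology (cochains L) (DD L) (1, 0)"

definition HP_brk ::
    "('k, 'e::ab_group_add, 'n::finite) graded_algebra \<Rightarrow> int ^ 'n \<Rightarrow> 'e
      \<Rightarrow> (int ^ 'n \<Rightarrow> 'e set) \<Rightarrow> (int ^ 'n \<Rightarrow> 'e set) \<Rightarrow> int ^ 'n \<Rightarrow> 'e set" where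
  "HP_brk L \<theta> P \<xi> \<zeta> =
     coh_class (gr L) (brk L P) \<theta>
       (brk L (coh_rep (gr L) (brk L P) \<theta> \<xi>) (coh_rep (gr L) (brk L P) \<theta> \<zeta>))"

definition HP_center ::
    "('k, 'e::ab_group_add, 'n::finite) graded_algebra \<Rightarrow> int ^ 'n \<Rightarrow> 'e
      \<Rightarrow> (int ^ 'n \<Rightarrow> 'e set) set" where
  "HP_center L \<theta> P =
     {\<zeta> \<in> HP L \<theta> P. \<forall>\<xi> \<in> HP L \<theta> P. HP_brk L \<theta> P \<zeta> \<xi> = coh_zero (gr L) (brk L P) \<theta>}"


section \<open>The map \<open>\<eta>\<close>\<close>

definition arity_set :: "('e list \<Rightarrow> 'e::zero) \<Rightarrow> nat set" where
  "arity_set C = {p. \<exists>Xs. length Xs = p \<and> C Xs \<noteq> 0}"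

text \<open>The arity is \<open>p = k + 1\<close>, and restricting \<open>C\<close> to lists of length \<open>p\<close> gives its arity \<open>p\<close> part.\<close>

definition eta ::
    "('k::field_char_0, 'e::ab_group_add, 'n::finite) graded_algebra
      \<Rightarrow> ('e list \<Rightarrow> 'e) \<Rightarrow> 'e \<Rightarrow> 'e" where
  "eta L C X = (\<Sum>p \<in> arity_set C. scl L (1 / fact p) (C (replicate p X)))"

definition eta_sharp ::
    "('k::field_char_0, 'e::ab_group_add, 'n::finite) graded_algebra \<Rightarrow> int ^ 'n \<Rightarrow> 'e
      \<Rightarrow> (int \<times> (int ^ 'n) \<Rightarrow> ('e list \<Rightarrow> 'e) set) \<Rightarrow> int ^ 'n \<Rightarrow> 'e set" where
  "eta_sharp L \<theta> P \<xi> =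
     coh_class (gr L) (brk L P) \<theta> (eta L (coh_rep (cochains L) (DD L) (1, 0) \<xi>) P)"


section \<open>Formal power series and deformations\<close>

definition fps_over :: "'v set \<Rightarrow> 'v fps set" where
  "fps_over V = {F. \<forall>i. fps_nth F i \<in> V}"

definition fps_space ::
    "('k, 'e::ab_group_add, 'n::finite) graded_algebra \<Rightarrow> 'e fps set" where
  "fps_space L = direct_sum UNIV (\<lambda>x. fps_over (gr L x))"

definition fps_brk ::
    "('k, 'e::ab_group_add, 'n::finite) graded_algebra \<Rightarrow> 'e fps \<Rightarrow> 'e fps \<Rightarrow> 'e fps" where
  "fps_brk L F G = Abs_fps (\<lambda>i. \<Sum>j\<le>i. brk L (fps_nth F j) (fps_nth G (i - j)))"

definition DD_fps ::
    "('k::field_char_0, 'e::ab_group_add, 'n::finite) graded_algebra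
      \<Rightarrow> ('e list \<Rightarrow> 'e) fps \<Rightarrow> ('e list \<Rightarrow> 'e) fps" where
  "DD_fps L C = Abs_fps (\<lambda>i. DD L (fps_nth C i))"

definition eval_at_fps :: "('e list \<Rightarrow> 'e::ab_group_add) \<Rightarrow> 'e fps list \<Rightarrow> 'e fps" where
  "eval_at_fps K Fs = Abs_fps (\<lambda>i.
     \<Sum>js | length js = length Fs \<and> sum_list js = i. K (map2 fps_nth Fs js))"

definition eta_fps ::
    "('k::field_char_0, 'e::ab_group_add, 'n::finite) graded_algebra
      \<Rightarrow> ('e list \<Rightarrow> 'e) fps \<Rightarrow> 'e fps \<Rightarrow> 'e fps" where
  "eta_fps L C F = Abs_fps (\<lambda>i. \<Sum>j\<le>i. \<Sum>p \<in> arity_set (fps_nth C j).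
     scl L (1 / fact p) (fps_nth (eval_at_fps (fps_nth C j) (replicate p F)) (i - j)))"

text \<open>
  \<^const>\<open>fps_deriv\<close> needs coefficients in a semiring and is not available for coefficients in a
  vector space.
\<close>

definition fps_derivative ::
    "('k::field_char_0, 'e::ab_group_add, 'n::finite) graded_algebra \<Rightarrow> 'e fps \<Rightarrow> 'e fps" where
  "fps_derivative L F = Abs_fps (\<lambda>i. scl L (of_nat (i + 1)) (fps_nth F (i + 1)))"

definition deformation ::
    "('k, 'e::ab_group_add, 'n::finite) graded_algebra \<Rightarrow> int ^ 'n \<Rightarrow> 'e \<Rightarrow> 'e fps \<Rightarrow> bool" where
  "deformation L \<theta> P F \<longleftrightarrow>
     F \<in> fps_over (gr L \<theta>) \<and> fps_brk L F F = 0 \<and> fps_nth F 0 = P"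

definition apply_fps :: "('e list \<Rightarrow> 'e::ab_group_add) fps \<Rightarrow> 'e fps \<Rightarrow> 'e fps" where
  "apply_fps \<phi> F = Abs_fps (\<lambda>i. \<Sum>j\<le>i. fps_nth \<phi> j [fps_nth F (i - j)])"

text \<open>
  A series with coefficients of multidegree \<open>(0, 0)\<close> acts \<open>\<lambda>\<close>-linearly by construction,
  so only bijectivity and the compatibility with degrees and bracket have to be demanded of an automorphism.
\<close>

definition equivalence ::
    "('k::field_char_0, 'e::ab_group_add, 'n::finite) graded_algebra
      \<Rightarrow> ('e list \<Rightarrow> 'e) fps \<Rightarrow> bool" where
  "equivalence L \<phi> \<longleftrightarrow>
     \<phi> \<in> fps_over (cochains L (0, 0)) \<and>
     (\<forall>X. fps_nth \<phi> 0 [X] = X) \<and>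
     bij_betw (apply_fps \<phi>) (fps_space L) (fps_space L) \<and>
     (\<forall>x. apply_fps \<phi> ` fps_over (gr L x) \<subseteq> fps_over (gr L x)) \<and>
     (\<forall>F \<in> fps_space L. \<forall>G \<in> fps_space L.
        apply_fps \<phi> (fps_brk L F G) = fps_brk L (apply_fps \<phi> F) (apply_fps \<phi> G))"

definition equivalent ::
    "('k::field_char_0, 'e::ab_group_add, 'n::finite) graded_algebra
      \<Rightarrow> 'e fps \<Rightarrow> 'e fps \<Rightarrow> bool" where
  "equivalent L F F' \<longleftrightarrow> (\<exists>\<phi>. equivalence L \<phi> \<and> F' = apply_fps \<phi> F)"

definition deformation_cocycle ::
    "('k::field_char_0, 'e::ab_group_add, 'n::finite) graded_algebra \<Rightarrow> int ^ 'n
      \<Rightarrow> ('e list \<Rightarrow> 'e) fps \<Rightarrow> bool" where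
  "deformation_cocycle L \<theta> C \<longleftrightarrow>
     C \<in> fps_over (direct_sum {(k, c). k *s \<theta> + c = 0} (cochains L)) \<and> DD_fps L C = 0"

definition cohomologous ::
    "('k::field_char_0, 'e::ab_group_add, 'n::finite) graded_algebra \<Rightarrow> int ^ 'n
      \<Rightarrow> ('e list \<Rightarrow> 'e) fps \<Rightarrow> ('e list \<Rightarrow> 'e) fps \<Rightarrow> bool" where
  "cohomologous L \<theta> C C' \<longleftrightarrow>
     (\<exists>A \<in> fps_over (direct_sum {(k, c). (k + 1) *s \<theta> + c = 0} (cochains L)).
        C' - C = DD_fps L A)"

definition solution ::
    "('k::field_char_0, 'e::ab_group_add, 'n::finite) graded_algebra \<Rightarrow> int ^ 'n \<Rightarrow> 'e
      \<Rightarrow> ('e list \<Rightarrow> 'e) fps \<Rightarrow> 'e fps \<Rightarrow> bool" where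
  "solution L \<theta> P C F \<longleftrightarrow>
     F \<in> fps_over (gr L \<theta>) \<and> fps_derivative L F + eta_fps L C F = 0 \<and> fps_nth F 0 = P"

definition associated ::
    "('k::field_char_0, 'e::ab_group_add, 'n::finite) graded_algebra \<Rightarrow> int ^ 'n \<Rightarrow> 'e
      \<Rightarrow> ('e list \<Rightarrow> 'e) fps \<Rightarrow> 'e fps \<Rightarrow> bool" where
  "associated L \<theta> P C F \<longleftrightarrow> deformation_cocycle L \<theta> C \<and> solution L \<theta> P C F"

end

theory Submission
  imports Defs
begin

text \<open>
  A cocycle of \<open>A(E)\<close> acts on Maurer-Cartan elements as a vector field, and a coboundary acts
  through the adjoint representation of \<open>E\<close>. Everything rests on one identity: evaluated on copies of
  an odd element \<open>F\<close> with \<open>[F, F] = 0\<close>, the cochain \<open>DD K\<close> (\<open>K\<close> of degree \<open>(k, c)\<close>) gives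
  \<open>- (-1)^\<langle>c, \<theta>\<rangle> (k + 2) [F, K(F, \<dots>, F)]\<close>. It holds for formal power series \<open>F\<close> as well, and modulo
  \<open>\<lambda>^(n+1)\<close> as soon as \<open>[F, F]\<close> vanishes modulo \<open>\<lambda>^(n+1)\<close> (\<open>cauchy_eval_DD\<close>).

  Its source is the Cartan formula \<open>i_a DD + DD i_a = - (-1)^\<langle>a, c\<rangle> L_a\<close> for the contraction \<open>i_a\<close>
  with a homogeneous element \<open>a\<close> and the action \<open>L_a\<close> of \<open>a\<close> on cochains (\<open>cartan\<close>). It computes
  \<open>DD\<close> by recursion on the number of arguments, so it replaces every further manipulation of sums over
  permutations. It is proved for lists of pairs (degree, element), where alternation is an iterated
  insertion \<open>perm_sum\<close> of the arguments one after the other. The formula also yields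
  \<open>DD L_a = L_a DD\<close> for \<open>a\<close> of degree \<open>0\<close> (\<open>cob_act\<close>) and, on cocycles, \<open>L_a K = - DD (i_a K)\<close>
  (\<open>lie_act_cocycle\<close>).

  (i) The differential equation is a recursion for the coefficients. Along a solution the derivative
  of \<open>[F, F]\<close> is \<open>-2 [F, \<eta>(C)(F)]\<close>, whose coefficient of order \<open>n\<close> vanishes if \<open>[F, F]\<close> vanishes
  up to order \<open>n\<close>, since \<open>C\<close> is a cocycle; hence \<open>[F, F] = 0\<close>.

  (ii) A series \<open>a\<close> of elements of degree \<open>0\<close> has a flow \<open>\<phi>\<close> on \<open>E\<close> with \<open>\<phi>' = ad(a) \<phi>\<close>, which is an
  automorphism, and a flow \<open>T\<close> on cochains with \<open>T' = L_a T\<close>; they satisfy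
  \<open>\<phi>(K(F, \<dots>)) = (T K)(\<phi> F, \<dots>)\<close> (\<open>flow_cauchy_eval\<close>). If \<open>F\<close> is associated to \<open>C\<close>, then
  \<open>H = \<phi> F\<close> solves \<open>H' = [a, H] - \<eta>(T C)(H)\<close>. Because \<open>L_a\<close> is null-homotopic on cocycles,
  \<open>T C = C - DD B\<close> with \<open>B\<close> explicit (\<open>cflow_fps_homotopy\<close>), and the order \<open>n\<close> part of \<open>B\<close> depends
  only on the parts of \<open>a\<close> of order below \<open>n\<close>. For \<open>C' = C + DD A\<close> the series \<open>a\<close> can therefore be
  chosen recursively so that \<open>[a, H]\<close> cancels \<open>\<eta>(DD (A + B))(H)\<close>; then \<open>H\<close> is the
  solution associated to \<open>C'\<close>.

  (iii) For an equivalence \<open>\<phi>\<close> the coefficients of \<open>\<phi>' \<phi>^(-1)\<close> are derivations of degree \<open>0\<close>, that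
  is, cocycles of degree \<open>(0, 0)\<close>. If \<open>H^0\<close> vanishes they are inner, so \<open>\<phi>\<close> is the flow of a series
  \<open>a\<close>, and \<open>\<phi> F\<close> is associated to \<open>T C - DD a\<close>, which is cohomologous to \<open>C\<close>.

  (iv) For a cocycle \<open>K\<close> and \<open>w\<close> with \<open>[P, w] = 0\<close> the Cartan formula at \<open>(w, P, \<dots>, P)\<close> exhibits
  \<open>[w, K(P, \<dots>, P)]\<close> as a boundary, hence the image of \<open>\<eta>_P\<close> is central. Given a deformation \<open>F\<close>,
  a cocycle \<open>C\<close> is built order by order: the defect of order \<open>n\<close> of \<open>F' + \<eta>(C)(F) = 0\<close> is a
  \<open>\<partial>_P\<close>-cocycle of degree \<open>\<theta>\<close>, so by hypothesis it is, up to a boundary \<open>[P, e]\<close>, of the form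
  \<open>\<eta>(z)(P)\<close>, and \<open>[P, e]\<close> itself equals \<open>- \<eta>(DD e)(P)\<close>.
\<close>

section \<open>Signs\<close>

lemma ip_add_left: "ip (x + y) z = ip x z + ip y z"
  by (simp add: ip_def sum.distrib algebra_simps)

lemma ip_add_right: "ip x (y + z) = ip x y + ip x z"
  by (simp add: ip_def sum.distrib algebra_simps)

lemma ip_commute: "ip x y = ip y x"
  by (simp add: ip_def mult.commute)

lemma ip_zero_left [simp]: "ip 0 x = 0" and ip_zero_right [simp]: "ip x 0 = 0"
  by (simp_all add: ip_def)

lemma ip_smult_left: "ip (k *s x) y = k * ip x y"
  by (simp add: ip_def sum_distrib_left mult.assoc)

text \<open>
  A constant of its own, so that signs can be multiplied without distinguishing the parities of the exponents.
\<close>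

definition msgn :: "int \<Rightarrow> 'k::field_char_0" where
  "msgn n = (-1) powi n"

lemma msgn_add: "msgn (m + n) = msgn m * msgn n"
  by (simp add: msgn_def power_int_minus_left)

lemma msgn_0 [simp]: "msgn 0 = 1" and msgn_1 [simp]: "msgn 1 = -1"
  by (simp_all add: msgn_def)

lemma msgn_minus [simp]: "msgn (- n) = msgn n"
  by (simp add: msgn_def power_int_minus_left)

lemma msgn_square [simp]: "msgn n * msgn n = 1"
  by (simp add: msgn_def power_int_minus_left)

lemma msgn_square_left [simp]: "msgn n * (msgn n * x) = x"
  by (simp add: msgn_def power_int_minus_left)

lemma msgn_nonzero [simp]: "msgn n \<noteq> 0"
  by (simp add: msgn_def power_int_minus_left)

lemma msgn_eq: "msgn n = (if even n then 1 else -1)"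
  by (simp add: msgn_def power_int_minus_left)

text \<open>
  The factor by which an alternating map changes when two neighbouring arguments of these degrees are exchanged.
\<close>

definition swap_sign :: "int ^ 'n \<Rightarrow> int ^ 'n \<Rightarrow> 'k::field_char_0" where
  "swap_sign x y = - msgn (ip x y)"

lemma swap_sign_commute: "swap_sign x y = swap_sign y x"
  by (simp add: swap_sign_def ip_commute)

lemma swap_sign_square [simp]: "swap_sign x y * swap_sign x y = 1"
  by (simp add: swap_sign_def)

lemma swap_sign_square_left [simp]: "swap_sign x y * (swap_sign x y * c) = c"
  by (simp add: swap_sign_def)

lemma swap_sign_add_right: "swap_sign z (x + y) = - swap_sign z x * swap_sign z y"
  by (simp add: swap_sign_def ip_add_right msgn_add)

context graded_lie_algebra
begin

sublocale vs: vector_space "scl L"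
  by (rule vector_space)

abbreviation hom :: "(int ^ 'n) \<times> 'e \<Rightarrow> bool" where
  "hom z \<equiv> snd z \<in> gr L (fst z)"

abbreviation homs :: "((int ^ 'n) \<times> 'e) list \<Rightarrow> bool" where
  "homs zs \<equiv> (\<forall>z \<in> set zs. hom z)"

section \<open>Alternation by successive insertion\<close>

text \<open>
  The sum over all places at which \<open>z\<close> can be inserted into the list of arguments, with the sign of moving
  \<open>z\<close> to that place. Arguments are pairs of a degree and an element of that degree, so that signs make
  sense for the zero element too.
\<close>

fun ins_sum :: "(int ^ 'n) \<times> 'e \<Rightarrow> (((int ^ 'n) \<times> 'e) list \<Rightarrow> 'e) \<Rightarrow> ((int ^ 'n) \<times> 'e) list \<Rightarrow> 'e" where
  "ins_sum z f [] = f [z]"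
| "ins_sum z f (w # ws) =
     f (z # w # ws) + scl L (swap_sign (fst z) (fst w)) (ins_sum z (\<lambda>vs. f (w # vs)) ws)"

text \<open>
  The signed sum over all permutations of the arguments: a permutation is obtained by inserting
  the arguments one after the other. This recursive form is the one that fits induction on the list of arguments.
\<close>

fun perm_sum :: "(((int ^ 'n) \<times> 'e) list \<Rightarrow> 'e) \<Rightarrow> ((int ^ 'n) \<times> 'e) list \<Rightarrow> 'e" where
  "perm_sum f [] = f []"
| "perm_sum f (z # zs) = perm_sum (ins_sum z f) zs"

definition alternating :: "(((int ^ 'n) \<times> 'e) list \<Rightarrow> 'e) \<Rightarrow> bool" where
  "alternating f \<longleftrightarrow> (\<forall>us z w vs. homs us \<and> hom z \<and> hom w \<and> homs vs \<longrightarrow>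
     f (us @ z # w # vs) = scl L (swap_sign (fst z) (fst w)) (f (us @ w # z # vs)))"

lemma alternatingD:
  "\<lbrakk>alternating f; homs us; hom z; hom w; homs vs\<rbrakk> \<Longrightarrow>
     f (us @ z # w # vs) = scl L (swap_sign (fst z) (fst w)) (f (us @ w # z # vs))"
  unfolding alternating_def by blast

lemma alternatingD0:
  "\<lbrakk>alternating f; hom z; hom w; homs vs\<rbrakk> \<Longrightarrow>
     f (z # w # vs) = scl L (swap_sign (fst z) (fst w)) (f (w # z # vs))"
  by (rule alternatingD[where us = "[]", unfolded append_Nil]) simp_all

lemma alternating_Cons: "\<lbrakk>alternating f; hom z\<rbrakk> \<Longrightarrow> alternating (\<lambda>zs. f (z # zs))"
  unfolding alternating_def
proof (intro allI impI)
  fix us w w' vs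
  assume f: "\<forall>us z w vs. homs us \<and> hom z \<and> hom w \<and> homs vs \<longrightarrow>
     f (us @ z # w # vs) = scl L (swap_sign (fst z) (fst w)) (f (us @ w # z # vs))" and z: "hom z"
    and "homs us \<and> hom w \<and> hom w' \<and> homs vs"
  then show "f (z # us @ w # w' # vs) = scl L (swap_sign (fst w) (fst w')) (f (z # us @ w' # w # vs))"
    using f[rule_format, of "z # us" w w' vs] by simp
qed

lemma alternatingI:
  assumes "\<And>us z w vs. \<lbrakk>homs us; hom z; hom w; homs vs\<rbrakk> \<Longrightarrow>
     f (us @ z # w # vs) = scl L (swap_sign (fst z) (fst w)) (f (us @ w # z # vs))"
  shows "alternating f"
  unfolding alternating_def using assms by blast

lemma ins_sum_add: "ins_sum z (\<lambda>zs. f zs + g zs) zs = ins_sum z f zs + ins_sum z g zs"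
  by (induction zs arbitrary: f g) (simp_all add: vs.scale_right_distrib algebra_simps)

lemma ins_sum_scl: "ins_sum z (\<lambda>zs. scl L r (f zs)) zs = scl L r (ins_sum z f zs)"
  by (induction zs arbitrary: f) (simp_all add: vs.scale_right_distrib mult.commute)

lemma ins_sum_cong:
  assumes "hom z" "homs zs"
    and "\<And>vs. homs vs \<Longrightarrow> length vs = Suc (length zs) \<Longrightarrow> f vs = g vs"
  shows "ins_sum z f zs = ins_sum z g zs"
  using assms
proof (induction zs arbitrary: f g)
  case (Cons w ws)
  have "ins_sum z (\<lambda>vs. f (w # vs)) ws = ins_sum z (\<lambda>vs. g (w # vs)) ws"
    using Cons.prems by (intro Cons.IH) auto
  then show ?case using Cons.prems by auto
qed simp

text \<open>
  Both sides insert the two elements into all pairs of places; the pairs match up, and the two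
  orders differ by the sign of exchanging the elements.
\<close>

lemma ins_sum_swap:
  "ins_sum w (ins_sum z f) zs = scl L (swap_sign (fst z) (fst w)) (ins_sum z (ins_sum w f) zs)"
proof (induction zs arbitrary: f)
  case Nil
  then show ?case
    by (simp add: vs.scale_right_distrib swap_sign_commute[of "fst w"] add.commute)
next
  case (Cons v vs)
  have "ins_sum w (ins_sum z f) (v # vs)
      = f (z # w # v # vs) + scl L (swap_sign (fst z) (fst w)) (f (w # z # v # vs))
        + scl L (swap_sign (fst z) (fst w) * swap_sign (fst z) (fst v)) (ins_sum z (\<lambda>vs. f (w # v # vs)) vs)
        + scl L (swap_sign (fst w) (fst v)) (ins_sum w (\<lambda>vs. f (z # v # vs)) vs)
        + scl L (swap_sign (fst w) (fst v) * swap_sign (fst z) (fst v)) (ins_sum w (ins_sum z (\<lambda>vs. f (v # vs))) vs)"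
    for w z :: "(int ^ 'n) \<times> 'e"
    by (simp add: ins_sum_add ins_sum_scl vs.scale_right_distrib algebra_simps)
  note expand = this
  show ?case
    unfolding expand[of w z] expand[of z w] Cons.IH[of "\<lambda>vs. f (v # vs)"]
    by (simp add: vs.scale_right_distrib swap_sign_commute[of "fst w" "fst z"] mult.left_commute mult.commute add_ac)
qed

lemma perm_sum_add: "perm_sum (\<lambda>zs. f zs + g zs) zs = perm_sum f zs + perm_sum g zs"
proof (induction zs arbitrary: f g)
  case (Cons z zs)
  have "ins_sum z (\<lambda>zs. f zs + g zs) = (\<lambda>zs. ins_sum z f zs + ins_sum z g zs)"
    by (simp add: fun_eq_iff ins_sum_add)
  then show ?case by (simp add: Cons.IH)
qed simp

lemma perm_sum_scl: "perm_sum (\<lambda>zs. scl L r (f zs)) zs = scl L r (perm_sum f zs)"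
proof (induction zs arbitrary: f)
  case (Cons z zs)
  have "ins_sum z (\<lambda>zs. scl L r (f zs)) = (\<lambda>zs. scl L r (ins_sum z f zs))"
    by (simp add: fun_eq_iff ins_sum_scl)
  then show ?case by (simp add: Cons.IH)
qed simp

lemma perm_sum_cong:
  assumes "homs zs" and "\<And>vs. homs vs \<Longrightarrow> length vs = length zs \<Longrightarrow> f vs = g vs"
  shows "perm_sum f zs = perm_sum g zs"
  using assms
proof (induction zs arbitrary: f g)
  case (Cons z zs)
  have "perm_sum (ins_sum z f) zs = perm_sum (ins_sum z g) zs"
    using Cons.prems by (intro Cons.IH ins_sum_cong) auto
  then show ?case by simp
qed simp

text \<open>
  The exchanged neighbours are inserted immediately after each other.
\<close>

lemma perm_sum_swap:
  "perm_sum f (us @ z # w # vs) = scl L (swap_sign (fst z) (fst w)) (perm_sum f (us @ w # z # vs))"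
proof (induction us arbitrary: f)
  case Nil
  have "ins_sum w (ins_sum z f) = (\<lambda>zs. scl L (swap_sign (fst z) (fst w)) (ins_sum z (ins_sum w f) zs))"
    by (rule ext) (rule ins_sum_swap)
  then show ?case by (simp add: perm_sum_scl)
next
  case (Cons u us)
  show ?case unfolding append_Cons perm_sum.simps by (rule Cons.IH)
qed

text \<open>
  Each insertion contributes the same value, since the sign of the insertion undoes the sign of the alternating map.
\<close>

lemma ins_sum_alternating:
  assumes "alternating f" "hom z" "homs zs"
  shows "ins_sum z f zs = scl L (of_nat (Suc (length zs))) (f (z # zs))"
  using assms
proof (induction zs arbitrary: f)
  case (Cons w ws)
  have "ins_sum z (\<lambda>vs. f (w # vs)) ws = scl L (of_nat (Suc (length ws))) (f (w # z # ws))"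
    using Cons.prems by (intro Cons.IH alternating_Cons) auto
  moreover have "f (z # w # ws) = scl L (swap_sign (fst z) (fst w)) (f (w # z # ws))"
    using Cons.prems by (intro alternatingD0) auto
  ultimately show ?case
    by (simp add: vs.scale_left_distrib[symmetric] del: vs.scale_left_distrib) (simp add: distrib_left distrib_right mult.commute)
qed simp

lemma perm_sum_alternating:
  assumes "alternating f" "homs zs"
  shows "perm_sum f zs = scl L (fact (length zs)) (f zs)"
  using assms
proof (induction zs arbitrary: f)
  case (Cons z zs)
  have "perm_sum (ins_sum z f) zs = perm_sum (\<lambda>zs. scl L (of_nat (Suc (length zs))) (f (z # zs))) zs"
    using Cons.prems by (intro perm_sum_cong ins_sum_alternating) auto
  also have "\<dots> = perm_sum (\<lambda>vs. scl L (of_nat (Suc (length zs))) (f (z # vs))) zs"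
    using Cons.prems by (intro perm_sum_cong) auto
  also have "\<dots> = scl L (of_nat (Suc (length zs))) (perm_sum (\<lambda>vs. f (z # vs)) zs)"
    by (rule perm_sum_scl)
  also have "perm_sum (\<lambda>vs. f (z # vs)) zs = scl L (fact (length zs)) (f (z # zs))"
    using Cons.prems by (intro Cons.IH alternating_Cons) auto
  finally show ?case by simp
qed simp


section \<open>The three kinds of insertions in the differential\<close>

lemma scl_two: "scl L 2 X = X + X"
  using vs.scale_left_distrib[of 1 1 X] by simp

lemma scl_two_mult: "scl L (2 * r) X = scl L r X + scl L r X"
  unfolding mult_2 by (rule vs.scale_left_distrib)

lemma brk_add_left: "brk L (X + Y) Z = brk L X Z + brk L Y Z"
  and brk_scl_left: "brk L (scl L r X) Z = scl L r (brk L X Z)"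
  using linear_left[of Z] by (simp_all add: Vector_Spaces.linear_iff)

lemma brk_add_right: "brk L Z (X + Y) = brk L Z X + brk L Z Y"
  and brk_scl_right: "brk L Z (scl L r X) = scl L r (brk L Z X)"
  using linear_right[of Z] by (simp_all add: Vector_Spaces.linear_iff)

lemma brk_zero_left [simp]: "brk L 0 Z = 0" and brk_zero_right [simp]: "brk L Z 0 = 0"
  using brk_scl_left[of 0 0 Z] brk_scl_right[of Z 0 0] by simp_all

lemma brk_minus_right: "brk L Z (- X) = - brk L Z X"
  using brk_scl_right[of Z "-1" X] by simp

lemma brk_sum_left: "brk L (sum f A) Z = (\<Sum>i\<in>A. brk L (f i) Z)"
  by (induction A rule: infinite_finite_induct) (simp_all add: brk_add_left)

lemma brk_sum_right: "brk L Z (sum f A) = (\<Sum>i\<in>A. brk L Z (f i))"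
  by (induction A rule: infinite_finite_induct) (simp_all add: brk_add_right)

lemma gr_0 [simp]: "0 \<in> gr L x"
  and gr_add: "X \<in> gr L x \<Longrightarrow> Y \<in> gr L x \<Longrightarrow> X + Y \<in> gr L x"
  and gr_scl: "X \<in> gr L x \<Longrightarrow> scl L r X \<in> gr L x"
  using subspace[of x] by (auto simp: vs.subspace_def)

lemma gr_minus: "X \<in> gr L x \<Longrightarrow> - X \<in> gr L x"
  using gr_scl[of X x "-1"] by simp

lemma gr_diff: "X \<in> gr L x \<Longrightarrow> Y \<in> gr L x \<Longrightarrow> X - Y \<in> gr L x"
  using gr_add[of X x "- Y"] gr_minus[of Y x] by simp

lemma gr_sum: "(\<And>i. i \<in> A \<Longrightarrow> f i \<in> gr L x) \<Longrightarrow> sum f A \<in> gr L x"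
  by (induction A rule: infinite_finite_induct) (simp_all add: gr_add)

lemma brk_swap:
  "\<lbrakk>X \<in> gr L x; Y \<in> gr L y\<rbrakk> \<Longrightarrow> brk L X Y = scl L (swap_sign x y) (brk L Y X)"
  unfolding swap_sign_def msgn_def vs.scale_minus_left by (rule antisym)

lemma jacobi_msgn:
  "\<lbrakk>X \<in> gr L x; Y \<in> gr L y; Z \<in> gr L z\<rbrakk> \<Longrightarrow>
     brk L X (brk L Y Z) = brk L (brk L X Y) Z + scl L (msgn (ip x y)) (brk L Y (brk L X Z))"
  unfolding msgn_def by (rule jacobi)

definition brk2 :: "(int ^ 'n) \<times> 'e \<Rightarrow> (int ^ 'n) \<times> 'e \<Rightarrow> (int ^ 'n) \<times> 'e" where
  "brk2 z w = (fst z + fst w, brk L (snd z) (snd w))"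

lemma fst_brk2 [simp]: "fst (brk2 z w) = fst z + fst w"
  and snd_brk2 [simp]: "snd (brk2 z w) = brk L (snd z) (snd w)"
  by (simp_all add: brk2_def)

lemma hom_brk2: "\<lbrakk>hom z; hom w\<rbrakk> \<Longrightarrow> hom (brk2 z w)"
  by (simp add: degree)

text \<open>
  The properties of the function on pairs that an alternating cochain of degree \<open>c\<close> induces. The number
  of arguments is left open, so the notion is stable under fixing the first argument.
\<close>

definition alt_form :: "int ^ 'n \<Rightarrow> (((int ^ 'n) \<times> 'e) list \<Rightarrow> 'e) \<Rightarrow> bool" where
  "alt_form c f \<longleftrightarrow> alternating f \<and>
     (\<forall>us x X Y vs. homs us \<and> homs vs \<and> X \<in> gr L x \<and> Y \<in> gr L x \<longrightarrow>
        f (us @ (x, X + Y) # vs) = f (us @ (x, X) # vs) + f (us @ (x, Y) # vs)) \<and>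
     (\<forall>us x X r vs. homs us \<and> homs vs \<and> X \<in> gr L x \<longrightarrow>
        f (us @ (x, scl L r X) # vs) = scl L r (f (us @ (x, X) # vs))) \<and>
     (\<forall>zs. homs zs \<longrightarrow> f zs \<in> gr L (c + sum_list (map fst zs)))"

lemma alt_form_alternating: "alt_form c f \<Longrightarrow> alternating f"
  by (simp add: alt_form_def)

lemma alt_form_add0:
  assumes "alt_form c f" "homs vs" "X \<in> gr L x" "Y \<in> gr L x"
  shows "f ((x, X + Y) # vs) = f ((x, X) # vs) + f ((x, Y) # vs)"
proof -
  have "homs []" by simp
  then show ?thesis
    using assms unfolding alt_form_def by (metis append_Nil)
qed

lemma alt_form_scl0:
  assumes "alt_form c f" "homs vs" "X \<in> gr L x"
  shows "f ((x, scl L r X) # vs) = scl L r (f ((x, X) # vs))"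
proof -
  have "homs []" by simp
  then show ?thesis
    using assms unfolding alt_form_def by (metis append_Nil)
qed

lemma alt_form_zero0: "\<lbrakk>alt_form c f; homs vs\<rbrakk> \<Longrightarrow> f ((x, 0) # vs) = 0"
  using alt_form_scl0[of c f vs 0 x 0] by simp

lemma alt_form_degree: "\<lbrakk>alt_form c f; homs zs\<rbrakk> \<Longrightarrow> f zs \<in> gr L (c + sum_list (map fst zs))"
  by (simp add: alt_form_def)

lemma alt_form_Cons:
  assumes "alt_form c f" "hom z"
  shows "alt_form (c + fst z) (\<lambda>zs. f (z # zs))"
proof -
  have a: "f ((z # us) @ (x, X + Y) # vs) = f ((z # us) @ (x, X) # vs) + f ((z # us) @ (x, Y) # vs)"
    if "homs us" "homs vs" "X \<in> gr L x" "Y \<in> gr L x" for us vs x X Y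
    using assms that unfolding alt_form_def
    by (metis set_ConsD)
  have b: "f ((z # us) @ (x, scl L r X) # vs) = scl L r (f ((z # us) @ (x, X) # vs))"
    if "homs us" "homs vs" "X \<in> gr L x" for us vs x X r
    using assms that unfolding alt_form_def
    by (metis set_ConsD)
  have c: "f (z # zs) \<in> gr L (c + fst z + sum_list (map fst zs))" if "homs zs" for zs
    using alt_form_degree[OF assms(1), of "z # zs"] assms that by (simp add: add.assoc)
  show ?thesis
    unfolding alt_form_def
  proof (intro conjI allI impI)
    show "alternating (\<lambda>zs. f (z # zs))"
      using assms alt_form_alternating alternating_Cons by blast
  qed (use a b c in auto)
qed

lemma alt_form_swap0:
  assumes "alt_form c f" "hom z" "hom w" "homs vs"
  shows "f (z # w # vs) = scl L (swap_sign (fst z) (fst w)) (f (w # z # vs))"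
  using assms alt_form_alternating alternatingD0 by blast

lemma alt_form_brk2_swap:
  assumes "alt_form c f" "hom z" "hom w" "homs vs"
  shows "f (brk2 z w # vs) = scl L (swap_sign (fst z) (fst w)) (f (brk2 w z # vs))"
proof -
  have "brk2 z w = (fst w + fst z, scl L (swap_sign (fst z) (fst w)) (brk L (snd w) (snd z)))"
    unfolding brk2_def using brk_swap[OF assms(2,3)] by (simp add: add.commute)
  then show ?thesis
    using alt_form_scl0[OF assms(1,4), of "brk L (snd w) (snd z)" "fst w + fst z"] degree[OF assms(3,2)]
    by (simp add: brk2_def add.commute)
qed

text \<open>
  The part \<open>j([ , ]) K\<close> of the differential for the bracket inserted into \<open>K\<close>: the alternating sum
  over neighbouring arguments that are replaced by their bracket.
\<close>

fun inner_brk :: "(((int ^ 'n) \<times> 'e) list \<Rightarrow> 'e) \<Rightarrow> ((int ^ 'n) \<times> 'e) list \<Rightarrow> 'e" where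
  "inner_brk f (z # w # zs) = f (brk2 z w # zs) - inner_brk (\<lambda>vs. f (z # vs)) (w # zs)"
| "inner_brk f _ = 0"

text \<open>
  The bracket of \<open>K\<close>, evaluated at all arguments but the last, with the last argument; together with
  \<open>brk_hd\<close> this is \<open>K\<close> inserted into the bracket.
\<close>

fun brk_last :: "(((int ^ 'n) \<times> 'e) list \<Rightarrow> 'e) \<Rightarrow> ((int ^ 'n) \<times> 'e) list \<Rightarrow> 'e" where
  "brk_last f [] = 0"
| "brk_last f [z] = brk L (f []) (snd z)"
| "brk_last f (z # w # zs) = brk_last (\<lambda>vs. f (z # vs)) (w # zs)"

text \<open>
  The bracket of the first argument with \<open>K\<close> at the remaining ones, with the sign of moving \<open>K\<close>, of degree \<open>c\<close>, past the first argument.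
\<close>

fun brk_hd :: "int ^ 'n \<Rightarrow> (((int ^ 'n) \<times> 'e) list \<Rightarrow> 'e) \<Rightarrow> ((int ^ 'n) \<times> 'e) list \<Rightarrow> 'e" where
  "brk_hd c f [] = 0"
| "brk_hd c f (z # zs) = scl L (msgn (ip c (fst z))) (brk L (snd z) (f zs))"

text \<open>
  The sum over all arguments of replacing the argument by its bracket with \<open>a\<close>, with the sign of
  moving \<open>a\<close> to that argument.
\<close>

fun act_sum :: "(int ^ 'n) \<times> 'e \<Rightarrow> (((int ^ 'n) \<times> 'e) list \<Rightarrow> 'e) \<Rightarrow> ((int ^ 'n) \<times> 'e) list \<Rightarrow> 'e" where
  "act_sum a f [] = 0"
| "act_sum a f (z # zs) =
     f (brk2 a z # zs) + scl L (msgn (ip (fst a) (fst z))) (act_sum a (\<lambda>vs. f (z # vs)) zs)"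

lemma ins_sum_minus: "ins_sum z (\<lambda>zs. - f zs) zs = - ins_sum z f zs"
  using ins_sum_scl[of z "-1" f zs] by simp

lemma ins_sum_diff: "ins_sum z (\<lambda>zs. f zs - g zs) zs = ins_sum z f zs - ins_sum z g zs"
  using ins_sum_add[of z f "\<lambda>zs. - g zs" zs] by (simp add: ins_sum_minus)

lemma inner_brk_scl: "inner_brk (\<lambda>zs. scl L r (f zs)) zs = scl L r (inner_brk f zs)"
  by (induction f zs rule: inner_brk.induct) (simp_all add: vs.scale_right_diff_distrib)

lemma inner_brk_cong:
  assumes "homs zs" "\<And>vs. homs vs \<Longrightarrow> Suc (length vs) = length zs \<Longrightarrow> f vs = g vs"
  shows "inner_brk f zs = inner_brk g zs"
  using assms
proof (induction f zs arbitrary: g rule: inner_brk.induct)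
  case (1 f z w zs)
  have "inner_brk (\<lambda>vs. f (z # vs)) (w # zs) = inner_brk (\<lambda>vs. g (z # vs)) (w # zs)"
    using 1 by (intro 1) auto
  moreover have "f (brk2 z w # zs) = g (brk2 z w # zs)"
    using 1 by (auto simp: degree)
  ultimately show ?case by simp
qed auto

lemma act_sum_scl: "act_sum a (\<lambda>zs. scl L r (f zs)) zs = scl L r (act_sum a f zs)"
  by (induction zs arbitrary: f) (simp_all add: vs.scale_right_distrib mult.commute)

lemma brk_last_scl: "brk_last (\<lambda>zs. scl L r (f zs)) zs = scl L r (brk_last f zs)"
  by (induction f zs rule: brk_last.induct) (simp_all add: brk_scl_left)

lemma brk_last_cong:
  assumes "homs zs" "\<And>vs. homs vs \<Longrightarrow> Suc (length vs) = length zs \<Longrightarrow> f vs = g vs"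
  shows "brk_last f zs = brk_last g zs"
  using assms
proof (induction f zs arbitrary: g rule: brk_last.induct)
  case (3 f z w zs)
  have "brk_last (\<lambda>vs. f (z # vs)) (w # zs) = brk_last (\<lambda>vs. g (z # vs)) (w # zs)"
    using 3 by (intro 3) auto
  then show ?case by simp
qed auto

lemma ins_sum_brk: "ins_sum z (\<lambda>zs. brk L X (f zs)) zs = brk L X (ins_sum z f zs)"
  by (induction zs arbitrary: f) (simp_all add: brk_add_right brk_scl_right)

text \<open>
  If \<open>a\<close> is inserted away from the bracketed pair it can be moved to the front of \<open>f\<close>, which gives the
  term with \<open>inner_brk\<close>; if it is inserted next to an argument it is bracketed with this argument, once from each
  side, which gives twice \<open>act_sum\<close>. Induction on the arguments carries out this count.
\<close>

lemma ins_sum_inner_brk: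
  assumes "alt_form c f" "hom a" "homs zs"
  shows "ins_sum a (inner_brk f) zs =
     scl L 2 (act_sum a f zs) - scl L (of_nat (length zs)) (inner_brk (\<lambda>vs. f (a # vs)) zs)"
  using assms
proof (induction zs arbitrary: f c)
  case Nil
  then show ?case by simp
next
  case (Cons z zs)
  note g = \<open>alt_form c f\<close> and a = \<open>hom a\<close>
  from Cons.prems have z: "hom z" and zs: "homs zs" by auto
  let ?s = "swap_sign (fst a) (fst z) :: 'k"
  have az: "f (brk2 z a # zs) = scl L ?s (f (brk2 a z # zs))"
    using alt_form_brk2_swap[OF g z a zs] by (simp add: swap_sign_commute)
  have IH: "ins_sum a (inner_brk (\<lambda>vs. f (z # vs))) zs =
     scl L 2 (act_sum a (\<lambda>vs. f (z # vs)) zs)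
     - scl L (of_nat (length zs)) (inner_brk (\<lambda>vs. f (z # a # vs)) zs)"
    using Cons.IH[OF alt_form_Cons[OF g z] a zs] .
  have sgn: "msgn (ip (fst a) (fst z)) = - ?s" by (simp add: swap_sign_def)
  show ?case
  proof (cases zs)
    case Nil
    then show ?thesis using az
      by (simp add: scl_two)
  next
    case zs': (Cons y ys)
    from zs zs' have y: "hom y" and ys: "homs ys" by auto
    let ?n = "of_nat (length ys) :: 'k"
    have 1: "ins_sum a (\<lambda>vs. inner_brk f (z # vs)) zs
       = ins_sum a (\<lambda>vs. f (brk2 z (hd vs) # tl vs)) zs - ins_sum a (inner_brk (\<lambda>vs. f (z # vs))) zs"
    proof -
      have "ins_sum a (\<lambda>vs. inner_brk f (z # vs)) zs
         = ins_sum a (\<lambda>vs. f (brk2 z (hd vs) # tl vs) - inner_brk (\<lambda>vs. f (z # vs)) vs) zs"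
      proof (rule ins_sum_cong[OF a zs])
        fix vs :: "((int ^ 'n) \<times> 'e) list" assume "length vs = Suc (length zs)"
        then show "inner_brk f (z # vs) = f (brk2 z (hd vs) # tl vs) - inner_brk (\<lambda>vs. f (z # vs)) vs"
          by (cases vs) auto
      qed
      then show ?thesis by (simp add: ins_sum_diff)
    qed
    have 2: "ins_sum a (\<lambda>vs. f (brk2 z y # vs)) ys = scl L (of_nat (Suc (length ys))) (f (brk2 z y # a # ys))"
      by (rule ins_sum_alternating[OF alt_form_alternating[OF alt_form_Cons[OF g hom_brk2[OF z y]]] a ys])
    have 3: "f (a # brk2 z y # ys) = scl L (swap_sign (fst a) (fst z + fst y)) (f (brk2 z y # a # ys))"
      using alt_form_swap0[OF g a hom_brk2[OF z y] ys] by simp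
    have 4: "inner_brk (\<lambda>vs. f (a # z # vs)) zs = scl L ?s (inner_brk (\<lambda>vs. f (z # a # vs)) zs)"
      by (subst inner_brk_scl[symmetric], rule inner_brk_cong[OF zs]) (rule alt_form_swap0[OF g a z])
    define Q where "Q = f (brk2 z y # a # ys)"
    define J where "J = inner_brk (\<lambda>vs. f (z # a # vs)) zs"
    define A where "A = f (brk2 a z # zs)"
    define R where "R = act_sum a (\<lambda>vs. f (z # vs)) zs"
    define t :: 'k where "t = swap_sign (fst a) (fst y)"
    define n :: 'k where "n = of_nat (length zs)"
    have 5: "ins_sum a (\<lambda>vs. f (brk2 z (hd vs) # tl vs)) zs = scl L ?s A + scl L (t * n) Q"
      using az 2 by (simp add: zs' A_def Q_def t_def n_def)
    have 6: "inner_brk (\<lambda>vs. f (a # vs)) (z # zs) = - scl L (?s * t) Q - scl L ?s J"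
      using 3 4 by (simp add: zs' J_def Q_def t_def swap_sign_add_right)
    have "ins_sum a (inner_brk f) (z # zs)
        = A - inner_brk (\<lambda>vs. f (a # vs)) (z # zs) + scl L ?s (ins_sum a (\<lambda>vs. inner_brk f (z # vs)) zs)"
      by (simp add: A_def)
    also have "\<dots> = A - (- scl L (?s * t) Q - scl L ?s J)
        + scl L ?s (scl L ?s A + scl L (t * n) Q - (scl L 2 R - scl L n J))"
      unfolding 6 1 5 IH by (simp add: R_def J_def n_def)
    also have "\<dots> = scl L 2 (A - scl L ?s R) - scl L (1 + n) (- scl L (?s * t) Q - scl L ?s J)"
      by (simp add: algebra_simps scl_two scl_two_mult)
    also have "\<dots> = scl L 2 (act_sum a f (z # zs))
        - scl L (of_nat (length (z # zs))) (inner_brk (\<lambda>vs. f (a # vs)) (z # zs))"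
      unfolding 6 by (simp add: A_def R_def n_def sgn)
    finally show ?thesis .
  qed
qed

text \<open>
  Here the insertion at the last place is the exceptional one; all others contract \<open>f\<close> with \<open>a\<close>.
\<close>

lemma ins_sum_brk_last:
  assumes "alt_form c f" "hom a" "homs zs"
  shows "ins_sum a (brk_last f) zs =
     scl L (of_nat (length zs)) (brk_last (\<lambda>vs. f (a # vs)) zs)
     - scl L ((-1) ^ length zs * msgn (ip (fst a) c)) (brk L (snd a) (f zs))"
  using assms
proof (induction zs arbitrary: f c)
  case Nil
  then have "f [] \<in> gr L c" using alt_form_degree[of c f "[]"] by simp
  then show ?case
    using brk_swap[of "f []" c "snd a" "fst a"] Nil
    by (simp add: swap_sign_def ip_commute)
next
  case (Cons z zs)
  note g = \<open>alt_form c f\<close> and a = \<open>hom a\<close>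
  from Cons.prems have z: "hom z" and zs: "homs zs" by auto
  let ?s = "swap_sign (fst a) (fst z) :: 'k"
  define n :: 'k where "n = of_nat (length zs)"
  have IH: "ins_sum a (brk_last (\<lambda>vs. f (z # vs))) zs =
     scl L n (brk_last (\<lambda>vs. f (z # a # vs)) zs)
     - scl L ((-1) ^ length zs * msgn (ip (fst a) (c + fst z))) (brk L (snd a) (f (z # zs)))"
    unfolding n_def using Cons.IH[OF alt_form_Cons[OF g z] a zs] .
  have 1: "ins_sum a (\<lambda>vs. brk_last f (z # vs)) zs = ins_sum a (brk_last (\<lambda>vs. f (z # vs))) zs"
  proof (rule ins_sum_cong[OF a zs])
    fix vs :: "((int ^ 'n) \<times> 'e) list" assume "length vs = Suc (length zs)"
    then show "brk_last f (z # vs) = brk_last (\<lambda>vs. f (z # vs)) vs" by (cases vs) auto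
  qed
  have 2: "scl L n (brk_last (\<lambda>vs. f (a # vs)) (z # zs)) = scl L (?s * n) (brk_last (\<lambda>vs. f (z # a # vs)) zs)"
  proof (cases zs)
    case (Cons y ys)
    have "brk_last (\<lambda>vs. f (a # z # vs)) zs = scl L ?s (brk_last (\<lambda>vs. f (z # a # vs)) zs)"
      by (subst brk_last_scl[symmetric], rule brk_last_cong[OF zs]) (rule alt_form_swap0[OF g a z])
    then show ?thesis using Cons by (simp add: mult.commute)
  qed (simp add: n_def)
  have "ins_sum a (brk_last f) (z # zs)
      = brk_last (\<lambda>vs. f (a # vs)) (z # zs) + scl L ?s (ins_sum a (\<lambda>vs. brk_last f (z # vs)) zs)"
    by simp
  also have "\<dots> = brk_last (\<lambda>vs. f (a # vs)) (z # zs) + scl L n (brk_last (\<lambda>vs. f (a # vs)) (z # zs))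
       - scl L (?s * ((-1) ^ length zs * msgn (ip (fst a) (c + fst z)))) (brk L (snd a) (f (z # zs)))"
    unfolding 1 IH 2 by (simp add: vs.scale_right_diff_distrib)
  also have "?s * ((-1) ^ length zs * msgn (ip (fst a) (c + fst z))) = (-1) ^ length (z # zs) * msgn (ip (fst a) c)"
    by (simp add: swap_sign_def ip_add_right msgn_add mult_ac)
  finally show ?case
    by (simp add: n_def vs.scale_left_distrib del: brk_last.simps)
qed

lemma ins_sum_brk_hd:
  assumes "alt_form c f" "hom a" "homs zs"
  shows "ins_sum a (brk_hd c f) zs = scl L (msgn (ip (fst a) c)) (brk L (snd a) (f zs))
     - scl L (of_nat (length zs)) (brk_hd (c + fst a) (\<lambda>vs. f (a # vs)) zs)"
proof (cases zs)
  case Nil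
  then show ?thesis by (simp add: ip_commute)
next
  case (Cons z ys)
  note g = \<open>alt_form c f\<close> and a = \<open>hom a\<close>
  from assms Cons have z: "hom z" and ys: "homs ys" by auto
  have "ins_sum a (\<lambda>vs. brk_hd c f (z # vs)) ys
      = scl L (msgn (ip c (fst z))) (brk L (snd z) (ins_sum a f ys))"
    by (simp add: ins_sum_scl ins_sum_brk)
  also have "ins_sum a f ys = scl L (of_nat (Suc (length ys))) (f (a # ys))"
    by (rule ins_sum_alternating[OF alt_form_alternating[OF g] a ys])
  finally show ?thesis
    unfolding Cons
    by (simp add: brk_scl_right swap_sign_def ip_commute[of c] ip_add_left msgn_add mult_ac del: of_nat_Suc)
qed


section \<open>The Cartan formula\<close>

lemma act_sum_cong:
  assumes "hom a" "homs zs" "\<And>vs. homs vs \<Longrightarrow> length vs = length zs \<Longrightarrow> f vs = g vs"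
  shows "act_sum a f zs = act_sum a g zs"
  using assms
proof (induction zs arbitrary: f g)
  case (Cons z zs)
  have "act_sum a (\<lambda>vs. f (z # vs)) zs = act_sum a (\<lambda>vs. g (z # vs)) zs"
    using Cons.prems by (intro Cons.IH) auto
  moreover have "f (brk2 a z # zs) = g (brk2 a z # zs)"
    using Cons.prems by (auto simp: degree)
  ultimately show ?case by simp
qed simp

lemma act_sum_add: "act_sum a (\<lambda>zs. f zs + g zs) zs = act_sum a f zs + act_sum a g zs"
  by (induction zs arbitrary: f g) (simp_all add: vs.scale_right_distrib algebra_simps)

lemma act_sum_diff: "act_sum a (\<lambda>zs. f zs - g zs) zs = act_sum a f zs - act_sum a g zs"
  using act_sum_add[of a f "\<lambda>zs. scl L (-1) (g zs)" zs] unfolding act_sum_scl by simp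

text \<open>
  Exchanging two neighbours commutes with bracketing any other argument, and interchanges the two terms in
  which one of the neighbours is bracketed; the sign of \<open>a\<close> passing the other neighbour is the sign by which
  the degrees of the exchanged arguments differ.
\<close>

lemma act_sum_alternating:
  assumes "alt_form c f" "hom a"
  shows "alternating (act_sum a f)"
proof (rule alternatingI)
  fix us z w vs
  assume us: "homs us" and z: "hom z" and w: "hom w" and vs: "homs vs"
  show "act_sum a f (us @ z # w # vs) = scl L (swap_sign (fst z) (fst w)) (act_sum a f (us @ w # z # vs))"
    using assms us
  proof (induction us arbitrary: c f)
    case Nil
    note g = \<open>alt_form c f\<close> and a = \<open>hom a\<close>
    let ?s = "swap_sign (fst z) (fst w) :: 'k"
    let ?z = "msgn (ip (fst a) (fst z)) :: 'k" and ?w = "msgn (ip (fst a) (fst w)) :: 'k"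
    have 1: "f (brk2 a z # w # vs) = scl L (?w * ?s) (f (w # brk2 a z # vs))"
      using alt_form_swap0[OF g hom_brk2[OF a z] w vs] by (simp add: swap_sign_def ip_add_left msgn_add)
    have 2: "f (z # brk2 a w # vs) = scl L (?z * ?s) (f (brk2 a w # z # vs))"
      using alt_form_swap0[OF g z hom_brk2[OF a w] vs]
      by (simp add: swap_sign_def ip_add_right msgn_add ip_commute[of "fst z" "fst a"])
    have 3: "act_sum a (\<lambda>vs. f (z # w # vs)) vs = scl L ?s (act_sum a (\<lambda>vs. f (w # z # vs)) vs)"
      by (subst act_sum_scl[symmetric], rule act_sum_cong[OF a vs]) (rule alt_form_swap0[OF g z w])
    have 4: "?z * (?z * r) = r" "?w * (?w * r) = r" for r by simp_all
    show ?case
      unfolding append_Nil act_sum.simps 1 2 3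
      by (simp add: vs.scale_right_distrib add_ac mult_ac 4)
  next
    case (Cons u us)
    note g = \<open>alt_form c f\<close> and a = \<open>hom a\<close>
    have u: "hom u" and us: "homs us" using Cons.prems by auto
    have 1: "f (brk2 a u # us @ z # w # vs)
        = scl L (swap_sign (fst z) (fst w)) (f (brk2 a u # us @ w # z # vs))"
      using alternatingD[OF alt_form_alternating[OF g], of "brk2 a u # us" z w vs] us z w vs degree a u by simp
    have 2: "act_sum a (\<lambda>vs. f (u # vs)) (us @ z # w # vs)
        = scl L (swap_sign (fst z) (fst w)) (act_sum a (\<lambda>vs. f (u # vs)) (us @ w # z # vs))"
      by (rule Cons.IH[OF alt_form_Cons[OF g u] a us])
    show ?case
      unfolding append_Cons act_sum.simps 1 2 by (simp add: vs.scale_right_distrib mult.commute)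
  qed
qed

text \<open>
  The integrand of the differential, before alternation, for a cochain with \<open>p\<close> arguments and degree \<open>c\<close>.
\<close>

definition pre_cob :: "nat \<Rightarrow> int ^ 'n \<Rightarrow> (((int ^ 'n) \<times> 'e) list \<Rightarrow> 'e) \<Rightarrow> ((int ^ 'n) \<times> 'e) list \<Rightarrow> 'e" where
  "pre_cob p c f zs = inner_brk f zs + scl L ((-1) ^ p) (brk_last f zs) - brk_hd c f zs"

text \<open>
  The Chevalley-Eilenberg differential of a cochain with \<open>p\<close> arguments. The factor arises from
  \<open>(p + 1)! / (2! p!)\<close> in the definition of the insertion and \<open>1 / (p + 1)!\<close> in alternation.
\<close>

definition cob :: "nat \<Rightarrow> int ^ 'n \<Rightarrow> (((int ^ 'n) \<times> 'e) list \<Rightarrow> 'e) \<Rightarrow> ((int ^ 'n) \<times> 'e) list \<Rightarrow> 'e" where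
  "cob p c f zs = scl L (1 / (2 * fact p)) (perm_sum (pre_cob p c f) zs)"

text \<open>
  Splitting off the first argument \<open>a\<close> in the alternation means inserting it at all places of the integrand. By
  the three insertion formulas this produces \<open>- p\<close> times the integrand for the contraction of \<open>f\<close> with
  \<open>a\<close>, and twice the action of \<open>a\<close> on \<open>f\<close>, which is already alternating.
\<close>

theorem cartan:
  assumes g: "alt_form c f" and a: "hom a" and zs: "homs zs" and p: "length zs = p"
  shows "cob p c f (a # zs) =
     act_sum a f zs - scl L (msgn (ip (fst a) c)) (brk L (snd a) (f zs))
     - (if p = 0 then 0 else cob (p - 1) (c + fst a) (\<lambda>vs. f (a # vs)) zs)"
proof -
  let ?E = "\<lambda>vs. act_sum a f vs - scl L (msgn (ip (fst a) c)) (brk L (snd a) (f vs))"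
  let ?h = "pre_cob (p - 1) (c + fst a) (\<lambda>vs. f (a # vs))"
  have ins: "ins_sum a (pre_cob p c f) vs = scl L 2 (?E vs) + scl L (- of_nat p) (?h vs)"
    if vs: "homs vs" and len: "length vs = p" for vs
  proof -
    have "(-1) ^ p * of_nat p = - (of_nat p * (-1) ^ (p - Suc 0) :: 'k)"
      by (cases p) auto
    then show ?thesis
      unfolding pre_cob_def[abs_def] ins_sum_diff ins_sum_add ins_sum_scl
        ins_sum_inner_brk[OF g a vs] ins_sum_brk_last[OF g a vs] ins_sum_brk_hd[OF g a vs] len
      by (simp add: vs.scale_right_distrib vs.scale_right_diff_distrib scl_two scl_two_mult)
  qed
  have "alternating ?E"
  proof (rule alternatingI)
    fix us z w vs
    assume *: "homs us" "hom z" "hom w" "homs vs"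
    have 1: "act_sum a f (us @ z # w # vs) = scl L (swap_sign (fst z) (fst w)) (act_sum a f (us @ w # z # vs))"
      by (rule alternatingD[OF act_sum_alternating[OF g a] *])
    have 2: "f (us @ z # w # vs) = scl L (swap_sign (fst z) (fst w)) (f (us @ w # z # vs))"
      by (rule alternatingD[OF alt_form_alternating[OF g] *])
    show "?E (us @ z # w # vs) = scl L (swap_sign (fst z) (fst w)) (?E (us @ w # z # vs))"
      unfolding 1 2 by (simp add: brk_scl_right vs.scale_right_diff_distrib mult.commute)
  qed
  then have E: "perm_sum ?E zs = scl L (fact p) (?E zs)"
    using perm_sum_alternating[OF _ zs] p by blast
  have "perm_sum (pre_cob p c f) (a # zs) = perm_sum (\<lambda>vs. scl L 2 (?E vs) + scl L (- of_nat p) (?h vs)) zs"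
    using ins p by (simp, intro perm_sum_cong[OF zs]) simp
  also have "\<dots> = scl L 2 (scl L (fact p) (?E zs)) + scl L (- of_nat p) (perm_sum ?h zs)"
    unfolding perm_sum_add perm_sum_scl E ..
  finally have sum: "perm_sum (pre_cob p c f) (a # zs)
      = scl L 2 (scl L (fact p) (?E zs)) + scl L (- of_nat p) (perm_sum ?h zs)" .
  have "cob p c f (a # zs) = scl L (1 / (2 * fact p) * (2 * fact p)) (?E zs)
      + scl L (1 / (2 * fact p) * - of_nat p) (perm_sum ?h zs)"
    unfolding cob_def sum by (simp only: vs.scale_right_distrib vs.scale_scale mult.assoc)
  then have "cob p c f (a # zs) = ?E zs - scl L (of_nat p / (2 * fact p)) (perm_sum ?h zs)"
    by simp
  moreover have "of_nat p / (2 * fact p) = (1 / (2 * fact (p - 1)) :: 'k)" if "p > 0"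
    using that by (cases p) (simp_all del: of_nat_Suc)
  ultimately show ?thesis
    by (cases "p = 0") (simp_all add: cob_def)
qed

lemma inner_brk_add: "inner_brk (\<lambda>zs. f zs + g zs) zs = inner_brk f zs + inner_brk g zs"
proof (induction f zs arbitrary: g rule: inner_brk.induct)
  case (1 f z w zs)
  show ?case using "1.IH"[of "\<lambda>vs. g (z # vs)"] by simp
qed simp_all

lemma brk_last_add: "brk_last (\<lambda>zs. f zs + g zs) zs = brk_last f zs + brk_last g zs"
  by (induction f zs arbitrary: g rule: brk_last.induct) (simp_all add: brk_add_left)

lemma brk_hd_add: "brk_hd c (\<lambda>zs. f zs + g zs) zs = brk_hd c f zs + brk_hd c g zs"
  by (cases zs) (simp_all add: brk_add_right vs.scale_right_distrib)

lemma brk_hd_scl: "brk_hd c (\<lambda>zs. scl L r (f zs)) zs = scl L r (brk_hd c f zs)"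
  by (cases zs) (simp_all add: brk_scl_right mult.commute)

lemma cob_add: "cob p c (\<lambda>zs. f zs + g zs) zs = cob p c f zs + cob p c g zs"
proof -
  have "pre_cob p c (\<lambda>zs. f zs + g zs) = (\<lambda>zs. pre_cob p c f zs + pre_cob p c g zs)"
    by (simp add: fun_eq_iff pre_cob_def inner_brk_add brk_last_add brk_hd_add vs.scale_right_distrib)
  then show ?thesis by (simp add: cob_def perm_sum_add vs.scale_right_distrib)
qed

lemma cob_scl: "cob p c (\<lambda>zs. scl L r (f zs)) zs = scl L r (cob p c f zs)"
proof -
  have "pre_cob p c (\<lambda>zs. scl L r (f zs)) = (\<lambda>zs. scl L r (pre_cob p c f zs))"
    by (simp add: fun_eq_iff pre_cob_def inner_brk_scl brk_last_scl brk_hd_scl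
        vs.scale_right_distrib vs.scale_right_diff_distrib mult.commute)
  then show ?thesis by (simp add: cob_def perm_sum_scl mult.commute)
qed

lemma cob_diff: "cob p c (\<lambda>zs. f zs - g zs) zs = cob p c f zs - cob p c g zs"
  using cob_add[of p c f "\<lambda>zs. scl L (-1) (g zs)" zs] unfolding cob_scl by simp

section \<open>The action of elements of degree zero\<close>

text \<open>
  The Lie derivative \<open>[a, f] - f([a, \<dots>], \<dots>) - \<dots>\<close>; the formula without signs is the correct one only for \<open>a\<close> of degree \<open>0\<close>.
\<close>

definition act :: "(int ^ 'n) \<times> 'e \<Rightarrow> (((int ^ 'n) \<times> 'e) list \<Rightarrow> 'e) \<Rightarrow> ((int ^ 'n) \<times> 'e) list \<Rightarrow> 'e" where
  "act a f zs = brk L (snd a) (f zs) - act_sum a f zs"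

lemma act_Cons:
  "fst a = 0 \<Longrightarrow> act a f (z # zs) = act a (\<lambda>vs. f (z # vs)) zs - f (brk2 a z # zs)"
  by (simp add: act_def)

lemma act_sum_zero: "act_sum a (\<lambda>zs. 0) zs = 0"
  by (induction zs) simp_all

lemma brk_diff_right: "brk L Z (X - Y) = brk L Z X - brk L Z Y"
  using brk_add_right[of Z X "- Y"] by (simp add: brk_minus_right)

lemma act_cong:
  assumes "hom a" "homs zs" "\<And>vs. homs vs \<Longrightarrow> length vs = length zs \<Longrightarrow> f vs = g vs"
  shows "act a f zs = act a g zs"
  using act_sum_cong[OF assms] assms(2,3) by (simp add: act_def)

lemma act_add: "act a (\<lambda>zs. f zs + g zs) zs = act a f zs + act a g zs"
  by (simp add: act_def act_sum_add brk_add_right)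

lemma act_scl: "act a (\<lambda>zs. scl L r (f zs)) zs = scl L r (act a f zs)"
  by (simp add: act_def act_sum_scl brk_scl_right vs.scale_right_diff_distrib)

lemma act_diff: "act a (\<lambda>zs. f zs - g zs) zs = act a f zs - act a g zs"
  using act_add[of a f "\<lambda>zs. scl L (-1) (g zs)" zs] unfolding act_scl by simp

lemma act_alternating:
  assumes "alt_form c f" "hom a" "fst a = 0"
  shows "alternating (act a f)"
proof (rule alternatingI)
  fix us z w vs
  assume *: "homs us" "hom z" "hom w" "homs vs"
  have 1: "act_sum a f (us @ z # w # vs) = scl L (swap_sign (fst z) (fst w)) (act_sum a f (us @ w # z # vs))"
    by (rule alternatingD[OF act_sum_alternating[OF assms(1,2)] *])
  have 2: "f (us @ z # w # vs) = scl L (swap_sign (fst z) (fst w)) (f (us @ w # z # vs))"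
    by (rule alternatingD[OF alt_form_alternating[OF assms(1)] *])
  show "act a f (us @ z # w # vs) = scl L (swap_sign (fst z) (fst w)) (act a f (us @ w # z # vs))"
    unfolding 1 2 act_def by (simp add: brk_scl_right vs.scale_right_diff_distrib mult.commute)
qed

lemma jacobi_deg0:
  assumes "X \<in> gr L 0" "Y \<in> gr L y" "Z \<in> gr L z"
  shows "brk L X (brk L Y Z) = brk L (brk L X Y) Z + brk L Y (brk L X Z)"
  using jacobi_msgn[OF assms] by simp

lemma jacobi_arg:
  assumes g: "alt_form c f" and a: "hom a" "fst a = 0" and b: "hom b" and z: "hom z" and zs: "homs zs"
  shows "f (brk2 a (brk2 b z) # zs) = f (brk2 (brk2 a b) z # zs) + f (brk2 b (brk2 a z) # zs)"
proof -
  have "brk2 a (brk2 b z) = (fst b + fst z, brk L (brk L (snd a) (snd b)) (snd z) + brk L (snd b) (brk L (snd a) (snd z)))"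
    using jacobi_deg0[of "snd a" "snd b" "fst b" "snd z" "fst z"] a b z by (simp add: brk2_def)
  moreover have "brk2 (brk2 a b) z = (fst b + fst z, brk L (brk L (snd a) (snd b)) (snd z))"
    and "brk2 b (brk2 a z) = (fst b + fst z, brk L (snd b) (brk L (snd a) (snd z)))"
    using a by (simp_all add: brk2_def)
  moreover have "brk L (snd a) (snd b) \<in> gr L (fst b)" "brk L (snd a) (snd z) \<in> gr L (fst z)"
    using degree[of "snd a" 0 "snd b" "fst b"] degree[of "snd a" 0 "snd z" "fst z"] a b z by auto
  ultimately show ?thesis
    using alt_form_add0[OF g zs] degree b z by simp
qed

text \<open>
  The Jacobi identity, applied in each argument.
\<close>

lemma act_act_sum:
  assumes "alt_form c f" "hom a" "fst a = 0" "hom b" "homs zs"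
  shows "act a (act_sum b f) zs = act_sum b (act a f) zs + act_sum (brk2 a b) f zs"
  using assms
proof (induction zs arbitrary: c f)
  case Nil
  then show ?case by (simp add: act_def)
next
  case (Cons z zs)
  note g = \<open>alt_form c f\<close> and a = \<open>hom a\<close> and a0 = \<open>fst a = 0\<close> and b = \<open>hom b\<close>
  have z: "hom z" and zs: "homs zs" using Cons.prems by auto
  let ?s = "msgn (ip (fst b) (fst z)) :: 'k"
  have az: "hom (brk2 a z)" and bz: "hom (brk2 b z)" and ab: "hom (brk2 a b)"
    using a b z degree by auto
  have "act a (act_sum b f) (z # zs)
      = act a (\<lambda>vs. f (brk2 b z # vs)) zs + scl L ?s (act a (act_sum b (\<lambda>vs. f (z # vs))) zs)
        - f (brk2 b (brk2 a z) # zs) - scl L ?s (act_sum b (\<lambda>vs. f (brk2 a z # vs)) zs)"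
    using a0 by (simp add: act_Cons act_add act_scl)
  also have "act a (act_sum b (\<lambda>vs. f (z # vs))) zs
      = act_sum b (act a (\<lambda>vs. f (z # vs))) zs + act_sum (brk2 a b) (\<lambda>vs. f (z # vs)) zs"
    by (rule Cons.IH[OF alt_form_Cons[OF g z] a a0 b zs])
  also have "act_sum b (act a (\<lambda>vs. f (z # vs))) zs
      = act_sum b (\<lambda>vs. act a f (z # vs)) zs + act_sum b (\<lambda>vs. f (brk2 a z # vs)) zs"
    using a0 by (simp add: act_Cons act_sum_diff)
  also have "act a (\<lambda>vs. f (brk2 b z # vs)) zs = act a f (brk2 b z # zs) + f (brk2 a (brk2 b z) # zs)"
    using a0 by (simp add: act_Cons)
  also have "f (brk2 a (brk2 b z) # zs) = f (brk2 (brk2 a b) z # zs) + f (brk2 b (brk2 a z) # zs)"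
    by (rule jacobi_arg[OF g a a0 b z zs])
  finally show ?case
    using a0 by (simp add: vs.scale_right_distrib)
qed

lemma alt_form_lin:
  assumes "alt_form c f" "homs us" "homs vs" "X \<in> gr L x" "Y \<in> gr L x"
  shows "f (us @ (x, scl L r X + Y) # vs) = scl L r (f (us @ (x, X) # vs)) + f (us @ (x, Y) # vs)"
proof -
  have "f (us @ (x, scl L r X + Y) # vs) = f (us @ (x, scl L r X) # vs) + f (us @ (x, Y) # vs)"
    using assms gr_scl[OF assms(4), of r] unfolding alt_form_def by blast
  moreover have "f (us @ (x, scl L r X) # vs) = scl L r (f (us @ (x, X) # vs))"
    using assms unfolding alt_form_def by blast
  ultimately show ?thesis by simp
qed

lemma alt_formI:
  assumes "alternating f"
    and lin: "\<And>us x r X Y vs. \<lbrakk>homs us; homs vs; X \<in> gr L x; Y \<in> gr L x\<rbrakk> \<Longrightarrow>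
      f (us @ (x, scl L r X + Y) # vs) = scl L r (f (us @ (x, X) # vs)) + f (us @ (x, Y) # vs)"
    and "\<And>zs. homs zs \<Longrightarrow> f zs \<in> gr L (c + sum_list (map fst zs))"
  shows "alt_form c f"
proof -
  have zero: "f (us @ (x, 0) # vs) = 0" if "homs us" "homs vs" for us x vs
    using lin[of us vs 0 x 0 1] that by simp
  have "f (us @ (x, scl L r X) # vs) = scl L r (f (us @ (x, X) # vs))"
    if "homs us" "homs vs" "X \<in> gr L x" for us x r X vs
    using lin[of us vs X x 0 r] zero[of us vs x] that by simp
  moreover have "f (us @ (x, X + Y) # vs) = f (us @ (x, X) # vs) + f (us @ (x, Y) # vs)"
    if "homs us" "homs vs" "X \<in> gr L x" "Y \<in> gr L x" for us x X Y vs
    using lin[of us vs X x Y 1] that by simp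
  ultimately show ?thesis
    using assms(1,3) unfolding alt_form_def by blast
qed

lemma act_sum_lin:
  assumes "alt_form c f" "hom a" "homs us" "homs vs" "X \<in> gr L x" "Y \<in> gr L x"
  shows "act_sum a f (us @ (x, scl L r X + Y) # vs)
     = scl L r (act_sum a f (us @ (x, X) # vs)) + act_sum a f (us @ (x, Y) # vs)"
  using assms
proof (induction us arbitrary: c f)
  case Nil
  note g = \<open>alt_form c f\<close> and a = \<open>hom a\<close> and vs = \<open>homs vs\<close> and X = \<open>X \<in> gr L x\<close> and Y = \<open>Y \<in> gr L x\<close>
  have "brk2 a (x, scl L r X + Y) = (fst a + x, scl L r (brk L (snd a) X) + brk L (snd a) Y)"
    by (simp add: brk2_def brk_add_right brk_scl_right)
  then have 1: "f (brk2 a (x, scl L r X + Y) # vs) = scl L r (f (brk2 a (x, X) # vs)) + f (brk2 a (x, Y) # vs)"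
    using alt_form_lin[OF g _ vs, of "[]" "brk L (snd a) X" "fst a + x" "brk L (snd a) Y" r] degree a X Y
    by (simp add: brk2_def)
  have "act_sum a (\<lambda>vs. f ((x, scl L r X + Y) # vs)) vs
      = act_sum a (\<lambda>vs. scl L r (f ((x, X) # vs)) + f ((x, Y) # vs)) vs"
    using alt_form_lin[OF g, of "[]"] X Y by (intro act_sum_cong[OF a vs]) auto
  then show ?case
    using 1 by (simp add: act_sum_add act_sum_scl vs.scale_right_distrib mult.commute)
next
  case (Cons u us)
  note g = \<open>alt_form c f\<close> and a = \<open>hom a\<close> and vs = \<open>homs vs\<close> and X = \<open>X \<in> gr L x\<close> and Y = \<open>Y \<in> gr L x\<close>
  have u: "hom u" and us: "homs us" using Cons.prems by auto
  have 1: "f (brk2 a u # us @ (x, scl L r X + Y) # vs)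
     = scl L r (f (brk2 a u # us @ (x, X) # vs)) + f (brk2 a u # us @ (x, Y) # vs)"
    using alt_form_lin[OF g _ vs X Y, of "brk2 a u # us" r] us a u degree by simp
  show ?case
    unfolding append_Cons act_sum.simps 1 Cons.IH[OF alt_form_Cons[OF g u] a us vs X Y]
    by (simp add: vs.scale_right_distrib mult.commute)
qed

lemma act_sum_degree:
  assumes "alt_form c f" "hom a" "homs zs"
  shows "act_sum a f zs \<in> gr L (fst a + c + sum_list (map fst zs))"
  using assms
proof (induction zs arbitrary: c f)
  case (Cons z zs)
  note g = \<open>alt_form c f\<close> and a = \<open>hom a\<close>
  have z: "hom z" and zs: "homs zs" using Cons.prems by auto
  have "f (brk2 a z # zs) \<in> gr L (c + sum_list (map fst (brk2 a z # zs)))"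
    using alt_form_degree[OF g, of "brk2 a z # zs"] a z zs degree by simp
  moreover have "act_sum a (\<lambda>vs. f (z # vs)) zs \<in> gr L (fst a + (c + fst z) + sum_list (map fst zs))"
    by (rule Cons.IH[OF alt_form_Cons[OF g z] a zs])
  ultimately show ?case
    by (simp add: gr_add gr_scl add_ac)
qed simp

lemma alt_form_act:
  assumes g: "alt_form c f" and a: "hom a" "fst a = 0"
  shows "alt_form c (act a f)"
proof (rule alt_formI)
  show "alternating (act a f)" by (rule act_alternating[OF g a])
  show "act a f (us @ (x, scl L r X + Y) # vs)
     = scl L r (act a f (us @ (x, X) # vs)) + act a f (us @ (x, Y) # vs)"
    if "homs us" "homs vs" "X \<in> gr L x" "Y \<in> gr L x" for us x r X Y vs
    unfolding act_def act_sum_lin[OF g a(1) that] alt_form_lin[OF g that]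
    by (simp add: brk_add_right brk_scl_right vs.scale_right_diff_distrib)
  show "act a f zs \<in> gr L (c + sum_list (map fst zs))" if "homs zs" for zs
    unfolding act_def
    using act_sum_degree[OF g a(1) that] degree[OF a(1) alt_form_degree[OF g that]] a(2)
    by (simp add: gr_diff)
qed

lemma act_sum_brk: "act_sum a (\<lambda>zs. brk L X (f zs)) zs = brk L X (act_sum a f zs)"
  by (induction zs arbitrary: f) (simp_all add: brk_add_right brk_scl_right)

text \<open>
  Both sides are compared after fixing the first argument \<open>b\<close>. The Cartan formula reduces the
  difference to the same statement for the contraction with \<open>b\<close>, by means of \<open>[L_a, i_b] = i_[a,b]\<close> and
  \<open>[L_a, L_b] = L_[a,b]\<close>.
\<close>

theorem cob_act:
  assumes "alt_form c f" "hom a" "fst a = 0" "homs zs" "length zs = Suc p"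
  shows "cob p c (act a f) zs = act a (cob p c f) zs"
  using assms
proof (induction p arbitrary: c f zs rule: less_induct)
  case (less p)
  note g = \<open>alt_form c f\<close> and a = \<open>hom a\<close> and a0 = \<open>fst a = 0\<close>
  obtain b ys where zs: "zs = b # ys"
    using less.prems by (cases zs) auto
  then have ys: "homs ys" and b: "hom b" and len: "length ys = p"
    using less.prems by auto
  show ?case
  proof -
    have IH: "cob (p - 1) (c + fst b) (act a (\<lambda>vs. f (b # vs))) ys
         = act a (cob (p - 1) (c + fst b) (\<lambda>vs. f (b # vs))) ys" if "p \<noteq> 0"
      using that len by (intro less.IH[OF _ alt_form_Cons[OF g b] a a0 ys]) auto
    let ?m = "msgn (ip (fst b) c) :: 'k"
    let ?D = "\<lambda>h zs. if p = 0 then 0 else cob (p - 1) (c + fst b) h zs"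
    have ab: "hom (brk2 a b)"
      using a b by (rule hom_brk2)
    have "cob p c (act a f) (b # ys) = act_sum b (act a f) ys - scl L ?m (brk L (snd b) (act a f ys))
        - ?D (\<lambda>vs. act a f (b # vs)) ys"
      by (rule cartan[OF alt_form_act[OF g a a0] b ys len])
    moreover have "?D (\<lambda>vs. act a f (b # vs)) ys = act a (?D (\<lambda>vs. f (b # vs))) ys - ?D (\<lambda>vs. f (brk2 a b # vs)) ys"
      using IH by (simp add: act_Cons[OF a0] cob_diff zs) (simp add: act_def act_sum_zero)
    moreover have "act a (cob p c f) (b # ys) = act a (\<lambda>vs. act_sum b f vs - scl L ?m (brk L (snd b) (f vs))
        - ?D (\<lambda>vs. f (b # vs)) vs) ys - cob p c f (brk2 a b # ys)"
      unfolding act_Cons[OF a0] using cartan[OF g b] len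
      by (simp, intro act_cong[OF a ys]) simp
    moreover have "cob p c f (brk2 a b # ys) = act_sum (brk2 a b) f ys
        - scl L ?m (brk L (brk L (snd a) (snd b)) (f ys)) - ?D (\<lambda>vs. f (brk2 a b # vs)) ys"
      using cartan[OF g ab ys len] a0 by simp
    moreover have "act a (\<lambda>vs. brk L (snd b) (f vs)) ys
        = brk L (snd b) (act a f ys) + brk L (brk L (snd a) (snd b)) (f ys)"
      using jacobi_deg0[of "snd a" "snd b" _ "f ys", OF _ b alt_form_degree[OF g ys]] a a0
      by (simp add: act_def act_sum_brk brk_add_right brk_diff_right)
    ultimately show ?thesis
      unfolding zs act_diff act_scl act_act_sum[OF g a a0 b ys] by (simp add: vs.scale_right_distrib)
  qed
qed

end

section \<open>Decomposition into homogeneous parts\<close>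

text \<open>
  Subgroups whose sum is direct; differences suffice for the subgroup property, given the zero element.
\<close>

definition independent_family :: "('g \<Rightarrow> 'v::ab_group_add set) \<Rightarrow> bool" where
  "independent_family G \<longleftrightarrow>
     (\<forall>g. 0 \<in> G g) \<and> (\<forall>g. \<forall>u\<in>G g. \<forall>v\<in>G g. u - v \<in> G g) \<and>
     (\<forall>S f. finite S \<longrightarrow> (\<forall>g. f g \<in> G g) \<longrightarrow> sum f S = 0 \<longrightarrow> (\<forall>g\<in>S. f g = 0))"

lemma sum_support:
  "\<lbrakk>finite S; {g. f g \<noteq> 0} \<subseteq> S\<rbrakk> \<Longrightarrow> (\<Sum>g | f g \<noteq> 0. f g) = sum f S"
  by (rule sum.mono_neutral_left) auto

lemma hdecomp_iff:
  "hdecomp G v f \<longleftrightarrow> (\<forall>g. f g \<in> G g) \<and> (\<exists>S. finite S \<and> {g. f g \<noteq> 0} \<subseteq> S \<and> v = sum f S)"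
  unfolding hdecomp_def using sum_support[of _ f] by (metis finite_subset order_refl)

lemma hdecomp_unique:
  assumes G: "independent_family G" and "hdecomp G v f" "hdecomp G v f'"
  shows "f = f'"
proof
  fix g
  obtain S where S: "finite S" "{g. f g \<noteq> 0} \<subseteq> S" "v = sum f S"
    using assms(2) by (auto simp: hdecomp_iff)
  obtain S' where S': "finite S'" "{g. f' g \<noteq> 0} \<subseteq> S'" "v = sum f' S'"
    using assms(3) by (auto simp: hdecomp_iff)
  have "sum f S = sum f (S \<union> S')" "sum f' S' = sum f' (S \<union> S')"
    by (rule sum.mono_neutral_left; use S S' in auto)+
  then have 0: "(\<Sum>g \<in> S \<union> S'. f g - f' g) = 0"
    using S(3) S'(3) by (simp add: sum_subtractf)
  have "\<forall>g. f g - f' g \<in> G g"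
    using assms unfolding hdecomp_def independent_family_def by blast
  then have "\<forall>g \<in> S \<union> S'. f g - f' g = 0"
    using G 0 S(1) S'(1) unfolding independent_family_def by (metis (no_types, lifting) finite_UnI)
  then show "f g = f' g"
    using S(2) S'(2) by (cases "g \<in> S \<union> S'") (simp, metis (mono_tags, lifting) UnCI mem_Collect_eq subsetD)
qed

lemma hcomp_eq: "\<lbrakk>independent_family G; hdecomp G v f\<rbrakk> \<Longrightarrow> hcomp G v = f"
  unfolding hcomp_def using hdecomp_unique by blast

lemma hdecomp_homogeneous:
  assumes "independent_family G" "v \<in> G g"
  shows "hdecomp G v (\<lambda>h. if h = g then v else 0)"
  unfolding hdecomp_iff
  using assms by (auto simp: independent_family_def intro!: exI[of _ "{g}"])

lemma hcomp_homogeneous: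
  "\<lbrakk>independent_family G; v \<in> G g\<rbrakk> \<Longrightarrow> hcomp G v = (\<lambda>h. if h = g then v else 0)"
  by (rule hcomp_eq[OF _ hdecomp_homogeneous])

context graded_lie_algebra
begin

lemma gr_hdecomp: "hdecomp (gr L) X (hcomp (gr L) X)"
  unfolding hcomp_def using theI'[OF direct] .

lemma independent_gr: "independent_family (gr L)"
  unfolding independent_family_def
proof (intro conjI allI ballI impI)
  fix S :: "(int ^ 'n) set" and f g
  assume S: "finite S" and f: "\<forall>g. f g \<in> gr L g" and 0: "sum f S = 0" and g: "g \<in> S"
  have "hdecomp (gr L) 0 (\<lambda>g. if g \<in> S then f g else 0)"
    unfolding hdecomp_iff using S f 0 by (auto intro!: exI[of _ S])
  moreover have "hdecomp (gr L) 0 (\<lambda>g. 0)"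
    unfolding hdecomp_iff by auto
  ultimately have "(\<lambda>g. if g \<in> S then f g else 0) = (\<lambda>g. 0)"
    using direct[of 0] by blast
  then show "f g = 0" using g by metis
qed (auto intro: gr_diff)

lemma hcomp_in_gr [simp]: "hcomp (gr L) X x \<in> gr L x"
  using gr_hdecomp[of X] by (simp add: hdecomp_def)

lemma finite_hsupp [simp]: "finite (hsupp (gr L) X)"
  using gr_hdecomp[of X] by (simp add: hdecomp_def hsupp_def)

lemma sum_hcomp: "\<lbrakk>finite S; hsupp (gr L) X \<subseteq> S\<rbrakk> \<Longrightarrow> X = sum (hcomp (gr L) X) S"
  using gr_hdecomp[of X] sum_support[of S "hcomp (gr L) X"] by (simp add: hdecomp_def hsupp_def)

lemma hcomp_lin:
  "hcomp (gr L) (scl L r X + Y) x = scl L r (hcomp (gr L) X x) + hcomp (gr L) Y x"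
proof -
  let ?S = "hsupp (gr L) X \<union> hsupp (gr L) Y"
  let ?f = "\<lambda>x. scl L r (hcomp (gr L) X x) + hcomp (gr L) Y x"
  have "scl L r X + Y = scl L r (sum (hcomp (gr L) X) ?S) + sum (hcomp (gr L) Y) ?S"
    using sum_hcomp[of ?S X] sum_hcomp[of ?S Y] by simp
  also have "\<dots> = sum ?f ?S"
    by (simp add: vs.scale_sum_right sum.distrib)
  finally have "scl L r X + Y = sum ?f ?S" .
  then have "hdecomp (gr L) (scl L r X + Y) ?f"
    unfolding hdecomp_iff using finite_hsupp[unfolded hsupp_def]
    by (auto intro!: gr_add gr_scl exI[of _ ?S] simp: hsupp_def)
  from hcomp_eq[OF independent_gr this] show ?thesis by simp
qed

section \<open>Multilinear extension from homogeneous arguments\<close>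

text \<open>
  \<open>homog_ext\<close> for a function of lists of pairs, which admits recursion on the list.
\<close>

definition mext :: "(((int ^ 'n) \<times> 'e) list \<Rightarrow> 'e) \<Rightarrow> 'e list \<Rightarrow> 'e" where
  "mext F = homog_ext L (\<lambda>xs Ys. F (zip xs Ys))"

lemma mext_Nil [simp]: "mext F [] = F []"
  by (simp add: mext_def homog_ext_def)

lemma sum_set_Cons:
  "sum f (set_Cons A B) = (\<Sum>x\<in>A. \<Sum>xs\<in>B. f (x # xs))"
proof -
  have "set_Cons A B = (\<lambda>(x, xs). x # xs) ` (A \<times> B)"
    by (auto simp: set_Cons_def)
  moreover have "inj_on (\<lambda>(x, xs). x # xs) (A \<times> B)"
    by (auto simp: inj_on_def)
  ultimately show ?thesis
    by (simp add: sum.reindex sum.cartesian_product case_prod_unfold)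
qed

lemma mext_Cons:
  "mext F (X # Xs) = (\<Sum>x\<in>hsupp (gr L) X. mext (\<lambda>zs. F ((x, hcomp (gr L) X x) # zs)) Xs)"
  by (simp add: mext_def homog_ext_def sum_set_Cons)

lemma homog_ext_eq_mext:
  assumes "\<And>xs Ys. length xs = length Ys \<Longrightarrow> f xs Ys = F (zip xs Ys)"
  shows "homog_ext L f Xs = mext F Xs"
proof -
  have len: "length xs = length As" if "xs \<in> listset As" for xs and As :: "(int ^ 'n) set list"
    using that by (induction As arbitrary: xs) (auto simp: set_Cons_def)
  show ?thesis
    unfolding mext_def homog_ext_def
  proof (rule sum.cong[OF refl])
    fix xs assume "xs \<in> listset (map (hsupp (gr L)) Xs)"
    then have "length xs = length Xs" using len by fastforce
    then show "f xs (map2 (hcomp (gr L)) Xs xs) = F (zip xs (map2 (hcomp (gr L)) Xs xs))"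
      by (intro assms) simp
  qed
qed

lemma mext_cong:
  assumes "\<And>zs. \<lbrakk>homs zs; length zs = length Xs\<rbrakk> \<Longrightarrow> F zs = G zs"
  shows "mext F Xs = mext G Xs"
  using assms
proof (induction Xs arbitrary: F G)
  case (Cons X Xs)
  show ?case
    unfolding mext_Cons
    by (intro sum.cong refl Cons.IH) (simp add: Cons.prems)
qed simp

lemma mext_lin_fun: "mext (\<lambda>zs. scl L r (F zs) + G zs) Xs = scl L r (mext F Xs) + mext G Xs"
  by (induction Xs arbitrary: F G) (simp_all add: mext_Cons sum.distrib vs.scale_sum_right)

lemma mext_zero: "mext (\<lambda>zs. 0) Xs = 0"
  by (induction Xs) (simp_all add: mext_Cons)

definition slotwise_linear :: "(((int ^ 'n) \<times> 'e) list \<Rightarrow> 'e) \<Rightarrow> bool" where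
  "slotwise_linear F \<longleftrightarrow> (\<forall>us x r X Y vs. homs us \<and> homs vs \<and> X \<in> gr L x \<and> Y \<in> gr L x \<longrightarrow>
      F (us @ (x, scl L r X + Y) # vs) = scl L r (F (us @ (x, X) # vs)) + F (us @ (x, Y) # vs))"

lemma slotwise_linearD:
  "\<lbrakk>slotwise_linear F; homs us; homs vs; X \<in> gr L x; Y \<in> gr L x\<rbrakk> \<Longrightarrow>
      F (us @ (x, scl L r X + Y) # vs) = scl L r (F (us @ (x, X) # vs)) + F (us @ (x, Y) # vs)"
  by (simp add: slotwise_linear_def)

lemma slotwise_linearD0:
  "\<lbrakk>slotwise_linear F; homs vs; X \<in> gr L x; Y \<in> gr L x\<rbrakk> \<Longrightarrow>
      F ((x, scl L r X + Y) # vs) = scl L r (F ((x, X) # vs)) + F ((x, Y) # vs)"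
  using slotwise_linearD[of F "[]"] by simp

lemma slotwise_linear_zero0: "\<lbrakk>slotwise_linear F; homs vs\<rbrakk> \<Longrightarrow> F ((x, 0) # vs) = 0"
  using slotwise_linearD0[of F vs 0 x 0 1] by simp

lemma slotwise_linear_Cons: "\<lbrakk>slotwise_linear F; hom z\<rbrakk> \<Longrightarrow> slotwise_linear (\<lambda>zs. F (z # zs))"
  unfolding slotwise_linear_def by (metis append_Cons set_ConsD)

lemma mext_hom:
  assumes "slotwise_linear F" "homs zs"
  shows "mext F (map snd zs) = F zs"
  using assms
proof (induction zs arbitrary: F)
  case (Cons z zs)
  have z: "hom z" and zs: "homs zs" using Cons.prems by auto
  have hc: "hcomp (gr L) (snd z) = (\<lambda>h. if h = fst z then snd z else 0)"
    by (rule hcomp_homogeneous[OF independent_gr z])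
  have F: "F (z # zs) = 0" if "snd z = 0"
    using slotwise_linear_zero0[OF Cons.prems(1) zs, of "fst z"] that by (metis prod.collapse)
  have hs: "hsupp (gr L) (snd z) = (if snd z = 0 then {} else {fst z})"
    unfolding hsupp_def hc by auto
  show ?case
    using F Cons.IH[OF slotwise_linear_Cons[OF Cons.prems(1) z] zs]
    by (simp add: mext_Cons hs hc)
qed simp

text \<open>
  Fixing the first argument reduces linearity in a later argument to that of the fixed function; in the
  first argument it is the linearity of the homogeneous components.
\<close>

lemma mext_lin:
  assumes "slotwise_linear F"
  shows "mext F (us @ (scl L r X + Y) # vs) = scl L r (mext F (us @ X # vs)) + mext F (us @ Y # vs)"
  using assms
proof (induction us arbitrary: F)
  case Nil
  let ?S = "hsupp (gr L) X \<union> hsupp (gr L) Y \<union> hsupp (gr L) (scl L r X + Y)"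
  have ext: "mext F (Z # vs) = (\<Sum>x\<in>?S. mext (\<lambda>zs. F ((x, hcomp (gr L) Z x) # zs)) vs)"
    if "hsupp (gr L) Z \<subseteq> ?S" for Z
    unfolding mext_Cons
  proof (rule sum.mono_neutral_left[OF _ that])
    show "\<forall>x\<in>?S - hsupp (gr L) Z. mext (\<lambda>zs. F ((x, hcomp (gr L) Z x) # zs)) vs = 0"
    proof
      fix x assume "x \<in> ?S - hsupp (gr L) Z"
      then have "hcomp (gr L) Z x = 0" by (simp add: hsupp_def)
      then have "mext (\<lambda>zs. F ((x, hcomp (gr L) Z x) # zs)) vs = mext (\<lambda>zs. 0) vs"
        by (intro mext_cong) (simp add: slotwise_linear_zero0[OF Nil])
      then show "mext (\<lambda>zs. F ((x, hcomp (gr L) Z x) # zs)) vs = 0"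
        by (simp add: mext_zero)
    qed
  qed simp
  have "mext (\<lambda>zs. F ((x, hcomp (gr L) (scl L r X + Y) x) # zs)) vs
      = scl L r (mext (\<lambda>zs. F ((x, hcomp (gr L) X x) # zs)) vs) + mext (\<lambda>zs. F ((x, hcomp (gr L) Y x) # zs)) vs"
    for x
    unfolding mext_lin_fun[symmetric] hcomp_lin
    by (intro mext_cong slotwise_linearD0[OF Nil]) auto
  moreover have "hsupp (gr L) X \<subseteq> ?S" "hsupp (gr L) Y \<subseteq> ?S" "hsupp (gr L) (scl L r X + Y) \<subseteq> ?S"
    by auto
  ultimately show ?case
    unfolding append_Nil by (simp only: ext sum.distrib vs.scale_sum_right)
next
  case (Cons u us)
  have "mext (\<lambda>zs. F ((x, hcomp (gr L) u x) # zs)) (us @ (scl L r X + Y) # vs)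
     = scl L r (mext (\<lambda>zs. F ((x, hcomp (gr L) u x) # zs)) (us @ X # vs))
       + mext (\<lambda>zs. F ((x, hcomp (gr L) u x) # zs)) (us @ Y # vs)" for x
    by (intro Cons.IH slotwise_linear_Cons Cons.prems) simp
  then show ?case
    by (simp add: mext_Cons sum.distrib vs.scale_sum_right)
qed

end

section \<open>Permutations and successive insertion\<close>

text \<open>
  The permutation of \<open>{..n}\<close> with value \<open>0\<close> at \<open>q\<close> which otherwise takes the values of \<open>\<tau>\<close>,
  shifted by one. Every permutation arises in this way from a unique pair \<open>(\<tau>, q)\<close>.
\<close>

definition insert_perm :: "nat \<Rightarrow> (nat \<Rightarrow> nat) \<Rightarrow> nat \<Rightarrow> nat" where
  "insert_perm q \<tau> i = (if i < q then Suc (\<tau> i) else if i = q then 0 else Suc (\<tau> (i - 1)))"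

text \<open>
  The increasing enumeration of the places different from \<open>q\<close>.
\<close>

definition skip :: "nat \<Rightarrow> nat \<Rightarrow> nat" where
  "skip q i = (if i < q then i else Suc i)"

lemma insert_perm_skip [simp]: "insert_perm q \<tau> (skip q i) = Suc (\<tau> i)"
  by (auto simp: insert_perm_def skip_def)

lemma insert_perm_same [simp]: "insert_perm q \<tau> q = 0"
  by (simp add: insert_perm_def)

lemma skip_cases: obtains "i = q" | j where "i = skip q j"
proof (cases "i < q")
  case True
  then show ?thesis using that(2)[of i] by (simp add: skip_def)
next
  case False
  then show ?thesis using that(1) that(2)[of "i - 1"] by (cases "i = q") (auto simp: skip_def)
qed

lemma skip_inject [simp]: "skip q i = skip q j \<longleftrightarrow> i = j"
  and skip_neq [simp]: "skip q i \<noteq> q" "q \<noteq> skip q i"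
  and skip_less [simp]: "skip q i < skip q j \<longleftrightarrow> i < j"
  by (auto simp: skip_def)

lemma skip_bound: "q \<le> n \<Longrightarrow> skip q i < Suc n \<longleftrightarrow> i < n"
  by (auto simp: skip_def)

lemma insert_perm_permutes:
  assumes \<tau>: "\<tau> permutes {..<n}" and q: "q \<le> n"
  shows "insert_perm q \<tau> permutes {..<Suc n}"
proof (rule bij_imp_permutes)
  have inj: "inj_on (insert_perm q \<tau>) {..<Suc n}"
  proof (rule inj_onI)
    fix i j assume eq: "insert_perm q \<tau> i = insert_perm q \<tau> j"
    show "i = j"
      by (cases i q rule: skip_cases; cases j q rule: skip_cases)
        (use eq permutes_inj[OF \<tau>] in \<open>auto simp: inj_eq\<close>)
  qed
  have "insert_perm q \<tau> i < Suc n" if "i < Suc n" for i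
    using that permutes_in_image[OF \<tau>]
    by (cases i q rule: skip_cases) (auto simp: skip_bound[OF q])
  then have "insert_perm q \<tau> ` {..<Suc n} \<subseteq> {..<Suc n}" by auto
  then show "bij_betw (insert_perm q \<tau>) {..<Suc n} {..<Suc n}"
    using inj endo_inj_surj[of "{..<Suc n}" "insert_perm q \<tau>"] by (simp add: bij_betw_def)
  show "insert_perm q \<tau> i = i" if "i \<notin> {..<Suc n}" for i
    using that q permutes_not_in[OF \<tau>, of "i - 1"] by (auto simp: insert_perm_def)
qed

text \<open>
  Injectivity is seen from the place of the value \<open>0\<close>; surjectivity follows by counting both sides.
\<close>

lemma bij_betw_insert_perm:
  "bij_betw (\<lambda>(\<tau>, q). insert_perm q \<tau>) ({\<tau>. \<tau> permutes {..<n}} \<times> {..n}) {\<sigma>. \<sigma> permutes {..<Suc n}}"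
proof -
  let ?A = "{\<tau>. \<tau> permutes {..<n}} \<times> {..n}" and ?h = "\<lambda>(\<tau>, q). insert_perm q \<tau>"
  have inj: "inj_on ?h ?A"
  proof (rule inj_onI, clarify)
    fix \<tau> q \<tau>' q' assume eq: "insert_perm q \<tau> = insert_perm q' \<tau>'"
    have "q = q'"
      using fun_cong[OF eq, of q] by (auto simp: insert_perm_def split: if_splits)
    moreover have "\<tau> i = \<tau>' i" for i
      using fun_cong[OF eq, of "skip q i"] \<open>q = q'\<close> by simp
    ultimately show "\<tau> = \<tau>' \<and> q = q'" by auto
  qed
  have "card {\<tau>. \<tau> permutes {..<n}} = fact n" for n :: nat
    by (rule card_permutations) auto
  then have "card ?A = card {\<sigma>. \<sigma> permutes {..<Suc n}}"
    by (simp add: card_cartesian_product algebra_simps)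
  moreover have "?h ` ?A \<subseteq> {\<sigma>. \<sigma> permutes {..<Suc n}}"
    using insert_perm_permutes by auto
  moreover have "finite {\<sigma>. \<sigma> permutes {..<Suc n}}"
    by (rule finite_permutations) simp
  ultimately have "?h ` ?A = {\<sigma>. \<sigma> permutes {..<Suc n}}"
    using card_image[OF inj] by (metis card_subset_eq)
  with inj show ?thesis by (simp add: bij_betw_def)
qed

lemma perm_sign_swap_sign:
  "perm_sign \<sigma> xs = (\<Prod>(i, j) \<in> {(i, j). i < j \<and> j < length xs \<and> \<sigma> i > \<sigma> j}. swap_sign (xs ! \<sigma> i) (xs ! \<sigma> j))"
  by (simp add: perm_sign_def swap_sign_def msgn_def)

text \<open>
  The inversions of the extended permutation are those that involve the place \<open>q\<close> of the value \<open>0\<close>, namely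
  with every earlier place, and those of \<open>\<tau>\<close>.
\<close>

lemma perm_sign_insert_perm:
  assumes q: "q \<le> length xs" and \<tau>: "\<tau> permutes {..<length xs}"
  shows "perm_sign (insert_perm q \<tau>) (x # xs) = (\<Prod>i<q. swap_sign x (xs ! \<tau> i)) * perm_sign \<tau> xs"
proof -
  let ?I = "{(i, j). i < j \<and> j < length xs \<and> \<tau> i > \<tau> j}"
  let ?J = "{(i, j). i < j \<and> j < length (x # xs) \<and> insert_perm q \<tau> i > insert_perm q \<tau> j}"
  let ?A = "(\<lambda>i. (i, q)) ` {..<q}" and ?B = "map_prod (skip q) (skip q) ` ?I"
  let ?w = "\<lambda>(i, j). swap_sign ((x # xs) ! insert_perm q \<tau> i) ((x # xs) ! insert_perm q \<tau> j)"
  have fin: "finite ?I"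
    by (rule finite_subset[of _ "{..<length xs} \<times> {..<length xs}"]) auto
  have sub: "(i, j) \<in> ?A \<union> ?B" if ij: "i < j" "j < length (x # xs)" "insert_perm q \<tau> j < insert_perm q \<tau> i" for i j
  proof -
    show ?thesis
    proof (cases j q rule: skip_cases)
      case 1
      then show ?thesis using ij by auto
    next
      case j: (2 j')
      then show ?thesis
      proof (cases i q rule: skip_cases)
        case 1
        then show ?thesis using ij by simp
      next
        case (2 i')
        then have "(i', j') \<in> ?I" using ij j q by (simp add: skip_bound)
        then show ?thesis using 2 j by force
      qed
    qed
  qed
  have "?A \<subseteq> ?J"
    using q by (auto simp: insert_perm_def)
  moreover have "?B \<subseteq> ?J"
    using q by (auto simp: skip_bound)
  ultimately have "?J = ?A \<union> ?B"
    using sub by blast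
  then have "perm_sign (insert_perm q \<tau>) (x # xs) = prod ?w (?A \<union> ?B)"
    unfolding perm_sign_swap_sign by simp
  also have "\<dots> = prod ?w ?A * prod ?w ?B"
    using fin by (intro prod.union_disjoint) auto
  also have "prod ?w ?A = (\<Prod>i<q. swap_sign x (xs ! \<tau> i))"
    by (subst prod.reindex) (auto simp: inj_on_def insert_perm_def swap_sign_commute intro!: prod.cong)
  also have "prod ?w ?B = perm_sign \<tau> xs"
    unfolding perm_sign_swap_sign
    by (subst prod.reindex) (auto simp: inj_on_def intro!: prod.cong)
  finally show ?thesis .
qed

context graded_lie_algebra
begin

lemma ins_sum_eq:
  "ins_sum z f ws =
     (\<Sum>q\<le>length ws. scl L (\<Prod>i<q. swap_sign (fst z) (fst (ws ! i))) (f (take q ws @ z # drop q ws)))"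
proof (induction ws arbitrary: f)
  case (Cons w ws)
  show ?case
    unfolding ins_sum.simps Cons.IH[of "\<lambda>vs. f (w # vs)"] length_Cons sum.atMost_Suc_shift
    by (simp add: vs.scale_sum_right prod.lessThan_Suc_shift del: prod.lessThan_Suc)
qed simp

text \<open>
  The place of the first argument and the permutation of the others determine a permutation, and the sign factors accordingly.
\<close>

lemma sum_permutes_eq_perm_sum:
  "(\<Sum>\<sigma> | \<sigma> permutes {..<length zs}. scl L (perm_sign \<sigma> (map fst zs)) (f (map (\<lambda>i. zs ! \<sigma> i) [0..<length zs])))
     = perm_sum f zs"
proof (induction zs arbitrary: f)
  case Nil
  show ?case by (simp add: perm_sign_def)
next
  case (Cons z zs)
  let ?n = "length zs"
  define W where "W = (\<lambda>\<tau>. map (\<lambda>i. zs ! \<tau> i) [0..<?n])"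
  have list: "map (\<lambda>i. (z # zs) ! insert_perm q \<tau> i) [0..<Suc ?n] = take q (W \<tau>) @ z # drop q (W \<tau>)"
    if "q \<le> ?n" for q \<tau>
  proof (rule nth_equalityI)
    fix i assume "i < length (map (\<lambda>i. (z # zs) ! insert_perm q \<tau> i) [0..<Suc ?n])"
    then have "i < Suc ?n" by simp
    then show "map (\<lambda>i. (z # zs) ! insert_perm q \<tau> i) [0..<Suc ?n] ! i = (take q (W \<tau>) @ z # drop q (W \<tau>)) ! i"
      using that by (auto simp: W_def insert_perm_def nth_append nth_Cons' simp del: upt_Suc)
  qed (use that in \<open>simp add: W_def\<close>)
  have sgn: "perm_sign (insert_perm q \<tau>) (map fst (z # zs))
      = (\<Prod>i<q. swap_sign (fst z) (fst (W \<tau> ! i))) * (perm_sign \<tau> (map fst zs) :: 'k)"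
    if \<tau>: "\<tau> permutes {..<?n}" and q: "q \<le> ?n" for q \<tau>
  proof -
    have "(map fst zs) ! \<tau> i = fst (W \<tau> ! i)" if "i < q" for i
      using that q permutes_in_image[OF \<tau>, of i] by (simp add: W_def)
    then show ?thesis
      using perm_sign_insert_perm[of q "map fst zs" \<tau> "fst z"] \<tau> q by simp
  qed
  let ?t = "\<lambda>\<sigma>. scl L (perm_sign \<sigma> (map fst (z # zs))) (f (map (\<lambda>i. (z # zs) ! \<sigma> i) [0..<length (z # zs)]))"
  have "(\<Sum>\<sigma> | \<sigma> permutes {..<length (z # zs)}. ?t \<sigma>)
      = (\<Sum>(\<tau>, q) \<in> {\<tau>. \<tau> permutes {..<?n}} \<times> {..?n}. ?t (insert_perm q \<tau>))"
    using sum.reindex_bij_betw[OF bij_betw_insert_perm[of ?n], of ?t] by (simp add: case_prod_unfold)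
  also have "\<dots> = (\<Sum>(\<tau>, q) \<in> {\<tau>. \<tau> permutes {..<?n}} \<times> {..?n}.
      scl L (perm_sign \<tau> (map fst zs)) (scl L (\<Prod>i<q. swap_sign (fst z) (fst (W \<tau> ! i)))
        (f (take q (W \<tau>) @ z # drop q (W \<tau>)))))"
    by (rule sum.cong) (auto simp: sgn list mult.commute simp del: upt_Suc list.map)
  also have "\<dots> = (\<Sum>\<tau> | \<tau> permutes {..<?n}. scl L (perm_sign \<tau> (map fst zs)) (ins_sum z f (W \<tau>)))"
    by (simp add: sum.cartesian_product[symmetric] ins_sum_eq vs.scale_sum_right[symmetric] W_def
        del: vs.scale_scale)
  also have "\<dots> = perm_sum (ins_sum z f) zs"
    unfolding W_def by (rule Cons.IH)
  finally show ?case by simp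
qed


section \<open>Alternating cochains\<close>

abbreviation lift :: "('e list \<Rightarrow> 'e) \<Rightarrow> ((int ^ 'n) \<times> 'e) list \<Rightarrow> 'e" where
  "lift K \<equiv> \<lambda>zs. K (map snd zs)"

definition multilinear :: "('e list \<Rightarrow> 'e) \<Rightarrow> bool" where
  "multilinear K \<longleftrightarrow> (\<forall>us r X Y vs. K (us @ (scl L r X + Y) # vs) = scl L r (K (us @ X # vs)) + K (us @ Y # vs))"

lemma multilinearD:
  "multilinear K \<Longrightarrow> K (us @ (scl L r X + Y) # vs) = scl L r (K (us @ X # vs)) + K (us @ Y # vs)"
  by (simp add: multilinear_def)

lemma multilinearD0:
  "multilinear K \<Longrightarrow> K ((scl L r X + Y) # vs) = scl L r (K (X # vs)) + K (Y # vs)"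
  using multilinearD[of K "[]"] by simp

lemma multilinear_add0: "multilinear K \<Longrightarrow> K ((X + Y) # vs) = K (X # vs) + K (Y # vs)"
  using multilinearD0[of K 1 X Y] by simp

lemma multilinear_zero0: "multilinear K \<Longrightarrow> K (0 # vs) = 0"
  using multilinearD0[of K 1 0 0] by simp

lemma multilinear_scl0: "multilinear K \<Longrightarrow> K (scl L r X # vs) = scl L r (K (X # vs))"
  using multilinearD0[of K r X 0] by (simp add: multilinear_zero0)

lemma multilinear_sum0: "multilinear K \<Longrightarrow> K (sum f A # vs) = (\<Sum>i\<in>A. K (f i # vs))"
  by (induction A rule: infinite_finite_induct) (simp_all add: multilinear_add0 multilinear_zero0)

lemma multilinear_Cons: "multilinear K \<Longrightarrow> multilinear (\<lambda>Xs. K (X # Xs))"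
  unfolding multilinear_def by (metis append_Cons)

lemma linear_iff_lin:
  "Vector_Spaces.linear (scl L) (scl L) f \<longleftrightarrow> (\<forall>r X Y. f (scl L r X + Y) = scl L r (f X) + f Y)"
proof
  assume lin: "\<forall>r X Y. f (scl L r X + Y) = scl L r (f X) + f Y"
  have "f 0 = 0" using lin[rule_format, of 1 0 0] by simp
  then show "Vector_Spaces.linear (scl L) (scl L) f"
    using lin[rule_format, of 1] lin[rule_format, of _ _ 0]
    by (simp add: Vector_Spaces.linear_iff vector_space)
qed (simp add: Vector_Spaces.linear_iff)

lemma list_all2_hom: "list_all2 (\<lambda>x X. X \<in> gr L x) xs Xs \<longleftrightarrow> length xs = length Xs \<and> homs (zip xs Xs)"
  by (auto simp: list_all2_iff)

text \<open>
  Since a cochain vanishes on lists of the wrong length, linearity in each argument and compatibility with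
  degrees can be stated for lists of any length.
\<close>

lemma multilin_iff:
  "K \<in> multilin L (k, c) \<longleftrightarrow>
     (\<forall>Xs. int (length Xs) \<noteq> k + 1 \<longrightarrow> K Xs = 0) \<and> multilinear K \<and>
     (\<forall>zs. homs zs \<longrightarrow> lift K zs \<in> gr L (c + sum_list (map fst zs)))"
proof (cases "\<forall>Xs. int (length Xs) \<noteq> k + 1 \<longrightarrow> K Xs = 0")
  case len: True
  have "(\<forall>Xs i. int (length Xs) = k + 1 \<and> i < length Xs \<longrightarrow>
        Vector_Spaces.linear (scl L) (scl L) (\<lambda>X. K (Xs[i := X]))) \<longleftrightarrow> multilinear K" (is "?A \<longleftrightarrow> _")
  proof
    assume A: ?A
    show "multilinear K"
      unfolding multilinear_def
    proof (intro allI)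
      fix us r X Y vs
      show "K (us @ (scl L r X + Y) # vs) = scl L r (K (us @ X # vs)) + K (us @ Y # vs)"
      proof (cases "int (length (us @ X # vs)) = k + 1")
        case True
        then show ?thesis
          using A[rule_format, of "us @ X # vs" "length us"] by (simp add: linear_iff_lin)
      next
        case False
        then show ?thesis using len by simp
      qed
    qed
  next
    assume K: "multilinear K"
    show ?A
    proof (intro allI impI)
      fix Xs :: "'e list" and i assume "int (length Xs) = k + 1 \<and> i < length Xs"
      then have "Xs[i := X] = take i Xs @ X # drop (Suc i) Xs" for X
        by (simp add: upd_conv_take_nth_drop)
      then show "Vector_Spaces.linear (scl L) (scl L) (\<lambda>X. K (Xs[i := X]))"
        unfolding linear_iff_lin using K by (simp add: multilinear_def)
    qed
  qed
  moreover have "(\<forall>xs Xs. int (length Xs) = k + 1 \<and> list_all2 (\<lambda>x X. X \<in> gr L x) xs Xs \<longrightarrow>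
        K Xs \<in> gr L (sum_list xs + c)) \<longleftrightarrow>
      (\<forall>zs. homs zs \<longrightarrow> lift K zs \<in> gr L (c + sum_list (map fst zs)))" (is "?B \<longleftrightarrow> ?C")
  proof
    assume B: ?B
    show ?C
    proof (intro allI impI)
      fix zs :: "((int ^ 'n) \<times> 'e) list" assume "homs zs"
      then have "list_all2 (\<lambda>x X. X \<in> gr L x) (map fst zs) (map snd zs)"
        unfolding list_all2_hom zip_map_fst_snd by simp
      then show "lift K zs \<in> gr L (c + sum_list (map fst zs))"
        using B len by (cases "int (length zs) = k + 1") (auto simp: add.commute)
    qed
  next
    assume C: ?C
    show ?B
    proof (intro allI impI, elim conjE)
      fix xs Xs assume "list_all2 (\<lambda>x X. X \<in> gr L x) xs Xs"
      then show "K Xs \<in> gr L (sum_list xs + c)"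
        using C[rule_format, of "zip xs Xs"] by (simp add: list_all2_hom add.commute)
    qed
  qed
  ultimately show ?thesis
    using len by (simp add: multilin_def)
qed (auto simp: multilin_def)

lemma slotwise_linear_lift: "multilinear K \<Longrightarrow> slotwise_linear (lift K)"
  by (simp add: slotwise_linear_def multilinear_def)

lemma multilinear_mext: "slotwise_linear F \<Longrightarrow> multilinear (mext F)"
  unfolding multilinear_def using mext_lin by blast

lemma mext_lift:
  assumes "multilinear K" shows "mext (lift K) Xs = K Xs"
  using assms
proof (induction Xs arbitrary: K)
  case (Cons X Xs)
  have "mext (lift K) (X # Xs) = (\<Sum>x\<in>hsupp (gr L) X. K (hcomp (gr L) X x # Xs))"
    unfolding mext_Cons using Cons.IH[OF multilinear_Cons[OF Cons.prems]] by simp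
  also have "\<dots> = K ((\<Sum>x\<in>hsupp (gr L) X. hcomp (gr L) X x) # Xs)"
    by (rule multilinear_sum0[OF Cons.prems, symmetric])
  also have "(\<Sum>x\<in>hsupp (gr L) X. hcomp (gr L) X x) = X"
    by (rule sum_hcomp[symmetric]) simp_all
  finally show ?case .
qed simp

lemma multilinear_eqI:
  assumes "multilinear K" "multilinear K'" "\<And>zs. homs zs \<Longrightarrow> lift K zs = lift K' zs"
  shows "K = K'"
proof
  fix Xs
  have "mext (lift K) Xs = mext (lift K') Xs"
    by (rule mext_cong) (rule assms(3))
  then show "K Xs = K' Xs" using assms by (simp add: mext_lift)
qed

lemma slotwise_linear_ins_sum:
  assumes "slotwise_linear f" "hom z"
  shows "slotwise_linear (ins_sum z f)"
  unfolding slotwise_linear_def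
proof (intro allI impI, elim conjE)
  fix us x r X Y vs
  assume "homs us" and vs: "homs vs" and X: "X \<in> gr L x" and Y: "Y \<in> gr L x"
  then show "ins_sum z f (us @ (x, scl L r X + Y) # vs) =
      scl L r (ins_sum z f (us @ (x, X) # vs)) + ins_sum z f (us @ (x, Y) # vs)"
    using assms
  proof (induction us arbitrary: f)
    case Nil
    have "ins_sum z (\<lambda>ws. f ((x, scl L r X + Y) # ws)) vs
        = ins_sum z (\<lambda>ws. scl L r (f ((x, X) # ws)) + f ((x, Y) # ws)) vs"
      using Nil by (intro ins_sum_cong slotwise_linearD0) auto
    moreover have "f (z # (x, scl L r X + Y) # vs) = scl L r (f (z # (x, X) # vs)) + f (z # (x, Y) # vs)"
      using slotwise_linearD[OF Nil(5), of "[z]" vs] Nil by simp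
    ultimately show ?case
      by (simp add: ins_sum_add ins_sum_scl vs.scale_right_distrib mult.commute)
  next
    case (Cons u us)
    have "ins_sum z (\<lambda>vs. f (u # vs)) (us @ (x, scl L r X + Y) # vs) =
      scl L r (ins_sum z (\<lambda>vs. f (u # vs)) (us @ (x, X) # vs)) + ins_sum z (\<lambda>vs. f (u # vs)) (us @ (x, Y) # vs)"
      using Cons.prems by (intro Cons.IH slotwise_linear_Cons) auto
    moreover have "f (z # u # us @ (x, scl L r X + Y) # vs)
      = scl L r (f (z # u # us @ (x, X) # vs)) + f (z # u # us @ (x, Y) # vs)"
      using slotwise_linearD[OF Cons.prems(5), of "z # u # us" vs] Cons.prems by simp
    ultimately show ?case
      by (simp add: vs.scale_right_distrib mult.commute)
  qed
qed

lemma slotwise_linear_perm_sum: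
  assumes "slotwise_linear f"
  shows "slotwise_linear (perm_sum f)"
  unfolding slotwise_linear_def
proof (intro allI impI, elim conjE)
  fix us x r X Y vs
  assume "homs us" and vs: "homs vs" and X: "X \<in> gr L x" and Y: "Y \<in> gr L x"
  then show "perm_sum f (us @ (x, scl L r X + Y) # vs) =
      scl L r (perm_sum f (us @ (x, X) # vs)) + perm_sum f (us @ (x, Y) # vs)"
    using assms
  proof (induction us arbitrary: f)
    case Nil
    have "ins_sum (x, scl L r X + Y) f ws = scl L r (ins_sum (x, X) f ws) + ins_sum (x, Y) f ws"
      if "homs ws" for ws
      using that Nil(5)
    proof (induction ws arbitrary: f)
      case (Cons w ws)
      have "ins_sum (x, scl L r X + Y) (\<lambda>vs. f (w # vs)) ws
          = scl L r (ins_sum (x, X) (\<lambda>vs. f (w # vs)) ws) + ins_sum (x, Y) (\<lambda>vs. f (w # vs)) ws"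
        using Cons.prems by (intro Cons.IH slotwise_linear_Cons) auto
      then show ?case
        using slotwise_linearD0[OF Cons.prems(2,1) X Y]
        by (simp add: vs.scale_right_distrib mult.commute)
    qed (use slotwise_linearD0[OF _ _ X Y, of _ "[]"] in simp)
    then have "perm_sum (ins_sum (x, scl L r X + Y) f) vs
        = perm_sum (\<lambda>ws. scl L r (ins_sum (x, X) f ws) + ins_sum (x, Y) f ws) vs"
      by (intro perm_sum_cong[OF vs]) simp
    then show ?case
      by (simp add: perm_sum_add perm_sum_scl)
  next
    case (Cons u us)
    then show ?case by (simp add: slotwise_linear_ins_sum)
  qed
qed

lemma slotwise_linear_scl: "slotwise_linear f \<Longrightarrow> slotwise_linear (\<lambda>zs. scl L (g (length zs)) (f zs))"
  by (simp add: slotwise_linear_def vs.scale_right_distrib mult.commute)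

lemma ins_sum_degree:
  assumes "\<And>zs. homs zs \<Longrightarrow> f zs \<in> gr L (c + sum_list (map fst zs))" "hom z" "homs zs"
  shows "ins_sum z f zs \<in> gr L (c + fst z + sum_list (map fst zs))"
  using assms
proof (induction zs arbitrary: f c)
  case Nil
  then show ?case using Nil(1)[of "[z]"] by simp
next
  case (Cons w ws)
  have "ins_sum z (\<lambda>vs. f (w # vs)) ws \<in> gr L (c + fst w + fst z + sum_list (map fst ws))"
  proof (rule Cons.IH)
    show "f (w # vs) \<in> gr L (c + fst w + sum_list (map fst vs))" if "homs vs" for vs
      using Cons.prems(1)[of "w # vs"] Cons.prems(3) that by (simp add: add.assoc)
  qed (use Cons.prems in auto)
  moreover have "f (z # w # ws) \<in> gr L (c + sum_list (map fst (z # w # ws)))"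
    using Cons.prems by (intro Cons.prems(1)) auto
  ultimately show ?case
    by (auto intro!: gr_add gr_scl simp: add_ac)
qed

lemma perm_sum_degree:
  assumes "\<And>zs. homs zs \<Longrightarrow> f zs \<in> gr L (c + sum_list (map fst zs))" "homs zs"
  shows "perm_sum f zs \<in> gr L (c + sum_list (map fst zs))"
  using assms
proof (induction zs arbitrary: f c)
  case (Cons z zs)
  have "perm_sum (ins_sum z f) zs \<in> gr L (c + fst z + sum_list (map fst zs))"
    using Cons.prems by (intro Cons.IH ins_sum_degree) auto
  then show ?case by (simp add: add.assoc)
next
  case Nil
  then show ?case using Nil(1)[of "[]"] by simp
qed

lemma alt_eq_mext:
  "alt L K = mext (\<lambda>zs. scl L (1 / fact (length zs)) (perm_sum (lift K) zs))"
  unfolding alt_def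
proof (rule ext, rule homog_ext_eq_mext)
  fix xs :: "(int ^ 'n) list" and Ys :: "'e list"
  assume len: "length xs = length Ys"
  let ?n = "length Ys"
  have "map snd (map (\<lambda>i. zip xs Ys ! \<sigma> i) [0..<?n]) = map (\<lambda>i. Ys ! \<sigma> i) [0..<?n]"
    if "\<sigma> permutes {..<?n}" for \<sigma>
    using permutes_in_image[OF that] len by auto
  then have "(\<Sum>\<sigma> | \<sigma> permutes {..<?n}. scl L (perm_sign \<sigma> xs) (K (map (\<lambda>i. Ys ! \<sigma> i) [0..<?n])))
      = (\<Sum>\<sigma> | \<sigma> permutes {..<?n}. scl L (perm_sign \<sigma> xs) (lift K (map (\<lambda>i. zip xs Ys ! \<sigma> i) [0..<?n])))"
    by (intro sum.cong refl arg_cong2[where f = "scl L"] arg_cong[where f = K]) simp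
  also have "\<dots> = perm_sum (lift K) (zip xs Ys)"
    using sum_permutes_eq_perm_sum[of "zip xs Ys" "lift K"] len by simp
  finally have "(\<Sum>\<sigma> | \<sigma> permutes {..<?n}. scl L (perm_sign \<sigma> xs) (K (map (\<lambda>i. Ys ! \<sigma> i) [0..<?n])))
      = perm_sum (lift K) (zip xs Ys)" .
  then show "scl L (1 / fact ?n) (\<Sum>\<sigma> | \<sigma> permutes {..<?n}. scl L (perm_sign \<sigma> xs) (K (map (\<lambda>i. Ys ! \<sigma> i) [0..<?n])))
      = scl L (1 / fact (length (zip xs Ys))) (perm_sum (lift K) (zip xs Ys))"
    using len by simp
qed

lemma multilinear_alt: "multilinear K \<Longrightarrow> multilinear (alt L K)"
  unfolding alt_eq_mext
  by (intro multilinear_mext slotwise_linear_scl[of _ "\<lambda>n. 1 / fact n"] slotwise_linear_perm_sum slotwise_linear_lift)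

lemma alt_hom:
  assumes "multilinear K" "homs zs"
  shows "lift (alt L K) zs = scl L (1 / fact (length zs)) (perm_sum (lift K) zs)"
  unfolding alt_eq_mext using assms
  by (intro mext_hom slotwise_linear_scl[of _ "\<lambda>n. 1 / fact n"] slotwise_linear_perm_sum slotwise_linear_lift)

lemma alt_length:
  assumes "multilinear K" "\<And>Xs. length Xs = n \<Longrightarrow> K Xs = 0" "length Xs = n"
  shows "alt L K Xs = 0"
proof -
  have "alt L K Xs = mext (\<lambda>zs. 0) Xs"
    unfolding alt_eq_mext
  proof (rule mext_cong)
    fix zs :: "((int ^ 'n) \<times> 'e) list" assume zs: "homs zs" "length zs = length Xs"
    have "perm_sum (lift K) zs = perm_sum (\<lambda>_. scl L 0 0) zs"
      using zs assms by (intro perm_sum_cong) auto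
    then show "scl L (1 / fact (length zs)) (perm_sum (lift K) zs) = 0"
      unfolding perm_sum_scl by simp
  qed
  then show ?thesis by (simp add: mext_zero)
qed

text \<open>
  The image of alternation consists of the alternating maps, because alternation produces alternating maps and
  fixes them.
\<close>

lemma cochains_iff:
  "K \<in> cochains L (k, c) \<longleftrightarrow> K \<in> multilin L (k, c) \<and> alternating (lift K)"
proof
  assume "K \<in> cochains L (k, c)"
  then obtain M where M: "M \<in> multilin L (k, c)" and K: "K = alt L M"
    by (auto simp: cochains_def)
  then have ml: "multilinear M" by (simp add: multilin_iff)
  have "lift K zs \<in> gr L (c + sum_list (map fst zs))" if "homs zs" for zs
    unfolding K alt_hom[OF ml that] using M that
    by (intro gr_scl perm_sum_degree) (simp_all add: multilin_iff)
  moreover have "K Xs = 0" if "int (length Xs) \<noteq> k + 1" for Xs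
    unfolding K using M that by (intro alt_length[OF ml _ refl]) (simp add: multilin_iff)
  moreover have "alternating (lift K)"
  proof (rule alternatingI)
    fix us z w vs assume *: "homs us" "hom z" "hom w" "homs vs"
    then have "homs (us @ z # w # vs)" "homs (us @ w # z # vs)" by auto
    then show "lift K (us @ z # w # vs) = scl L (swap_sign (fst z) (fst w)) (lift K (us @ w # z # vs))"
      unfolding K alt_hom[OF ml \<open>homs (us @ z # w # vs)\<close>] alt_hom[OF ml \<open>homs (us @ w # z # vs)\<close>]
        perm_sum_swap[of _ us z w vs]
      by (simp add: mult.commute)
  qed
  ultimately show "K \<in> multilin L (k, c) \<and> alternating (lift K)"
    using multilinear_alt[OF ml] K by (simp add: multilin_iff)
next
  assume K: "K \<in> multilin L (k, c) \<and> alternating (lift K)"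
  then have ml: "multilinear K" by (simp add: multilin_iff)
  have "alt L K = K"
  proof (rule multilinear_eqI[OF multilinear_alt[OF ml] ml])
    fix zs :: "((int ^ 'n) \<times> 'e) list" assume "homs zs"
    then show "lift (alt L K) zs = lift K zs"
      using K by (simp add: alt_hom[OF ml] perm_sum_alternating)
  qed
  then show "K \<in> cochains L (k, c)"
    using K unfolding cochains_def by (metis image_eqI)
qed

lemma alt_form_lift: "K \<in> cochains L (k, c) \<Longrightarrow> alt_form c (lift K)"
  by (intro alt_formI) (auto simp: cochains_iff multilin_iff multilinear_def)

lemma cochain_multilinear: "K \<in> cochains L (k, c) \<Longrightarrow> multilinear K"
  and cochain_length: "\<lbrakk>K \<in> cochains L (k, c); int (length Xs) \<noteq> k + 1\<rbrakk> \<Longrightarrow> K Xs = 0"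
  and cochain_degree: "\<lbrakk>K \<in> cochains L (k, c); homs zs\<rbrakk> \<Longrightarrow> lift K zs \<in> gr L (c + sum_list (map fst zs))"
  by (auto simp: cochains_iff multilin_iff)

lemma cochainI:
  assumes "\<And>Xs. int (length Xs) \<noteq> k + 1 \<Longrightarrow> K Xs = 0" "multilinear K" "alt_form c (lift K)"
  shows "K \<in> cochains L (k, c)"
  using assms alt_form_alternating alt_form_degree by (auto simp: cochains_iff multilin_iff)


section \<open>The differential on cochains\<close>

lemma brk2_lin:
  "brk2 (x, scl L r X + Y) w = (x + fst w, scl L r (brk L X (snd w)) + brk L Y (snd w))"
  "brk2 w (x, scl L r X + Y) = (fst w + x, scl L r (brk L (snd w) X) + brk L (snd w) Y)"
  by (simp_all add: brk2_def brk_add_left brk_add_right brk_scl_left brk_scl_right)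

lemma slotwise_linear_inner_brk:
  assumes "slotwise_linear f" shows "slotwise_linear (inner_brk f)"
  unfolding slotwise_linear_def
proof (intro allI impI, elim conjE)
  fix us x r X Y vs
  assume "homs us" and vs: "homs vs" and X: "X \<in> gr L x" and Y: "Y \<in> gr L x"
  then show "inner_brk f (us @ (x, scl L r X + Y) # vs) =
      scl L r (inner_brk f (us @ (x, X) # vs)) + inner_brk f (us @ (x, Y) # vs)"
    using assms
  proof (induction us arbitrary: f)
    case Nil
    note f = \<open>slotwise_linear f\<close>
    show ?case
    proof (cases vs)
      case (Cons w ws)
      then have w: "hom w" and ws: "homs ws" using vs by auto
      have 1: "f (brk2 (x, scl L r X + Y) w # ws) = scl L r (f (brk2 (x, X) w # ws)) + f (brk2 (x, Y) w # ws)"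
        unfolding brk2_lin using slotwise_linearD0[OF f ws degree[OF X w] degree[OF Y w]]
        by (simp add: brk2_def)
      have "inner_brk (\<lambda>vs. f ((x, scl L r X + Y) # vs)) vs
          = inner_brk (\<lambda>vs. scl L r (f ((x, X) # vs)) + f ((x, Y) # vs)) vs"
        by (intro inner_brk_cong[OF vs] slotwise_linearD0[OF f _ X Y])
      then show ?thesis
        using 1 Cons by (simp add: inner_brk_add inner_brk_scl vs.scale_right_diff_distrib)
    qed simp
  next
    case (Cons u us)
    note f = \<open>slotwise_linear f\<close>
    have u: "hom u" and us: "homs us" using Cons.prems by auto
    have IH: "inner_brk (\<lambda>vs. f (u # vs)) (us @ (x, scl L r X + Y) # vs)
        = scl L r (inner_brk (\<lambda>vs. f (u # vs)) (us @ (x, X) # vs)) + inner_brk (\<lambda>vs. f (u # vs)) (us @ (x, Y) # vs)"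
      by (intro Cons.IH[OF us vs X Y] slotwise_linear_Cons f u)
    show ?case
    proof (cases us)
      case Nil
      have "f (brk2 u (x, scl L r X + Y) # vs) = scl L r (f (brk2 u (x, X) # vs)) + f (brk2 u (x, Y) # vs)"
        unfolding brk2_lin using slotwise_linearD0[OF f vs degree[OF u X] degree[OF u Y]]
        by (simp add: brk2_def)
      then show ?thesis
        using IH Nil by (simp add: vs.scale_right_diff_distrib)
    next
      case (Cons u' us')
      have "homs (brk2 u u' # us')" using us u Cons degree by auto
      from slotwise_linearD[OF f this vs X Y, of r] show ?thesis
        using IH Cons by (simp add: vs.scale_right_diff_distrib)
    qed
  qed
qed

lemma slotwise_linear_brk_last:
  assumes "slotwise_linear f" shows "slotwise_linear (brk_last f)"
  unfolding slotwise_linear_def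
proof (intro allI impI, elim conjE)
  fix us x r X Y vs
  assume "homs us" and vs: "homs vs" and X: "X \<in> gr L x" and Y: "Y \<in> gr L x"
  then show "brk_last f (us @ (x, scl L r X + Y) # vs) =
      scl L r (brk_last f (us @ (x, X) # vs)) + brk_last f (us @ (x, Y) # vs)"
    using assms
  proof (induction us arbitrary: f)
    case Nil
    note f = \<open>slotwise_linear f\<close>
    show ?case
    proof (cases vs)
      case (Cons w ws)
      have "brk_last (\<lambda>vs. f ((x, scl L r X + Y) # vs)) vs
          = brk_last (\<lambda>vs. scl L r (f ((x, X) # vs)) + f ((x, Y) # vs)) vs"
        by (intro brk_last_cong[OF vs] slotwise_linearD0[OF f _ X Y])
      then show ?thesis
        using Cons by (simp add: brk_last_add brk_last_scl)
    qed (simp add: brk_add_right brk_scl_right)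
  next
    case (Cons u us)
    have "brk_last (\<lambda>vs. f (u # vs)) (us @ (x, scl L r X + Y) # vs)
        = scl L r (brk_last (\<lambda>vs. f (u # vs)) (us @ (x, X) # vs)) + brk_last (\<lambda>vs. f (u # vs)) (us @ (x, Y) # vs)"
      using Cons.prems by (intro Cons.IH slotwise_linear_Cons) auto
    then show ?case by (cases us) auto
  qed
qed

lemma slotwise_linear_brk_hd:
  assumes "slotwise_linear f" shows "slotwise_linear (brk_hd c f)"
  unfolding slotwise_linear_def
proof (intro allI impI, elim conjE)
  fix us x r X Y vs
  assume us: "homs us" and vs: "homs vs" and X: "X \<in> gr L x" and Y: "Y \<in> gr L x"
  show "brk_hd c f (us @ (x, scl L r X + Y) # vs) =
      scl L r (brk_hd c f (us @ (x, X) # vs)) + brk_hd c f (us @ (x, Y) # vs)"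
  proof (cases us)
    case Nil
    then show ?thesis
      by (simp add: brk_add_left brk_scl_left vs.scale_right_distrib mult.commute)
  next
    case (Cons u us')
    then have "homs us'" using us by simp
    from slotwise_linearD[OF assms this vs X Y, of r] show ?thesis
      using Cons by (simp add: brk_add_right brk_scl_right vs.scale_right_distrib mult.commute)
  qed
qed

lemma slotwise_linear_lin:
  "\<lbrakk>slotwise_linear f; slotwise_linear g\<rbrakk> \<Longrightarrow> slotwise_linear (\<lambda>zs. f zs + scl L s (g zs))"
  by (simp add: slotwise_linear_def vs.scale_right_distrib mult.commute add_ac)

lemma inner_brk_length:
  assumes "\<And>zs. length zs \<noteq> p \<Longrightarrow> f zs = 0" "length zs \<noteq> Suc p"
  shows "inner_brk f zs = 0"
  using assms
proof (induction f zs arbitrary: p rule: inner_brk.induct)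
  case (1 f z w zs)
  show ?case
  proof (cases p)
    case 0
    then have "inner_brk (\<lambda>vs. f (z # vs)) (w # zs) = inner_brk (\<lambda>vs. scl L 0 0) (w # zs)"
      using 1(2) by simp
    then show ?thesis
      using 1(2,3) 0 unfolding inner_brk_scl by simp
  next
    case (Suc q)
    then show ?thesis using 1(1)[of q] 1(2,3) by simp
  qed
qed simp_all

lemma brk_last_length:
  assumes "\<And>zs. length zs \<noteq> p \<Longrightarrow> f zs = 0" "length zs \<noteq> Suc p"
  shows "brk_last f zs = 0"
  using assms
proof (induction f zs arbitrary: p rule: brk_last.induct)
  case (3 f z w zs)
  show ?case
  proof (cases p)
    case 0
    then have "brk_last (\<lambda>vs. f (z # vs)) (w # zs) = brk_last (\<lambda>vs. scl L 0 0) (w # zs)"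
      using 3(2) by simp
    then show ?thesis unfolding brk_last_scl by simp
  next
    case (Suc q)
    then show ?thesis using 3(1)[of q] 3(2,3) by simp
  qed
qed simp_all

lemma brk_hd_length:
  assumes "\<And>zs. length zs \<noteq> p \<Longrightarrow> f zs = 0" "length zs \<noteq> Suc p"
  shows "brk_hd c f zs = 0"
  using assms by (cases zs) auto

lemma inner_brk_eq:
  "length zs = Suc p \<Longrightarrow> inner_brk f zs =
     (\<Sum>i<p. scl L ((-1) ^ i) (f (take i zs @ brk2 (zs ! i) (zs ! Suc i) # drop (i + 2) zs)))"
proof (induction f zs arbitrary: p rule: inner_brk.induct)
  case (1 f z w zs)
  then obtain q where p: "p = Suc q" and q: "length (w # zs) = Suc q" by auto
  show ?case
    unfolding p sum.lessThan_Suc_shift inner_brk.simps 1(1)[OF q]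
    by (simp add: sum_negf)
qed auto

lemma brk_last_eq:
  "zs \<noteq> [] \<Longrightarrow> brk_last f zs = brk L (f (butlast zs)) (snd (last zs))"
  by (induction f zs rule: brk_last.induct) simp_all

lemma insert_op_brk:
  assumes K: "K \<in> cochains L (int p - 1, c)" and p: "p > 0"
  shows "insert_op L (1, 0) (int p - 1, c) (brk_cochain L) K = mext (inner_brk (lift K))"
proof
  fix Xs
  show "insert_op L (1, 0) (int p - 1, c) (brk_cochain L) K Xs = mext (inner_brk (lift K)) Xs"
  proof (cases "length Xs = Suc p")
    case False
    have "mext (inner_brk (lift K)) Xs = mext (\<lambda>zs. 0) Xs"
      using False cochain_length[OF K] by (intro mext_cong inner_brk_length[of p]) auto
    then show ?thesis
      using False p by (simp add: insert_op_def mext_zero)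
  next
    case True
    have nat: "nat (int p - 1) = p - 1" using p by simp
    have set: "{0..p - 1} = {..<p}" using p by auto
    have "homog_ext L (\<lambda>xs Ys. \<Sum>i = 0..p - 1.
       scl L ((-1) powi (1 * int i + ip 0 (c + sum_list (take i xs))))
         (K (take i Ys @ brk_cochain L (take (nat (1 + 1)) (drop i Ys)) # drop (i + nat (1 + 1)) Ys))) Xs
       = mext (\<lambda>zs. \<Sum>i<p. scl L ((-1) ^ i)
           (K (take i (map snd zs) @ brk_cochain L (take 2 (drop i (map snd zs))) # drop (i + 2) (map snd zs)))) Xs"
      unfolding set by (rule homog_ext_eq_mext) simp
    also have "\<dots> = mext (inner_brk (lift K)) Xs"
    proof (rule mext_cong)
      fix zs :: "((int ^ 'n) \<times> 'e) list" assume "length zs = length Xs"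
      then have len: "length zs = Suc p" using True by simp
      have "brk_cochain L (take 2 (drop i (map snd zs))) = snd (brk2 (zs ! i) (zs ! Suc i))" if "i < p" for i
        using that len by (simp add: brk_cochain_def brk2_def)
      then show "(\<Sum>i<p. scl L ((-1) ^ i)
           (K (take i (map snd zs) @ brk_cochain L (take 2 (drop i (map snd zs))) # drop (i + 2) (map snd zs))))
          = inner_brk (lift K) zs"
        unfolding inner_brk_eq[OF len] by (intro sum.cong refl) (simp add: take_map drop_map)
    qed
    finally show ?thesis
      using True p by (simp add: insert_op_def nat)
  qed
qed

lemma insert_op_into_brk:
  assumes K: "K \<in> cochains L (int p - 1, c)"
  shows "insert_op L (int p - 1, c) (1, 0) K (brk_cochain L)
     = mext (\<lambda>zs. brk_last (lift K) zs + scl L (msgn (int p - 1)) (brk_hd c (lift K) zs))" (is "_ = mext ?F")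
proof
  fix Xs
  show "insert_op L (int p - 1, c) (1, 0) K (brk_cochain L) Xs = mext ?F Xs"
  proof (cases "length Xs = Suc p")
    case False
    have "mext ?F Xs = mext (\<lambda>zs. 0) Xs"
      using False cochain_length[OF K]
      by (intro mext_cong) (simp add: brk_last_length[of p] brk_hd_length[of p])
    then show ?thesis
      using False by (simp add: insert_op_def mext_zero)
  next
    case True
    have "homog_ext L (\<lambda>xs Ys. \<Sum>i = 0..1.
       scl L ((-1) powi ((int p - 1) * int i + ip c (0 + sum_list (take i xs))))
         (brk_cochain L (take i Ys @ K (take p (drop i Ys)) # drop (i + p) Ys))) Xs
       = mext (\<lambda>zs. \<Sum>i = 0..1::nat. scl L ((-1) powi ((int p - 1) * int i + ip c (0 + sum_list (take i (map fst zs)))))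
         (brk_cochain L (take i (map snd zs) @ K (take p (drop i (map snd zs))) # drop (i + p) (map snd zs)))) Xs"
      by (rule homog_ext_eq_mext) simp
    also have "\<dots> = mext ?F Xs"
    proof (rule mext_cong)
      fix zs :: "((int ^ 'n) \<times> 'e) list" assume "length zs = length Xs"
      then have len: "length zs = Suc p" using True by simp
      then obtain z zs' where zs: "zs = z # zs'" by (cases zs) auto
      have "map snd zs = map snd (butlast zs @ [last zs])"
        using zs by (intro arg_cong[where f = "map snd"]) simp
      then have split: "map snd zs = map snd (butlast zs) @ [snd (last zs)]"
        by (simp only: map_append list.map)
      have 1: "brk_cochain L (K (take p (map snd zs)) # drop p (map snd zs)) = brk_last (lift K) zs"
        unfolding split using len zs by (subst brk_last_eq) (simp_all add: brk_cochain_def del: butlast.simps last.simps)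
      have 2: "brk_cochain L (take 1 (map snd zs) @ K (take p (drop 1 (map snd zs))) # drop (1 + p) (map snd zs))
          = brk L (snd z) (K (map snd zs'))"
        using len zs by (simp add: brk_cochain_def)
      show "(\<Sum>i = 0..1::nat. scl L ((-1) powi ((int p - 1) * int i + ip c (0 + sum_list (take i (map fst zs)))))
         (brk_cochain L (take i (map snd zs) @ K (take p (drop i (map snd zs))) # drop (i + p) (map snd zs)))) = ?F zs"
        using 1 2 zs by (simp add: msgn_add[symmetric]) (simp add: msgn_def)
    qed
    finally show ?thesis
      using True by (simp add: insert_op_def)
  qed
qed

end

lemma independent_familyD:
  "\<lbrakk>independent_family G; finite S; \<And>g. f g \<in> G g; sum f S = 0; g \<in> S\<rbrakk> \<Longrightarrow> f g = 0"
  unfolding independent_family_def by blast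

context graded_lie_algebra
begin

lemma multilinear_lin: "\<lbrakk>multilinear K; multilinear M\<rbrakk> \<Longrightarrow> multilinear (\<lambda>Xs. scl L s (K Xs) + scl L t (M Xs))"
  by (simp add: multilinear_def vs.scale_right_distrib mult.commute add_ac)

text \<open>
  For \<open>p = 0\<close> the left side vanishes by convention, and the right side because no two arguments are available.
\<close>

lemma alt_insert_brk:
  assumes K: "K \<in> cochains L (int p - 1, c)"
  shows "alt_insert L (1, 0) (int p - 1, c) (brk_cochain L) K Xs
    = scl L (fact (Suc p) / (2 * fact p)) (alt L (mext (inner_brk (lift K))) Xs)"
proof (cases "p = 0")
  case True
  have "mext (inner_brk (lift K)) = mext (\<lambda>zs. 0)"
  proof (intro ext mext_cong)
    fix zs :: "((int ^ 'n) \<times> 'e) list" and Xs :: "'e list"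
    show "inner_brk (lift K) zs = 0"
    proof (cases "length zs = Suc 0")
      case True
      then show ?thesis by (auto simp: length_Suc_conv)
    next
      case False
      then show ?thesis using cochain_length[OF K] \<open>p = 0\<close> by (intro inner_brk_length[of 0]) auto
    qed
  qed
  then have "mext (inner_brk (lift K)) = (\<lambda>Xs. 0)" by (simp add: fun_eq_iff mext_zero)
  then have "alt L (mext (inner_brk (lift K))) Xs = 0"
    by (intro alt_length[where n = "length Xs"]) (auto simp: multilinear_def)
  then show ?thesis using True by (simp add: alt_insert_def)
next
  case False
  then have "nat (1 + (int p - 1) + 1) = Suc p" "nat (int p - 1 + 1) = p" by auto
  then show ?thesis
    using False insert_op_brk[OF K] by (simp add: alt_insert_def nat_add_distrib)
qed

lemma alt_insert_into_brk:
  assumes K: "K \<in> cochains L (int p - 1, c)"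
  shows "alt_insert L (int p - 1, c) (1, 0) K (brk_cochain L) Xs
    = scl L (fact (Suc p) / (2 * fact p))
       (alt L (mext (\<lambda>zs. brk_last (lift K) zs + scl L (msgn (int p - 1)) (brk_hd c (lift K) zs))) Xs)"
proof -
  have "nat (int p - 1 + 1 + 1) = Suc p" "nat (int p - 1 + 1) = p" by auto
  then show ?thesis
    using insert_op_into_brk[OF K] by (simp add: alt_insert_def nat_add_distrib)
qed

lemma slotwise_linear_insertions:
  assumes "K \<in> cochains L (k, c)"
  shows "slotwise_linear (inner_brk (lift K))"
    and "slotwise_linear (\<lambda>zs. brk_last (lift K) zs + scl L s (brk_hd c (lift K) zs))"
  using slotwise_linear_lift[OF cochain_multilinear[OF assms]]
  by (auto intro: slotwise_linear_inner_brk slotwise_linear_lin slotwise_linear_brk_last slotwise_linear_brk_hd)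

lemma cochain_brk_hom_eq:
  assumes K: "K \<in> cochains L (int p - 1, c)"
  shows "cochain_brk_hom L (1, 0) (int p - 1, c) (brk_cochain L) K =
    (\<lambda>Xs. scl L (fact (Suc p) / (2 * fact p)) (alt L (mext (inner_brk (lift K))) Xs)
     + scl L (- msgn (int p - 1) * (fact (Suc p) / (2 * fact p)))
        (alt L (mext (\<lambda>zs. brk_last (lift K) zs + scl L (msgn (int p - 1)) (brk_hd c (lift K) zs))) Xs))"
  by (simp add: fun_eq_iff cochain_brk_hom_def alt_insert_brk[OF K] alt_insert_into_brk[OF K] msgn_def)

lemma cochain_brk_hom_multilinear:
  assumes K: "K \<in> cochains L (int p - 1, c)"
  shows "multilinear (cochain_brk_hom L (1, 0) (int p - 1, c) (brk_cochain L) K)"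
  unfolding cochain_brk_hom_eq[OF K]
  using slotwise_linear_insertions[OF K]
  by (intro multilinear_lin multilinear_alt multilinear_mext)

lemma cochain_brk_hom_length:
  assumes K: "K \<in> cochains L (int p - 1, c)" and len: "length Xs \<noteq> Suc p"
  shows "cochain_brk_hom L (1, 0) (int p - 1, c) (brk_cochain L) K Xs = 0"
proof -
  have "mext (inner_brk (lift K)) Ys = mext (\<lambda>zs. 0) Ys" if "length Ys = length Xs" for Ys
    using len that cochain_length[OF K] by (intro mext_cong inner_brk_length[of p]) auto
  moreover have "mext (\<lambda>zs. brk_last (lift K) zs + scl L (msgn (int p - 1)) (brk_hd c (lift K) zs)) Ys = mext (\<lambda>zs. 0) Ys"
    if "length Ys = length Xs" for Ys
    using len that cochain_length[OF K]
    by (intro mext_cong) (simp add: brk_last_length[of p] brk_hd_length[of p])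
  moreover have "alt L (mext F) Xs = 0"
    if "slotwise_linear F" "\<And>Ys. length Ys = length Xs \<Longrightarrow> mext F Ys = 0" for F
    using that by (intro alt_length[OF multilinear_mext, of _ "length Xs"]) auto
  ultimately show ?thesis
    unfolding cochain_brk_hom_eq[OF K] using slotwise_linear_insertions[OF K]
    by (simp add: mext_zero)
qed

lemma cochain_brk_hom_hom:
  assumes K: "K \<in> cochains L (int p - 1, c)" and zs: "homs zs" and len: "length zs = Suc p"
  shows "lift (cochain_brk_hom L (1, 0) (int p - 1, c) (brk_cochain L) K) zs = cob p c (lift K) zs"
proof -
  let ?G = "\<lambda>zs. brk_last (lift K) zs + scl L (msgn (int p - 1)) (brk_hd c (lift K) zs)"
  have alt: "lift (alt L (mext F)) zs = scl L (1 / fact (Suc p)) (perm_sum F zs)" if F: "slotwise_linear F" for F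
  proof -
    have "perm_sum (lift (mext F)) zs = perm_sum F zs"
      by (intro perm_sum_cong[OF zs] mext_hom[OF F])
    then show ?thesis
      unfolding alt_hom[OF multilinear_mext[OF F] zs] len by simp
  qed
  have s: "(-1) ^ p = - (msgn (int p - 1) :: 'k)"
    by (simp add: msgn_eq)
  have "perm_sum (pre_cob p c (lift K)) zs
      = perm_sum (\<lambda>zs. inner_brk (lift K) zs + scl L (- msgn (int p - 1)) (?G zs)) zs"
    unfolding pre_cob_def[abs_def] s
    by (intro perm_sum_cong[OF zs]) (simp add: vs.scale_right_distrib)
  also have "\<dots> = perm_sum (inner_brk (lift K)) zs + scl L (- msgn (int p - 1)) (perm_sum ?G zs)"
    unfolding perm_sum_add perm_sum_scl ..
  finally have "cob p c (lift K) zs = scl L (1 / (2 * fact p)) (perm_sum (inner_brk (lift K)) zs)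
      + scl L (- msgn (int p - 1) / (2 * fact p)) (perm_sum ?G zs)"
    unfolding cob_def by (simp add: vs.scale_right_diff_distrib)
  moreover have "fact (Suc p) / (2 * fact p) * (1 / fact (Suc p)) = (1 / (2 * fact p) :: 'k)"
    by (simp add: field_simps del: fact_Suc)
  ultimately show ?thesis
    unfolding cochain_brk_hom_eq[OF K] alt[OF slotwise_linear_insertions(1)[OF K]]
      alt[OF slotwise_linear_insertions(2)[OF K]]
    by (simp add: mult.assoc del: fact_Suc)
qed

text \<open>
  The Cartan formula gives the degree by induction on the number of arguments.
\<close>

lemma cob_degree:
  assumes "alt_form c f" "homs zs" "length zs = Suc p"
  shows "cob p c f zs \<in> gr L (c + sum_list (map fst zs))"
  using assms
proof (induction p arbitrary: c f zs rule: less_induct)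
  case (less p)
  note g = \<open>alt_form c f\<close>
  obtain a ys where zs: "zs = a # ys"
    using less.prems by (cases zs) auto
  then have ys: "homs ys" and a: "hom a" and len: "length ys = p"
    using less.prems by auto
  have 1: "act_sum a f ys \<in> gr L (c + (fst a + sum_list (map fst ys)))"
    using act_sum_degree[OF g a ys] by (simp add: add_ac)
  have 2: "brk L (snd a) (f ys) \<in> gr L (c + (fst a + sum_list (map fst ys)))"
    using degree[OF a alt_form_degree[OF g ys]] by (simp add: add_ac)
  have 3: "cob (p - 1) (c + fst a) (\<lambda>vs. f (a # vs)) ys \<in> gr L (c + (fst a + sum_list (map fst ys)))" if "p \<noteq> 0"
    using less.IH[OF _ alt_form_Cons[OF g a] ys] that len by (simp add: add.assoc)
  show ?case
    using 1 2 3 unfolding zs cartan[OF g a ys len] by (auto intro!: gr_diff gr_scl)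
qed

lemma cochain_brk_hom_cochain:
  assumes K: "K \<in> cochains L (int p - 1, c)"
  shows "cochain_brk_hom L (1, 0) (int p - 1, c) (brk_cochain L) K \<in> cochains L (int p, c)"
  unfolding cochains_iff multilin_iff
proof (intro conjI allI impI)
  let ?D = "cochain_brk_hom L (1, 0) (int p - 1, c) (brk_cochain L) K"
  show "?D Xs = 0" if "int (length Xs) \<noteq> int p + 1" for Xs
    using that by (intro cochain_brk_hom_length[OF K]) simp
  show "multilinear ?D" by (rule cochain_brk_hom_multilinear[OF K])
  show "lift ?D zs \<in> gr L (c + sum_list (map fst zs))" if "homs zs" for zs
  proof (cases "length zs = Suc p")
    case True
    then show ?thesis
      using cob_degree[OF alt_form_lift[OF K] that True] cochain_brk_hom_hom[OF K that] by simp
  qed (simp add: cochain_brk_hom_length[OF K])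
  show "alternating (lift ?D)"
  proof (rule alternatingI)
    fix us z w vs assume *: "homs us" "hom z" "hom w" "homs vs"
    then have zw: "homs (us @ z # w # vs)" "homs (us @ w # z # vs)" by auto
    show "lift ?D (us @ z # w # vs) = scl L (swap_sign (fst z) (fst w)) (lift ?D (us @ w # z # vs))"
    proof (cases "length (us @ z # w # vs) = Suc p")
      case True
      then have len: "length (us @ w # z # vs) = Suc p" by simp
      then show ?thesis
        unfolding cochain_brk_hom_hom[OF K zw(1) True] cochain_brk_hom_hom[OF K zw(2) len]
        unfolding cob_def perm_sum_swap[of _ us z w vs] by (simp add: mult.commute)
    qed (simp add: cochain_brk_hom_length[OF K])
  qed
qed

lemma cochains_lin:
  assumes "K \<in> cochains L (k, c)" "M \<in> cochains L (k, c)"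
  shows "(\<lambda>Xs. scl L r (K Xs) + scl L s (M Xs)) \<in> cochains L (k, c)"
  unfolding cochains_iff multilin_iff
proof (intro conjI allI impI)
  show "scl L r (K Xs) + scl L s (M Xs) = 0" if "int (length Xs) \<noteq> k + 1" for Xs
    using assms that by (simp add: cochain_length)
  show "multilinear (\<lambda>Xs. scl L r (K Xs) + scl L s (M Xs))"
    using assms by (intro multilinear_lin cochain_multilinear)
  show "lift (\<lambda>Xs. scl L r (K Xs) + scl L s (M Xs)) zs \<in> gr L (c + sum_list (map fst zs))" if "homs zs" for zs
    using assms that by (intro gr_add gr_scl cochain_degree)
  show "alternating (lift (\<lambda>Xs. scl L r (K Xs) + scl L s (M Xs)))"
  proof (rule alternatingI)
    fix us z w vs assume *: "homs us" "hom z" "hom w" "homs vs"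
    from assms have alt: "alternating (lift K)" "alternating (lift M)"
      by (auto simp: cochains_iff)
    show "lift (\<lambda>Xs. scl L r (K Xs) + scl L s (M Xs)) (us @ z # w # vs)
      = scl L (swap_sign (fst z) (fst w)) (lift (\<lambda>Xs. scl L r (K Xs) + scl L s (M Xs)) (us @ w # z # vs))"
      unfolding alternatingD[OF alt(1) *] alternatingD[OF alt(2) *]
      by (simp add: vs.scale_right_distrib mult.commute)
  qed
qed

lemma cochains_zero [simp]: "0 \<in> cochains L g"
  by (cases g) (auto simp: cochains_iff multilin_iff multilinear_def alternating_def zero_fun_def)

lemma cochains_diff: "\<lbrakk>u \<in> cochains L g; v \<in> cochains L g\<rbrakk> \<Longrightarrow> u - v \<in> cochains L g"
  using cochains_lin[of u "fst g" "snd g" v 1 "-1"] by (simp add: fun_diff_def)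

lemma cochains_add: "\<lbrakk>u \<in> cochains L g; v \<in> cochains L g\<rbrakk> \<Longrightarrow> u + v \<in> cochains L g"
  using cochains_lin[of u "fst g" "snd g" v 1 1] by (simp add: plus_fun_def)

lemma cochains_scl: "u \<in> cochains L g \<Longrightarrow> (\<lambda>Xs. scl L r (u Xs)) \<in> cochains L g"
  using cochains_lin[of u "fst g" "snd g" u r 0] by simp

lemma sum_fun_apply: "(sum f A) x = (\<Sum>i\<in>A. f i x)" for f :: "'i \<Rightarrow> 'x \<Rightarrow> 'y::comm_monoid_add"
  by (induction A rule: infinite_finite_induct) auto

text \<open>
  Evaluation at homogeneous arguments separates the summands: the number of arguments selects \<open>k\<close>, and the
  degree of the value determines \<open>c\<close>.
\<close>

lemma independent_cochains: "independent_family (cochains L)"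
  unfolding independent_family_def
proof (intro conjI allI ballI impI)
  fix S :: "(int \<times> (int ^ 'n)) set" and f and g :: "int \<times> (int ^ 'n)"
  assume S: "finite S" and f: "\<forall>g. f g \<in> cochains L g" and 0: "sum f S = 0" and g: "g \<in> S"
  obtain k c where kc: "g = (k, c)" by (cases g)
  have fk: "f (k', c') \<in> cochains L (k', c')" for k' c' using f by blast
  have "f (k, c) = (\<lambda>_. 0)"
  proof (rule multilinear_eqI)
    show "multilinear (f (k, c))" using fk by (rule cochain_multilinear)
    show "multilinear (\<lambda>_. 0)" by (simp add: multilinear_def)
    fix zs :: "((int ^ 'n) \<times> 'e) list" assume zs: "homs zs"
    show "lift (f (k, c)) zs = 0"
    proof (cases "int (length zs) = k + 1")
      case True
      let ?s = "sum_list (map fst zs)"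
      let ?S = "(\<lambda>c. c + ?s) ` {c. (k, c) \<in> S}"
      let ?h = "\<lambda>x. f (k, x - ?s) (map snd zs)"
      have "{c. (k, c) \<in> S} = snd ` (S \<inter> {k} \<times> UNIV)" by force
      then have fin: "finite {c. (k, c) \<in> S}" using S by simp
      have "sum ?h ?S = (\<Sum>c' | (k, c') \<in> S. f (k, c') (map snd zs))"
        by (subst sum.reindex) (auto simp: inj_on_def)
      also have "\<dots> = (\<Sum>g\<in>Pair k ` {c. (k, c) \<in> S}. f g (map snd zs))"
        by (subst sum.reindex) (auto simp: inj_on_def)
      also have "\<dots> = (\<Sum>g\<in>S. f g (map snd zs))"
      proof (rule sum.mono_neutral_left[OF S])
        show "\<forall>g\<in>S - Pair k ` {c. (k, c) \<in> S}. f g (map snd zs) = 0"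
        proof
          fix g assume "g \<in> S - Pair k ` {c. (k, c) \<in> S}"
          then obtain k' c' where "g = (k', c')" "k' \<noteq> k" by (cases g) auto
          then show "f g (map snd zs) = 0"
            using True by (auto intro!: cochain_length[OF fk])
        qed
      qed auto
      also have "\<dots> = (sum f S) (map snd zs)" by (simp add: sum_fun_apply)
      finally have "sum ?h ?S = 0" using 0 by simp
      moreover have "?h x \<in> gr L x" for x
        using cochain_degree[OF fk zs, of k "x - ?s"] by simp
      ultimately have "?h (c + ?s) = 0"
        using g kc fin by (intro independent_familyD[OF independent_gr, of ?S ?h]) auto
      then show ?thesis by simp
    next
      case False
      then show ?thesis by (intro cochain_length[OF fk]) simp
    qed
  qed
  then show "f g = 0" using kc by (simp add: zero_fun_def)
qed (auto intro: cochains_diff)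

lemma brk_cochain_in_cochains: "brk_cochain L \<in> cochains L (1, 0)"
  unfolding cochains_iff multilin_iff
proof (intro conjI allI impI)
  show "brk_cochain L Xs = 0" if "int (length Xs) \<noteq> 1 + 1" for Xs
    using that by (auto simp: brk_cochain_def)
  show "multilinear (brk_cochain L)"
    unfolding multilinear_def
  proof (intro allI)
    fix us r X Y vs
    show "brk_cochain L (us @ (scl L r X + Y) # vs)
        = scl L r (brk_cochain L (us @ X # vs)) + brk_cochain L (us @ Y # vs)"
    proof (cases "length (us @ X # vs) = 2")
      case True
      then consider Z where "us = [Z]" "vs = []" | Z where "us = []" "vs = [Z]"
        by (cases us; cases vs) (auto simp: length_Suc_conv)
      then show ?thesis
        by cases (simp_all add: brk_cochain_def brk_add_left brk_add_right brk_scl_left brk_scl_right)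
    qed (simp add: brk_cochain_def)
  qed
  show "lift (brk_cochain L) zs \<in> gr L (0 + sum_list (map fst zs))" if "homs zs" for zs
    using that by (auto simp: brk_cochain_def length_Suc_conv numeral_2_eq_2 degree)
  show "alternating (lift (brk_cochain L))"
  proof (rule alternatingI)
    fix us z w vs assume *: "homs us" "hom z" "hom w" "homs vs"
    then show "lift (brk_cochain L) (us @ z # w # vs) = scl L (swap_sign (fst z) (fst w)) (lift (brk_cochain L) (us @ w # z # vs))"
      using brk_swap[of "snd z" "fst z" "snd w" "fst w"]
      by (cases us; cases vs) (auto simp: brk_cochain_def)
  qed
qed

end

section \<open>The differential on sums of homogeneous cochains\<close>

lemma direct_sumI:
  "\<lbrakk>finite S; S \<subseteq> I; \<And>g. g \<in> S \<Longrightarrow> f g \<in> G g\<rbrakk> \<Longrightarrow> sum f S \<in> direct_sum I G"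
  unfolding direct_sum_def by (intro CollectI exI[of _ S] exI[of _ f] conjI ballI refl)

lemma direct_sumE:
  assumes "v \<in> direct_sum I G" "\<And>g. 0 \<in> G g"
  obtains S f where "finite S" "S \<subseteq> I" "\<forall>g. f g \<in> G g" "\<forall>g. g \<notin> S \<longrightarrow> f g = 0" "v = sum f S"
proof -
  from assms(1) obtain S f where S: "finite S" "S \<subseteq> I" "\<forall>g\<in>S. f g \<in> G g" "v = sum f S"
    unfolding direct_sum_def by (elim CollectE exE conjE)
  let ?f = "\<lambda>g. if g \<in> S then f g else 0"
  have "v = sum ?f S" unfolding S(4) by (rule sum.cong) simp_all
  moreover have "?f g \<in> G g" for g using S(3) assms(2) by simp
  ultimately show ?thesis using that[of S ?f] S(1,2) by simp
qed

lemma direct_sum_zero [simp]: "0 \<in> direct_sum I G"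
  using direct_sumI[of "{}" I] by simp

lemma direct_sum_homogeneous: "\<lbrakk>g \<in> I; v \<in> G g\<rbrakk> \<Longrightarrow> v \<in> direct_sum I G"
  using direct_sumI[of "{g}" I "\<lambda>_. v" G] by simp

lemma direct_sum_add:
  assumes G0: "\<And>g. 0 \<in> G g" and G: "\<And>g u v. u \<in> G g \<Longrightarrow> v \<in> G g \<Longrightarrow> u + v \<in> G g"
    and u: "u \<in> direct_sum I G" and v: "v \<in> direct_sum I G"
  shows "u + v \<in> direct_sum I G"
proof -
  obtain S f where S: "finite S" "S \<subseteq> I" "\<forall>g. f g \<in> G g" "\<forall>g. g \<notin> S \<longrightarrow> f g = 0" "u = sum f S"
    using direct_sumE[OF u G0] by metis
  obtain S' f' where S': "finite S'" "S' \<subseteq> I" "\<forall>g. f' g \<in> G g" "\<forall>g. g \<notin> S' \<longrightarrow> f' g = 0" "v = sum f' S'"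
    using direct_sumE[OF v G0] by metis
  have "u = sum f (S \<union> S')" unfolding S(5)
    by (rule sum.mono_neutral_left) (use S(1,4) S'(1) in auto)
  moreover have "v = sum f' (S \<union> S')" unfolding S'(5)
    by (rule sum.mono_neutral_left) (use S'(1,4) S(1) in auto)
  ultimately have "u + v = (\<Sum>g\<in>S \<union> S'. f g + f' g)" by (simp add: sum.distrib)
  also have "\<dots> \<in> direct_sum I G"
    using S(1,2) S'(1,2) by (intro direct_sumI G S(3)[rule_format] S'(3)[rule_format]) auto
  finally show ?thesis .
qed

lemma direct_sum_induct [consumes 1, case_names zero homogeneous add]:
  assumes "v \<in> direct_sum I G"
    and "P 0" "\<And>g u. g \<in> I \<Longrightarrow> u \<in> G g \<Longrightarrow> P u" "\<And>u w. P u \<Longrightarrow> P w \<Longrightarrow> P (u + w)"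
  shows "P v"
proof -
  from assms(1) obtain S f where S: "finite S" "S \<subseteq> I" "\<forall>g\<in>S. f g \<in> G g" "v = sum f S"
    unfolding direct_sum_def by (elim CollectE exE conjE)
  have "P (sum f S)"
    using S(1-3)
  proof (induction S rule: finite_induct)
    case (insert g S)
    have "P (f g)" using insert.prems by (intro assms(3)[of g]) auto
    moreover have "P (sum f S)" using insert by auto
    ultimately show ?case using insert(1,2) assms(4) by simp
  qed (simp add: assms(2))
  then show ?thesis using S by simp
qed

lemma direct_sum_mono:
  assumes "I \<subseteq> J" "\<And>g. g \<in> I \<Longrightarrow> G g \<subseteq> H g"
  shows "direct_sum I G \<subseteq> direct_sum J H"
proof
  fix v assume "v \<in> direct_sum I G"
  then obtain S f where S: "finite S" "S \<subseteq> I" "\<forall>g\<in>S. f g \<in> G g" and v: "v = sum f S"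
    unfolding direct_sum_def by (elim CollectE exE conjE)
  show "v \<in> direct_sum J H"
    unfolding v
  proof (rule direct_sumI[OF S(1)])
    fix g assume "g \<in> S"
    then show "f g \<in> H g" using S(2,3) assms(2)[of g] by auto
  qed (use S(2) assms(1) in auto)
qed

context graded_lie_algebra
begin

lemma cochains_eqI:
  assumes "K \<in> cochains L (k, c)" "K' \<in> cochains L (k, c')"
    and "\<And>zs. homs zs \<Longrightarrow> int (length zs) = k + 1 \<Longrightarrow> lift K zs = lift K' zs"
  shows "K = K'"
proof (rule multilinear_eqI)
  fix zs :: "((int ^ 'n) \<times> 'e) list" assume zs: "homs zs"
  show "lift K zs = lift K' zs"
    using assms zs cochain_length[OF assms(1)] cochain_length[OF assms(2)]
    by (cases "int (length zs) = k + 1") auto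
qed (use assms cochain_multilinear in auto)

lemma cochains_negative: "\<lbrakk>K \<in> cochains L (k, c); k < -1\<rbrakk> \<Longrightarrow> K = 0"
  by (rule ext) (simp add: cochain_length)

lemma cob_zero: "cob p c (\<lambda>zs. 0) zs = 0"
  using cob_scl[of p c 0 "\<lambda>zs. 0" zs] by simp

text \<open>
  The degenerate case in which the cochain given by the bracket is zero and so has no homogeneous component.
\<close>

lemma cob_abelian:
  assumes "\<And>X Y. brk L X Y = 0" "alt_form c f" "homs zs" "length zs = Suc p"
  shows "cob p c f zs = 0"
  using assms(2-)
proof (induction p arbitrary: c f zs rule: less_induct)
  case (less p)
  note g = \<open>alt_form c f\<close>
  obtain a ys where zs: "zs = a # ys"
    using less.prems by (cases zs) auto
  then have ys: "homs ys" and a: "hom a" and len: "length ys = p"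
    using less.prems by auto
  have "act_sum a f ys = 0" using g ys
  proof (induction ys arbitrary: c f)
    case (Cons z ws)
    have "act_sum a (\<lambda>vs. f (z # vs)) ws = 0"
      using Cons.IH[OF alt_form_Cons[OF Cons.prems(1), of z]] Cons.prems(2) by simp
    moreover have "f (brk2 a z # ws) = 0"
      using Cons.prems alt_form_zero0 by (simp add: brk2_def assms(1))
    ultimately show ?case by simp
  qed simp
  moreover have "cob (p - 1) (c + fst a) (\<lambda>vs. f (a # vs)) ys = 0" if "p \<noteq> 0"
    using that len by (intro less.IH alt_form_Cons g a ys) auto
  ultimately show ?case
    unfolding zs cartan[OF g a ys len] by (simp add: assms(1))
qed

lemma hsupp_cochain:
  "K \<in> cochains L g \<Longrightarrow> hsupp (cochains L) K = (if K = 0 then {} else {g})"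
  unfolding hsupp_def by (auto simp: hcomp_homogeneous[OF independent_cochains])

lemma DD_zero [simp]: "DD L 0 = 0"
  using hsupp_cochain[OF cochains_zero[of undefined]] by (simp add: DD_def cochain_brk_def)

text \<open>
  On homogeneous cochains the sums over homogeneous components reduce to one term, or are empty if the bracket or
  \<open>K\<close> is zero; in the latter case the bracket of homogeneous cochains vanishes as well.
\<close>

lemma DD_eq:
  assumes K: "K \<in> cochains L (int p - 1, c)"
  shows "DD L K = cochain_brk_hom L (1, 0) (int p - 1, c) (brk_cochain L) K"
proof (cases "brk_cochain L = 0 \<or> K = 0")
  case True
  have "cochain_brk_hom L (1, 0) (int p - 1, c) (brk_cochain L) K = 0"
  proof (rule cochains_eqI[OF cochain_brk_hom_cochain[OF K] cochains_zero])
    fix zs :: "((int ^ 'n) \<times> 'e) list" assume zs: "homs zs" and "int (length zs) = int p + 1"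
    then have len: "length zs = Suc p" by simp
    have "cob p c (lift K) zs = 0"
      using True
    proof
      assume "brk_cochain L = 0"
      then have "brk_cochain L [X, Y] = 0" for X Y by simp
      then have "brk L X Y = 0" for X Y by (simp add: brk_cochain_def)
      then show ?thesis by (intro cob_abelian alt_form_lift[OF K] zs len)
    qed (simp add: cob_zero)
    then show "lift (cochain_brk_hom L (1, 0) (int p - 1, c) (brk_cochain L) K) zs = lift 0 zs"
      by (simp add: cochain_brk_hom_hom[OF K zs len])
  qed
  then show ?thesis
    using True by (auto simp: DD_def cochain_brk_def hsupp_cochain[OF brk_cochain_in_cochains] hsupp_cochain[OF K])
next
  case False
  then show ?thesis
    by (simp add: DD_def cochain_brk_def hsupp_cochain[OF brk_cochain_in_cochains] hsupp_cochain[OF K]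
        hcomp_homogeneous[OF independent_cochains brk_cochain_in_cochains]
        hcomp_homogeneous[OF independent_cochains K])
qed

lemma DD_cochain:
  assumes "K \<in> cochains L (k, c)" shows "DD L K \<in> cochains L (k + 1, c)"
proof (cases "k < -1")
  case True
  then show ?thesis using cochains_negative[OF assms] by simp
next
  case False
  then have k: "k = int (nat (k + 1)) - 1" by simp
  then have "K \<in> cochains L (int (nat (k + 1)) - 1, c)" using assms by simp
  from cochain_brk_hom_cochain[OF this] DD_eq[OF this] show ?thesis using False by simp
qed

lemma DD_hom:
  assumes "K \<in> cochains L (int p - 1, c)" "homs zs" "length zs = Suc p"
  shows "lift (DD L K) zs = cob p c (lift K) zs"
  using cochain_brk_hom_hom[OF assms] DD_eq[OF assms(1)] by simp

lemma DD_lin_cochain: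
  assumes K: "K \<in> cochains L g" and M: "M \<in> cochains L g"
  shows "DD L (\<lambda>Xs. scl L r (K Xs) + scl L s (M Xs)) = (\<lambda>Xs. scl L r (DD L K Xs) + scl L s (DD L M Xs))"
proof -
  obtain k c where g: "g = (k, c)" by (cases g)
  show ?thesis
  proof (cases "k < -1")
    case True
    then have "K = 0" "M = 0" using K M g cochains_negative by auto
    then show ?thesis by (simp add: zero_fun_def[symmetric])
  next
    case False
    define p where "p = nat (k + 1)"
    have k: "k = int p - 1" using False by (simp add: p_def)
    note K' = K[unfolded g k] and M' = M[unfolded g k]
    note KM = cochains_lin[OF K' M', of r s]
    show ?thesis
    proof (rule cochains_eqI[OF DD_cochain[OF KM] cochains_lin[OF DD_cochain[OF K'] DD_cochain[OF M']]])
      fix zs :: "((int ^ 'n) \<times> 'e) list" assume zs: "homs zs" and "int (length zs) = int p - 1 + 1 + 1"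
      then have len: "length zs = Suc p" by simp
      show "lift (DD L (\<lambda>Xs. scl L r (K Xs) + scl L s (M Xs))) zs = lift (\<lambda>Xs. scl L r (DD L K Xs) + scl L s (DD L M Xs)) zs"
        using DD_hom[OF KM zs len] DD_hom[OF K' zs len] DD_hom[OF M' zs len]
        by (simp add: cob_add cob_scl)
    qed
  qed
qed

lemma DD_sum:
  assumes S: "finite S" and f: "\<And>g. f g \<in> cochains L g"
  shows "DD L (sum f S) = (\<Sum>g\<in>S. DD L (f g))"
proof -
  let ?f = "\<lambda>g. if g \<in> S then f g else 0"
  have "hdecomp (cochains L) (sum f S) ?f"
    unfolding hdecomp_iff using S f by (auto intro!: exI[of _ S] sum.cong)
  then have hc: "hcomp (cochains L) (sum f S) = ?f"
    by (rule hcomp_eq[OF independent_cochains])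
  have dd: "DD L K = (\<Sum>g1\<in>hsupp (cochains L) (brk_cochain L).
        cochain_brk_hom L g1 g (hcomp (cochains L) (brk_cochain L) g1) K)" if "K \<in> cochains L g" "K \<noteq> 0" for K g
    using that by (simp add: DD_def cochain_brk_def hsupp_cochain[OF that(1)]
        hcomp_homogeneous[OF independent_cochains that(1)])
  have "DD L (sum f S) = (\<Sum>g1\<in>hsupp (cochains L) (brk_cochain L). \<Sum>g2\<in>{g. ?f g \<noteq> 0}.
        cochain_brk_hom L g1 g2 (hcomp (cochains L) (brk_cochain L) g1) (?f g2))"
    unfolding DD_def cochain_brk_def hsupp_def[of _ "sum f S"] hc ..
  also have "\<dots> = (\<Sum>g2\<in>{g. ?f g \<noteq> 0}. \<Sum>g1\<in>hsupp (cochains L) (brk_cochain L).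
        cochain_brk_hom L g1 g2 (hcomp (cochains L) (brk_cochain L) g1) (?f g2))"
    by (rule sum.swap)
  also have "\<dots> = (\<Sum>g2\<in>{g. ?f g \<noteq> 0}. DD L (f g2))"
    by (rule sum.cong) (auto simp: dd[OF f] split: if_splits)
  also have "\<dots> = (\<Sum>g\<in>S. DD L (f g))"
    using S by (intro sum.mono_neutral_left) (auto split: if_splits)
  finally show ?thesis .
qed

abbreviation all_cochains :: "('e list \<Rightarrow> 'e) set" where
  "all_cochains \<equiv> direct_sum UNIV (cochains L)"

lemma DD_lin:
  assumes "u \<in> all_cochains" "v \<in> all_cochains"
  shows "DD L (\<lambda>Xs. scl L r (u Xs) + scl L s (v Xs)) = (\<lambda>Xs. scl L r (DD L u Xs) + scl L s (DD L v Xs))"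
proof -
  obtain S f where S: "finite S" "\<forall>g. f g \<in> cochains L g" "\<forall>g. g \<notin> S \<longrightarrow> f g = 0" "u = sum f S"
    using direct_sumE[OF assms(1) cochains_zero] by metis
  obtain S' f' where S': "finite S'" "\<forall>g. f' g \<in> cochains L g" "\<forall>g. g \<notin> S' \<longrightarrow> f' g = 0" "v = sum f' S'"
    using direct_sumE[OF assms(2) cochains_zero] by metis
  let ?T = "S \<union> S'"
  have u: "u = sum f ?T" unfolding S(4)
    by (rule sum.mono_neutral_left) (use S(1,3) S'(1) in auto)
  have v: "v = sum f' ?T" unfolding S'(4)
    by (rule sum.mono_neutral_left) (use S'(1,3) S(1) in auto)
  have T: "finite ?T" using S S' by simp
  have "(\<lambda>Xs. scl L r (u Xs) + scl L s (v Xs)) = (\<Sum>g\<in>?T. (\<lambda>Xs. scl L r (f g Xs) + scl L s (f' g Xs)))"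
    unfolding u v by (rule ext) (simp add: sum_fun_apply sum.distrib vs.scale_sum_right)
  moreover have "(\<lambda>Xs. scl L r (f g Xs) + scl L s (f' g Xs)) \<in> cochains L g" for g
    using cochains_lin[of "f g" "fst g" "snd g" "f' g"] S(2) S'(2) by simp
  ultimately have "DD L (\<lambda>Xs. scl L r (u Xs) + scl L s (v Xs))
      = (\<Sum>g\<in>?T. DD L (\<lambda>Xs. scl L r (f g Xs) + scl L s (f' g Xs)))"
    using DD_sum[OF T, of "\<lambda>g Xs. scl L r (f g Xs) + scl L s (f' g Xs)"] by simp
  also have "\<dots> = (\<Sum>g\<in>?T. (\<lambda>Xs. scl L r (DD L (f g) Xs) + scl L s (DD L (f' g) Xs)))"
    using S(2) S'(2) by (intro sum.cong refl DD_lin_cochain) auto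
  also have "\<dots> = (\<lambda>Xs. scl L r ((\<Sum>g\<in>?T. DD L (f g)) Xs) + scl L s ((\<Sum>g\<in>?T. DD L (f' g)) Xs))"
    by (rule ext) (simp add: sum_fun_apply sum.distrib vs.scale_sum_right)
  finally show ?thesis
    unfolding u v DD_sum[OF T S(2)[rule_format]] DD_sum[OF T S'(2)[rule_format]] .
qed

lemma DD_add: "\<lbrakk>u \<in> all_cochains; v \<in> all_cochains\<rbrakk> \<Longrightarrow> DD L (u + v) = DD L u + DD L v"
  using DD_lin[of u v 1 1] by (simp add: plus_fun_def)

lemma DD_diff: "\<lbrakk>u \<in> all_cochains; v \<in> all_cochains\<rbrakk> \<Longrightarrow> DD L (u - v) = DD L u - DD L v"
  using DD_lin[of u v 1 "-1"] by (simp add: fun_diff_def)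

lemma DD_uminus: "u \<in> all_cochains \<Longrightarrow> DD L (- u) = - DD L u"
  using DD_diff[of 0 u] by simp

lemma DD_scl: "u \<in> all_cochains \<Longrightarrow> DD L (\<lambda>Xs. scl L r (u Xs)) = (\<lambda>Xs. scl L r (DD L u Xs))"
  using DD_lin[of u 0 r 0] by simp

lemma direct_sum_cochains_add:
  "\<lbrakk>u \<in> direct_sum I (cochains L); v \<in> direct_sum I (cochains L)\<rbrakk> \<Longrightarrow> u + v \<in> direct_sum I (cochains L)"
  by (rule direct_sum_add) (auto intro: cochains_add)

lemma direct_sum_cochains_scl:
  assumes "u \<in> direct_sum I (cochains L)"
  shows "(\<lambda>Xs. scl L r (u Xs)) \<in> direct_sum I (cochains L)"
  using assms
proof (induction rule: direct_sum_induct)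
  case (add u w)
  have "(\<lambda>Xs. scl L r ((u + w) Xs)) = (\<lambda>Xs. scl L r (u Xs)) + (\<lambda>Xs. scl L r (w Xs))"
    by (simp add: fun_eq_iff vs.scale_right_distrib)
  then show ?case using direct_sum_cochains_add[OF add] by simp
next
  case zero
  have "(\<lambda>Xs. scl L r ((0 :: 'e list \<Rightarrow> 'e) Xs)) = 0" by (simp add: fun_eq_iff)
  then show ?case by simp
qed (auto intro: direct_sum_homogeneous cochains_scl)

lemma direct_sum_cochains_uminus:
  "u \<in> direct_sum I (cochains L) \<Longrightarrow> - u \<in> direct_sum I (cochains L)"
  using direct_sum_cochains_scl[of u I "-1"] by (simp add: fun_Compl_def)

lemma direct_sum_cochains_diff:
  "\<lbrakk>u \<in> direct_sum I (cochains L); v \<in> direct_sum I (cochains L)\<rbrakk> \<Longrightarrow> u - v \<in> direct_sum I (cochains L)"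
  using direct_sum_cochains_add[of u I "- v"] direct_sum_cochains_uminus by simp

lemma direct_sum_cochains_sum:
  "(\<And>i. i \<in> A \<Longrightarrow> f i \<in> direct_sum I (cochains L)) \<Longrightarrow> sum f A \<in> direct_sum I (cochains L)"
  by (induction A rule: infinite_finite_induct) (auto intro: direct_sum_cochains_add)

lemma direct_sum_all: "u \<in> direct_sum I (cochains L) \<Longrightarrow> u \<in> all_cochains"
  using direct_sum_mono[of I UNIV "cochains L" "cochains L"] by blast

lemma DD_sum_all: "(\<And>i. i \<in> A \<Longrightarrow> f i \<in> all_cochains) \<Longrightarrow> DD L (sum f A) = (\<Sum>i\<in>A. DD L (f i))"
  by (induction A rule: infinite_finite_induct) (auto simp: DD_add direct_sum_cochains_sum)

lemma DD_direct_sum: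
  assumes "u \<in> direct_sum I (cochains L)" "\<And>k c. (k, c) \<in> I \<Longrightarrow> (k + 1, c) \<in> J"
  shows "DD L u \<in> direct_sum J (cochains L)"
proof -
  have "u \<in> all_cochains \<and> DD L u \<in> direct_sum J (cochains L)"
    using assms(1)
  proof (induction rule: direct_sum_induct)
    case (homogeneous g u)
    then have "(fst g + 1, snd g) \<in> J" "DD L u \<in> cochains L (fst g + 1, snd g)"
      using assms(2)[of "fst g" "snd g"] DD_cochain[of u "fst g" "snd g"] by auto
    moreover have "u \<in> all_cochains"
      using homogeneous by (intro direct_sum_homogeneous[of g]) auto
    ultimately show ?case by (auto intro: direct_sum_homogeneous)
  next
    case zero
    show ?case using direct_sum_zero DD_zero by (metis (no_types))
  next
    case (add u w)
    then show ?case
      using direct_sum_cochains_add[of u UNIV w] direct_sum_cochains_add[of "DD L u" J "DD L w"] DD_add[of u w]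
      by metis
  qed
  then show ?thesis by blast
qed

text \<open>
  The differentials of the components lie in different degrees, so each of them vanishes.
\<close>

lemma cocycle_components:
  assumes v: "v \<in> direct_sum I (cochains L)" and d: "DD L v = 0"
  shows "v \<in> direct_sum I (\<lambda>g. {K \<in> cochains L g. DD L K = 0})"
proof -
  obtain S f where S: "finite S" "S \<subseteq> I" "\<forall>g. f g \<in> cochains L g" "v = sum f S"
    using direct_sumE[OF v cochains_zero] by metis
  let ?h = "\<lambda>g. DD L (f (g - (1, 0)))"
  have "sum ?h ((\<lambda>g. g + (1, 0)) ` S) = 0"
    using d DD_sum[OF S(1), of f] S(3,4) by (subst sum.reindex) (auto simp: inj_on_def)
  moreover have "?h g \<in> cochains L g" for g
    using DD_cochain[of "f (g - (1, 0))" "fst g - 1" "snd g"] S(3)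
    by (cases g) (simp add: minus_prod_def)
  ultimately have "?h (g + (1, 0)) = 0" if "g \<in> S" for g
    using that S(1) by (intro independent_familyD[OF independent_cochains, of "(\<lambda>g. g + (1, 0)) ` S" ?h]) auto
  then have "f g \<in> {K \<in> cochains L g. DD L K = 0}" if "g \<in> S" for g
    using S(3)[rule_format, of g] that by simp
  then show ?thesis
    unfolding S(4) by (intro direct_sumI S(1,2))
qed

section \<open>Contraction and Lie derivative\<close>

lemma contr_cochain:
  assumes K: "K \<in> cochains L (k, c)" and X: "X \<in> gr L x"
  shows "(\<lambda>Xs. K (X # Xs)) \<in> cochains L (k - 1, c + x)"
proof (rule cochainI)
  show "alt_form (c + x) (lift (\<lambda>Xs. K (X # Xs)))"
    using alt_form_Cons[OF alt_form_lift[OF K], of "(x, X)"] X by simp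
qed (use cochain_multilinear[OF K] cochain_length[OF K] multilinear_Cons in auto)

text \<open>
  \<open>act_sum\<close> in terms of elements only, possible if the sign of passing an argument is the same
  number \<open>s\<close> for all arguments.
\<close>

fun insert_brk :: "'k \<Rightarrow> 'e \<Rightarrow> ('e list \<Rightarrow> 'e) \<Rightarrow> 'e list \<Rightarrow> 'e" where
  "insert_brk s A K [] = 0"
| "insert_brk s A K (X # Xs) = K (brk L A X # Xs) + scl L s (insert_brk s A (\<lambda>Ys. K (X # Ys)) Xs)"

lemma act_sum_lift:
  "(\<And>z. z \<in> set zs \<Longrightarrow> msgn (ip (fst a) (fst z)) = s) \<Longrightarrow>
     act_sum a (lift K) zs = insert_brk s (snd a) K (map snd zs)"
proof (induction zs arbitrary: K)
  case (Cons z zs)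
  show ?case using Cons.IH[of "\<lambda>Ys. K (snd z # Ys)"] Cons.prems by simp
qed simp

lemma DD_contr:
  assumes K: "K \<in> cochains L (k, c)" and a: "hom a" and zs: "homs zs" and len: "int (length zs) = k + 1"
  shows "DD L K (snd a # map snd zs) =
     act_sum a (lift K) zs - scl L (msgn (ip (fst a) c)) (brk L (snd a) (lift K zs))
     - lift (DD L (\<lambda>Xs. K (snd a # Xs))) zs"
proof -
  define p where "p = length zs"
  have k: "k = int p - 1" using len by (simp add: p_def)
  note K' = K[unfolded k]
  have "DD L K (snd a # map snd zs) = cob p c (lift K) (a # zs)"
    using DD_hom[OF K', of "a # zs"] a zs by (simp add: p_def)
  moreover have "lift (DD L (\<lambda>Xs. K (snd a # Xs))) zs = (if p = 0 then 0 else cob (p - 1) (c + fst a) (\<lambda>vs. lift K (a # vs)) zs)"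
  proof (cases "p = 0")
    case True
    then have "(\<lambda>Xs. K (snd a # Xs)) = 0"
      using k by (intro ext) (simp add: cochain_length[OF K])
    then show ?thesis using True by simp
  next
    case False
    then have "(\<lambda>Xs. K (snd a # Xs)) \<in> cochains L (int (p - 1) - 1, c + fst a)"
      using contr_cochain[OF K' a] by (simp add: of_nat_diff)
    from DD_hom[OF this zs] False show ?thesis by (simp add: p_def)
  qed
  ultimately show ?thesis
    using cartan[OF alt_form_lift[OF K'] a zs] by (simp add: p_def)
qed

definition lie_act :: "'e \<Rightarrow> ('e list \<Rightarrow> 'e) \<Rightarrow> 'e list \<Rightarrow> 'e" where
  "lie_act A K Xs = brk L A (K Xs) - insert_brk 1 A K Xs"

lemma insert_brk_lin:
  "insert_brk s A (\<lambda>Xs. scl L r (K Xs) + M Xs) Xs = scl L r (insert_brk s A K Xs) + insert_brk s A M Xs"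
  by (induction Xs arbitrary: K M) (simp_all add: vs.scale_right_distrib mult.commute)

lemma lie_act_lin:
  "lie_act A (\<lambda>Xs. scl L r (K Xs) + M Xs) Xs = scl L r (lie_act A K Xs) + lie_act A M Xs"
  by (simp add: lie_act_def insert_brk_lin brk_add_right brk_scl_right vs.scale_right_diff_distrib)

lemma lie_act_add: "lie_act A (K + M) = lie_act A K + lie_act A M"
  using lie_act_lin[of A 1 K M] by (simp add: fun_eq_iff plus_fun_def)

lemma lie_act_zero [simp]: "lie_act A 0 = 0"
  using lie_act_lin[of A 1 0 0] by (simp add: fun_eq_iff zero_fun_def)

lemma lie_act_sum: "lie_act A (sum f S) = (\<Sum>i\<in>S. lie_act A (f i))"
  by (induction S rule: infinite_finite_induct)
    (simp_all only: sum.infinite sum.empty sum.insert lie_act_zero lie_act_add not_False_eq_True)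

lemma lie_act_hom:
  "lift (lie_act A K) zs = act (0, A) (lift K) zs"
  by (simp add: lie_act_def act_def act_sum_lift[where s = 1])

lemma multilinear_insert_brk:
  assumes "multilinear K" shows "multilinear (insert_brk s A K)"
  unfolding multilinear_def
proof (intro allI)
  fix us r X Y vs
  show "insert_brk s A K (us @ (scl L r X + Y) # vs)
     = scl L r (insert_brk s A K (us @ X # vs)) + insert_brk s A K (us @ Y # vs)"
    using assms
  proof (induction us arbitrary: K)
    case Nil
    have "(\<lambda>Ys. K ((scl L r X + Y) # Ys)) = (\<lambda>Ys. scl L r (K (X # Ys)) + K (Y # Ys))"
      by (rule ext) (rule multilinearD0[OF Nil])
    then show ?case
      by (simp add: insert_brk_lin brk_add_right brk_scl_right multilinearD0[OF Nil] vs.scale_right_distrib mult.commute)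
  next
    case (Cons u us)
    then show ?case
      using Cons.IH[OF multilinear_Cons[OF Cons.prems]] multilinearD[OF Cons.prems, of "brk L A u # us"]
      by (simp add: vs.scale_right_distrib mult.commute)
  qed
qed

lemma insert_brk_length:
  "(\<And>Ys. length Ys = length Xs \<Longrightarrow> K Ys = 0) \<Longrightarrow> insert_brk s A K Xs = 0"
  by (induction Xs arbitrary: K) auto

lemma lie_act_cochain:
  assumes K: "K \<in> cochains L (k, c)" and A: "A \<in> gr L 0"
  shows "lie_act A K \<in> cochains L (k, c)"
proof (rule cochainI)
  show "lie_act A K Xs = 0" if "int (length Xs) \<noteq> k + 1" for Xs
    using cochain_length[OF K] that by (simp add: lie_act_def insert_brk_length)
  show "multilinear (lie_act A K)"
    using cochain_multilinear[OF K] multilinear_insert_brk[OF cochain_multilinear[OF K], of 1 A]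
    by (simp add: multilinear_def lie_act_def brk_add_right brk_scl_right vs.scale_right_diff_distrib)
  show "alt_form c (lift (lie_act A K))"
    unfolding lie_act_hom using alt_form_act[OF alt_form_lift[OF K], of "(0, A)"] A by simp
qed

lemma DD_lie_act:
  assumes K: "K \<in> cochains L (k, c)" and A: "A \<in> gr L 0"
  shows "DD L (lie_act A K) = lie_act A (DD L K)"
proof (rule cochains_eqI[OF DD_cochain[OF lie_act_cochain[OF K A]] lie_act_cochain[OF DD_cochain[OF K] A]])
  fix zs :: "((int ^ 'n) \<times> 'e) list" assume zs: "homs zs" and len: "int (length zs) = k + 1 + 1"
  show "lift (DD L (lie_act A K)) zs = lift (lie_act A (DD L K)) zs"
  proof (cases "k < -1")
    case True
    then show ?thesis using cochains_negative[OF K] by simp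
  next
    case False
    define p where "p = nat (k + 1)"
    have k: "k = int p - 1" using False by (simp add: p_def)
    have len: "length zs = Suc p" using len k by simp
    note K' = K[unfolded k]
    have "lift (DD L (lie_act A K)) zs = cob p c (act (0, A) (lift K)) zs"
      using DD_hom[OF lie_act_cochain[OF K' A] zs len] unfolding lie_act_hom .
    also have "\<dots> = act (0, A) (cob p c (lift K)) zs"
      using A by (intro cob_act alt_form_lift[OF K'] zs len) auto
    also have "\<dots> = act (0, A) (lift (DD L K)) zs"
      using A DD_hom[OF K'] len by (intro act_cong[OF _ zs]) auto
    finally show ?thesis unfolding lie_act_hom .
  qed
qed

text \<open>
  The Cartan formula for a cocycle: the Lie derivative is null-homotopic.
\<close>

theorem lie_act_cocycle:
  assumes K: "K \<in> cochains L (k, c)" and A: "A \<in> gr L 0" and d: "DD L K = 0"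
  shows "lie_act A K = - DD L (\<lambda>Xs. K (A # Xs))"
proof (rule cochains_eqI[OF lie_act_cochain[OF K A]])
  have "(\<lambda>Xs. K (A # Xs)) \<in> cochains L (k - 1, c)" using contr_cochain[OF K A] by simp
  from DD_cochain[OF this] show "- DD L (\<lambda>Xs. K (A # Xs)) \<in> cochains L (k, c)"
    using cochains_diff[OF cochains_zero, of "DD L (\<lambda>Xs. K (A # Xs))"] by simp
  fix zs :: "((int ^ 'n) \<times> 'e) list" assume zs: "homs zs" and len: "int (length zs) = k + 1"
  show "lift (lie_act A K) zs = lift (- DD L (\<lambda>Xs. K (A # Xs))) zs"
    using DD_contr[OF K, of "(0, A)" zs] A zs len d
    by (simp add: lie_act_hom act_def algebra_simps)
qed

end

section \<open>Evaluation at formal power series\<close>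

lemma triangle_sum:
  "(\<Sum>j\<le>n. \<Sum>i\<le>n - j. f j i) = (\<Sum>(j, i)\<in>{(j, i). j + i \<le> n}. f j i)" for n :: nat
proof -
  have "{(j, i). j + i \<le> n} = Sigma {..n} (\<lambda>j. {..n - j})" by auto
  then show ?thesis by (simp add: sum.Sigma)
qed

lemma triangle_sum_swap:
  "(\<Sum>j\<le>n. \<Sum>i\<le>n - j. f j i) = (\<Sum>i\<le>n. \<Sum>j\<le>n - i. f j i)" for n :: nat
proof -
  have "(\<Sum>(j, i)\<in>{(j, i). j + i \<le> n}. f j i) = (\<Sum>(i, j)\<in>{(i, j). i + j \<le> n}. f j i)"
    by (rule sum.reindex_bij_witness[of _ "\<lambda>(i, j). (j, i)" "\<lambda>(i, j). (j, i)"]) auto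
  then show ?thesis unfolding triangle_sum .
qed

lemma triangle_sum_diagonal:
  "(\<Sum>j\<le>n. \<Sum>i\<le>n - j. f j i) = (\<Sum>r\<le>n. \<Sum>j\<le>r. f j (r - j))" for n :: nat
  unfolding triangle_sum by (rule sum.triangle_reindex_eq)

text \<open>
  The coefficient of order \<open>n\<close> of the value of \<open>K\<close> at formal power series. Splitting off one argument at a time
  turns sums over compositions of \<open>n\<close> into iterated Cauchy products.
\<close>

fun cauchy_eval :: "('v list \<Rightarrow> 'v::ab_group_add) \<Rightarrow> 'v fps list \<Rightarrow> nat \<Rightarrow> 'v" where
  "cauchy_eval K [] n = (if n = 0 then K [] else 0)"
| "cauchy_eval K (F # Fs) n = (\<Sum>j\<le>n. cauchy_eval (\<lambda>Xs. K (fps_nth F j # Xs)) Fs (n - j))"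

lemma eval_at_fps_nth: "fps_nth (eval_at_fps K Fs) n = cauchy_eval K Fs n"
proof (induction Fs arbitrary: K n)
  case Nil
  have "{js :: nat list. js = [] \<and> sum_list js = n} = (if n = 0 then {[]} else {})" by auto
  then show ?case by (simp add: eval_at_fps_def)
next
  case (Cons F Fs)
  let ?S = "\<lambda>m n. {js :: nat list. length js = m \<and> sum_list js = n}"
  have fin: "finite (?S m n)" for m n
  proof (rule finite_subset)
    show "?S m n \<subseteq> {js. set js \<subseteq> {..n} \<and> length js = m}"
      using member_le_sum_list by (auto intro: order_trans)
    show "finite {js. set js \<subseteq> {..n} \<and> length js = m}"
      by (rule finite_lists_length_eq) simp
  qed
  have "?S (Suc (length Fs)) n = (\<lambda>(j, js). j # js) ` Sigma {..n} (\<lambda>j. ?S (length Fs) (n - j))"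
    by (auto simp: length_Suc_conv image_iff)
  moreover have "inj_on (\<lambda>(j, js). j # js) (Sigma {..n} (\<lambda>j. ?S (length Fs) (n - j)))"
    by (auto simp: inj_on_def)
  ultimately have "fps_nth (eval_at_fps K (F # Fs)) n
      = (\<Sum>(j, js)\<in>Sigma {..n} (\<lambda>j. ?S (length Fs) (n - j)). K (fps_nth F j # map2 fps_nth Fs js))"
    by (simp add: eval_at_fps_def sum.reindex case_prod_unfold)
  also have "\<dots> = (\<Sum>j\<le>n. \<Sum>js\<in>?S (length Fs) (n - j). K (fps_nth F j # map2 fps_nth Fs js))"
    using fin by (simp add: sum.Sigma)
  also have "\<dots> = (\<Sum>j\<le>n. fps_nth (eval_at_fps (\<lambda>Xs. K (fps_nth F j # Xs)) Fs) (n - j))"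
    by (simp add: eval_at_fps_def)
  finally show ?case by (simp add: Cons.IH)
qed

lemma cauchy_eval_cong:
  assumes "\<And>Xs. list_all2 (\<lambda>X F. \<exists>j\<le>n. X = fps_nth F j) Xs Fs \<Longrightarrow> K Xs = M Xs"
  shows "cauchy_eval K Fs n = cauchy_eval M Fs n"
  using assms
proof (induction Fs arbitrary: K M n)
  case (Cons F Fs)
  have "cauchy_eval (\<lambda>Xs. K (fps_nth F j # Xs)) Fs (n - j) = cauchy_eval (\<lambda>Xs. M (fps_nth F j # Xs)) Fs (n - j)"
    if "j \<le> n" for j
  proof (rule Cons.IH)
    fix Xs assume "list_all2 (\<lambda>X F. \<exists>i\<le>n - j. X = fps_nth F i) Xs Fs"
    then have "list_all2 (\<lambda>X F. \<exists>i\<le>n. X = fps_nth F i) Xs Fs"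
      by (rule list_all2_mono) (use diff_le_self order_trans in blast)
    then show "K (fps_nth F j # Xs) = M (fps_nth F j # Xs)"
      using that by (intro Cons.prems) auto
  qed
  then show ?case by simp
qed (auto intro: assms)

lemma cauchy_eval_coeff_cong:
  assumes "list_all2 (\<lambda>F G. \<forall>j\<le>n. fps_nth F j = fps_nth G j) Fs Gs"
  shows "cauchy_eval K Fs n = cauchy_eval K Gs n"
  using assms
proof (induction Fs arbitrary: K Gs n)
  case (Cons F Fs)
  then obtain G Gs' where Gs: "Gs = G # Gs'" and FG: "\<forall>j\<le>n. fps_nth F j = fps_nth G j"
    and rest: "list_all2 (\<lambda>F G. \<forall>j\<le>n. fps_nth F j = fps_nth G j) Fs Gs'"
    by (auto simp: list_all2_Cons1)
  have "cauchy_eval (\<lambda>Xs. K (fps_nth G j # Xs)) Fs (n - j) = cauchy_eval (\<lambda>Xs. K (fps_nth G j # Xs)) Gs' (n - j)" for j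
    by (intro Cons.IH list_all2_mono[OF rest]) auto
  then show ?case unfolding Gs using FG by simp
qed simp

lemma cauchy_eval_zero: "cauchy_eval (\<lambda>Xs. 0) Fs n = 0"
  by (induction Fs arbitrary: n) simp_all

lemma list_all2_replicateD:
  "list_all2 P Xs (replicate p F) \<Longrightarrow> length Xs = p \<and> (\<forall>X\<in>set Xs. P X F)"
  by (auto simp: list_all2_conv_all_nth in_set_conv_nth)

context graded_lie_algebra
begin

lemma cauchy_eval_lin:
  "cauchy_eval (\<lambda>Xs. scl L r (K Xs) + M Xs) Fs n = scl L r (cauchy_eval K Fs n) + cauchy_eval M Fs n"
proof (induction Fs arbitrary: K M n)
  case (Cons F Fs)
  then show ?case by (simp add: sum.distrib vs.scale_sum_right)
qed simp

lemma cauchy_eval_add: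
  fixes K :: "'e list \<Rightarrow> 'e"
  shows "cauchy_eval (\<lambda>Xs. K Xs + M Xs) Fs n = cauchy_eval K Fs n + cauchy_eval M Fs n"
  using cauchy_eval_lin[of 1 K M] by simp

lemma cauchy_eval_scl: "cauchy_eval (\<lambda>Xs. scl L r (K Xs)) Fs n = scl L r (cauchy_eval K Fs n)"
  using cauchy_eval_lin[of r K "\<lambda>_. 0"] by (simp add: cauchy_eval_zero)

lemma cauchy_eval_minus:
  fixes K :: "'e list \<Rightarrow> 'e"
  shows "cauchy_eval (\<lambda>Xs. - K Xs) Fs n = - cauchy_eval K Fs n"
  using cauchy_eval_scl[of "-1" K] by simp

lemma cauchy_eval_diff:
  fixes K :: "'e list \<Rightarrow> 'e"
  shows "cauchy_eval (\<lambda>Xs. K Xs - M Xs) Fs n = cauchy_eval K Fs n - cauchy_eval M Fs n"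
  using cauchy_eval_add[of K "\<lambda>Xs. - M Xs"] by (simp add: cauchy_eval_minus)

lemma cauchy_eval_sum:
  fixes K :: "'i \<Rightarrow> 'e list \<Rightarrow> 'e"
  shows "cauchy_eval (\<lambda>Xs. \<Sum>i\<in>S. K i Xs) Fs n = (\<Sum>i\<in>S. cauchy_eval (K i) Fs n)"
  by (induction S rule: infinite_finite_induct) (simp_all add: cauchy_eval_zero cauchy_eval_add)

lemma cauchy_eval_brk: "cauchy_eval (\<lambda>Xs. brk L X (K Xs)) Fs n = brk L X (cauchy_eval K Fs n)"
proof (induction Fs arbitrary: K n)
  case (Cons F Fs)
  then show ?case by (simp add: brk_sum_right)
qed simp

lemma cauchy_eval_gr:
  assumes "\<And>Xs. list_all2 (\<lambda>X F. \<exists>j\<le>n. X = fps_nth F j) Xs Fs \<Longrightarrow> K Xs \<in> gr L x"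
  shows "cauchy_eval K Fs n \<in> gr L x"
  using assms
proof (induction Fs arbitrary: K n)
  case (Cons F Fs)
  have "cauchy_eval (\<lambda>Xs. K (fps_nth F j # Xs)) Fs (n - j) \<in> gr L x" if "j \<le> n" for j
  proof (rule Cons.IH)
    fix Xs assume "list_all2 (\<lambda>X F. \<exists>i\<le>n - j. X = fps_nth F i) Xs Fs"
    then have "list_all2 (\<lambda>X F. \<exists>i\<le>n. X = fps_nth F i) Xs Fs"
      by (rule list_all2_mono) (use diff_le_self order_trans in blast)
    then show "K (fps_nth F j # Xs) \<in> gr L x"
      using that by (intro Cons.prems) auto
  qed
  then show ?case by (auto intro: gr_sum)
qed (auto intro: assms)

text \<open>
  Collecting the terms by the total order of the two bracketed coefficients, each group contains a coefficient of
  \<open>[F, F]\<close>.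
\<close>

lemma cauchy_eval_insert_brk:
  assumes S: "\<And>i. i \<le> n \<Longrightarrow> (\<Sum>j\<le>i. brk L (fps_nth F j) (fps_nth F (i - j))) = 0"
    and "multilinear K" "m \<le> n"
  shows "(\<Sum>j\<le>m. cauchy_eval (insert_brk s (fps_nth F j) K) (replicate p F) (m - j)) = 0"
  using assms(2,3)
proof (induction p arbitrary: K m)
  case 0
  then show ?case by (intro sum.neutral) simp
next
  case (Suc p)
  let ?R = "replicate p F" and ?f = "fps_nth F"
  let ?A = "\<lambda>j i. cauchy_eval (\<lambda>Xs. K (brk L (?f j) (?f i) # Xs)) ?R (m - j - i)"
  let ?B = "\<lambda>j i. cauchy_eval (insert_brk s (?f j) (\<lambda>Xs. K (?f i # Xs))) ?R (m - j - i)"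
  have expand: "cauchy_eval (insert_brk s (?f j) K) (replicate (Suc p) F) (m - j)
      = (\<Sum>i\<le>m - j. ?A j i) + scl L s (\<Sum>i\<le>m - j. ?B j i)" for j
    by (simp add: cauchy_eval_add cauchy_eval_scl sum.distrib vs.scale_sum_right)
  have "(\<Sum>j\<le>m. \<Sum>i\<le>m - j. ?A j i) = (\<Sum>r\<le>m. \<Sum>j\<le>r. ?A j (r - j))"
    by (rule triangle_sum_diagonal)
  also have "\<dots> = (\<Sum>r\<le>m. cauchy_eval (\<lambda>Xs. K ((\<Sum>j\<le>r. brk L (?f j) (?f (r - j))) # Xs)) ?R (m - r))"
  proof (rule sum.cong[OF refl])
    fix r assume "r \<in> {..m}"
    have "cauchy_eval (\<lambda>Xs. K ((\<Sum>j\<le>r. brk L (?f j) (?f (r - j))) # Xs)) ?R (m - r)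
        = (\<Sum>j\<le>r. cauchy_eval (\<lambda>Xs. K (brk L (?f j) (?f (r - j)) # Xs)) ?R (m - r))"
      by (simp add: multilinear_sum0[OF Suc.prems(1)] cauchy_eval_sum)
    also have "\<dots> = (\<Sum>j\<le>r. ?A j (r - j))"
      by (rule sum.cong) auto
    finally show "(\<Sum>j\<le>r. ?A j (r - j)) = cauchy_eval (\<lambda>Xs. K ((\<Sum>j\<le>r. brk L (?f j) (?f (r - j))) # Xs)) ?R (m - r)" ..
  qed
  also have "\<dots> = 0"
    using S Suc.prems(2) by (intro sum.neutral) (simp add: multilinear_zero0[OF Suc.prems(1)] cauchy_eval_zero)
  finally have A: "(\<Sum>j\<le>m. \<Sum>i\<le>m - j. ?A j i) = 0" .
  have "(\<Sum>j\<le>m. \<Sum>i\<le>m - j. ?B j i) = (\<Sum>i\<le>m. \<Sum>j\<le>m - i. ?B j i)"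
    by (rule triangle_sum_swap)
  also have "\<dots> = (\<Sum>i\<le>m. \<Sum>j\<le>m - i. cauchy_eval (insert_brk s (?f j) (\<lambda>Xs. K (?f i # Xs))) ?R (m - i - j))"
    by (simp add: add.commute)
  also have "\<dots> = 0"
    using Suc.prems(2) by (intro sum.neutral ballI Suc.IH multilinear_Cons Suc.prems(1)) auto
  finally have B: "(\<Sum>j\<le>m. \<Sum>i\<le>m - j. ?B j i) = 0" .
  show ?case
    unfolding expand sum.distrib A vs.scale_sum_right[symmetric] B by simp
qed

lemma cauchy_eval_DD_step:
  assumes \<theta>: "odd (ip \<theta> \<theta>)" and F: "\<And>i. fps_nth F i \<in> gr L \<theta>"
    and S: "\<And>i. i \<le> n \<Longrightarrow> (\<Sum>j\<le>i. brk L (fps_nth F j) (fps_nth F (i - j))) = 0"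
    and K: "K \<in> cochains L (int p - 1, c)" and m: "m \<le> n"
  shows "cauchy_eval (DD L K) (replicate (Suc p) F) m
    = - scl L (msgn (ip c \<theta>)) (\<Sum>j\<le>m. brk L (fps_nth F j) (cauchy_eval K (replicate p F) (m - j)))
      - (\<Sum>j\<le>m. cauchy_eval (DD L (\<lambda>Xs. K (fps_nth F j # Xs))) (replicate p F) (m - j))"
  proof -
    let ?f = "fps_nth F"
    have "cauchy_eval (\<lambda>Xs. DD L K (?f j # Xs)) (replicate p F) (m - j)
      = cauchy_eval (\<lambda>Xs. insert_brk (-1) (?f j) K Xs - scl L (msgn (ip c \<theta>)) (brk L (?f j) (K Xs))
          - DD L (\<lambda>Xs. K (?f j # Xs)) Xs) (replicate p F) (m - j)" for j
    proof (rule cauchy_eval_cong)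
      fix Xs assume "list_all2 (\<lambda>X F. \<exists>i\<le>m - j. X = fps_nth F i) Xs (replicate p F)"
      from list_all2_replicateD[OF this] have Xs: "length Xs = p" "\<forall>X\<in>set Xs. X \<in> gr L \<theta>"
        using F by auto
      have map: "map snd (map (Pair \<theta>) Xs) = Xs" by (simp add: comp_def)
      have h: "homs (map (Pair \<theta>) Xs)" using Xs by auto
      have l: "int (length (map (Pair \<theta>) Xs)) = int p - 1 + 1" using Xs by simp
      have "DD L K (snd (\<theta>, ?f j) # map snd (map (Pair \<theta>) Xs))
        = act_sum (\<theta>, ?f j) (lift K) (map (Pair \<theta>) Xs)
          - scl L (msgn (ip \<theta> c)) (brk L (?f j) (lift K (map (Pair \<theta>) Xs)))
          - lift (DD L (\<lambda>Xs. K (?f j # Xs))) (map (Pair \<theta>) Xs)"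
        using DD_contr[OF K _ h l, of "(\<theta>, ?f j)"] F[of j] by simp
      moreover have "act_sum (\<theta>, ?f j) (lift K) (map (Pair \<theta>) Xs)
          = insert_brk (-1) (snd (\<theta>, ?f j)) K (map snd (map (Pair \<theta>) Xs))"
        by (rule act_sum_lift) (use \<theta> in \<open>auto simp: msgn_eq\<close>)
      ultimately show "DD L K (?f j # Xs) = insert_brk (-1) (?f j) K Xs
          - scl L (msgn (ip c \<theta>)) (brk L (?f j) (K Xs)) - DD L (\<lambda>Xs. K (?f j # Xs)) Xs"
        unfolding map by (simp add: ip_commute)
    qed
    then show ?thesis
      using cauchy_eval_insert_brk[OF S cochain_multilinear[OF K] m, of "-1" p]
      by (simp add: cauchy_eval_diff cauchy_eval_scl cauchy_eval_brk sum_subtractf vs.scale_sum_right)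
  qed

text \<open>
  Induction on the number of arguments. In the Cartan formula for a coefficient of \<open>F\<close> the terms of
  the Lie derivative with an inner bracket sum to coefficients of \<open>[F, F]\<close>, and the contracted cochain is
  handled by the induction hypothesis; the sign changes with its degree because \<open>\<theta>\<close> is odd.
\<close>

theorem cauchy_eval_DD:
  assumes \<theta>: "odd (ip \<theta> \<theta>)" and F: "\<And>i. fps_nth F i \<in> gr L \<theta>"
    and S: "\<And>i. i \<le> n \<Longrightarrow> (\<Sum>j\<le>i. brk L (fps_nth F j) (fps_nth F (i - j))) = 0"
    and "K \<in> cochains L (int p - 1, c)" "m \<le> n"
  shows "cauchy_eval (DD L K) (replicate (Suc p) F) m
    = - scl L (of_nat (Suc p) * msgn (ip c \<theta>))
        (\<Sum>j\<le>m. brk L (fps_nth F j) (cauchy_eval K (replicate p F) (m - j)))"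
  using assms(4,5)
proof (induction p arbitrary: K c m)
    case 0
    have "(\<lambda>Xs. K (fps_nth F j # Xs)) = 0" for j
      using cochain_length[OF 0(1)] by (intro ext) simp
    then have "DD L (\<lambda>Xs. K (fps_nth F j # Xs)) = 0" for j
      using DD_zero by metis
    then have "(\<Sum>j\<le>m. cauchy_eval (DD L (\<lambda>Xs. K (fps_nth F j # Xs))) (replicate 0 F) (m - j)) = 0"
      by (intro sum.neutral) simp
    then show ?case using cauchy_eval_DD_step[OF \<theta> F S 0] by simp
  next
    case (Suc p)
    let ?f = "fps_nth F"
    let ?B = "\<Sum>j\<le>m. brk L (?f j) (cauchy_eval K (replicate (Suc p) F) (m - j))"
    have K: "(\<lambda>Xs. K (?f j # Xs)) \<in> cochains L (int p - 1, c + \<theta>)" for j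
      using contr_cochain[OF Suc.prems(1) F[of j]] by simp
    have sgn: "msgn (ip (c + \<theta>) \<theta>) = - (msgn (ip c \<theta>) :: 'k)"
      using \<theta> by (simp add: ip_add_left msgn_add) (simp add: msgn_eq)
    have "(\<Sum>j\<le>m. cauchy_eval (DD L (\<lambda>Xs. K (?f j # Xs))) (replicate (Suc p) F) (m - j))
       = (\<Sum>j\<le>m. scl L (of_nat (Suc p) * msgn (ip c \<theta>))
          (\<Sum>i\<le>m - j. brk L (?f i) (cauchy_eval (\<lambda>Xs. K (?f j # Xs)) (replicate p F) (m - j - i))))"
    proof (rule sum.cong[OF refl])
      fix j assume "j \<in> {..m}"
      then have "m - j \<le> n" using Suc.prems(2) by simp
      from Suc.IH[OF K this, of j] show "cauchy_eval (DD L (\<lambda>Xs. K (?f j # Xs))) (replicate (Suc p) F) (m - j)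
        = scl L (of_nat (Suc p) * msgn (ip c \<theta>))
          (\<Sum>i\<le>m - j. brk L (?f i) (cauchy_eval (\<lambda>Xs. K (?f j # Xs)) (replicate p F) (m - j - i)))"
        unfolding sgn by simp
    qed
    also have "\<dots> = scl L (of_nat (Suc p) * msgn (ip c \<theta>))
        (\<Sum>i\<le>m. \<Sum>j\<le>m - i. brk L (?f i) (cauchy_eval (\<lambda>Xs. K (?f j # Xs)) (replicate p F) (m - j - i)))"
      unfolding vs.scale_sum_right[symmetric] by (rule arg_cong[OF triangle_sum_swap])
    also have "(\<Sum>i\<le>m. \<Sum>j\<le>m - i. brk L (?f i) (cauchy_eval (\<lambda>Xs. K (?f j # Xs)) (replicate p F) (m - j - i))) = ?B"
      by (simp add: brk_sum_right add.commute)
    finally have rest: "(\<Sum>j\<le>m. cauchy_eval (DD L (\<lambda>Xs. K (?f j # Xs))) (replicate (Suc p) F) (m - j))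
        = scl L (of_nat (Suc p) * msgn (ip c \<theta>)) ?B" .
    have "cauchy_eval (DD L K) (replicate (Suc (Suc p)) F) m
        = - scl L (msgn (ip c \<theta>)) ?B - scl L (of_nat (Suc p) * msgn (ip c \<theta>)) ?B"
      unfolding rest[symmetric] by (rule cauchy_eval_DD_step[OF \<theta> F S Suc.prems])
    also have "\<dots> = - scl L (of_nat (Suc (Suc p)) * msgn (ip c \<theta>)) ?B"
    proof -
      have "msgn (ip c \<theta>) + of_nat (Suc p) * msgn (ip c \<theta>) = (of_nat (Suc (Suc p)) * msgn (ip c \<theta>) :: 'k)"
        by (simp add: distrib_right)
      moreover have "- scl L a X - scl L b X = - scl L (a + b) X" for a b X
        by (simp add: vs.scale_left_distrib)
      ultimately show ?thesis by metis
    qed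
    finally show ?case .
qed


section \<open>Cochains as vector fields\<close>

text \<open>
  The coefficient of order \<open>n\<close> of \<open>\<eta>(C)(F)\<close> for \<open>s = 1\<close>, and of \<open>\<eta>(C)(-F)\<close> for \<open>s = -1\<close>. The twisted
  version absorbs the sign \<open>(-1)^\<langle>c, \<theta>\<rangle>\<close>, which for the cochains below depends on the number of arguments.
\<close>

definition eta_coeff :: "'k \<Rightarrow> ('e list \<Rightarrow> 'e) \<Rightarrow> 'e fps \<Rightarrow> nat \<Rightarrow> 'e" where
  "eta_coeff s C F n = (\<Sum>p\<in>arity_set C. scl L (s ^ p / fact p) (cauchy_eval C (replicate p F) n))"

lemma eta_fps_nth:
  "fps_nth (eta_fps L C F) n = (\<Sum>j\<le>n. eta_coeff 1 (fps_nth C j) F (n - j))"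
  by (simp add: eta_fps_def eta_coeff_def eval_at_fps_nth)

lemma cauchy_eval_const:
  "fps_nth F 0 = P \<Longrightarrow> cauchy_eval K (replicate p F) 0 = K (replicate p P)"
  by (induction p arbitrary: K) simp_all

lemma eta_eq_eta_coeff: "fps_nth F 0 = P \<Longrightarrow> eta L C P = eta_coeff 1 C F 0"
  by (simp add: eta_def eta_coeff_def cauchy_eval_const)

lemma arity_set_cochain: "K \<in> cochains L (int p - 1, c) \<Longrightarrow> arity_set K \<subseteq> {p}"
  using cochain_length by (fastforce simp: arity_set_def)

lemma cochain_arity_cases:
  assumes "K \<in> cochains L (k, c)"
  obtains "K = 0" | p where "k = int p - 1" "K \<in> cochains L (int p - 1, c)"
proof (cases "k < -1")
  case True
  then show ?thesis using that(1) cochains_negative[OF assms] by blast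
next
  case False
  then have "k = int (nat (k + 1)) - 1" by simp
  then show ?thesis using that(2) assms by metis
qed

lemma arity_set_zero [simp]: "arity_set 0 = {}"
  by (simp add: arity_set_def)

lemma arity_set_add: "arity_set (K + M) \<subseteq> arity_set K \<union> arity_set M" for K M :: "'e list \<Rightarrow> 'e"
  by (auto simp: arity_set_def)

lemma finite_arity_set:
  assumes "C \<in> all_cochains" shows "finite (arity_set C)"
  using assms
proof (induction rule: direct_sum_induct)
  case (homogeneous g u)
  obtain k c where g: "g = (k, c)" by (cases g)
  have "u \<in> cochains L (k, c)" using homogeneous g by simp
  then show ?case
  proof (cases rule: cochain_arity_cases)
    case (2 p)
    show ?thesis by (rule finite_subset[OF arity_set_cochain[OF 2(2)]]) simp
  next
    case 1
    show ?thesis unfolding 1 arity_set_zero by simp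
  qed
next
  case (add u w)
  have "finite (arity_set u \<union> arity_set w)" using add by blast
  then show ?case by (rule finite_subset[OF arity_set_add])
next
  case zero
  show ?case unfolding arity_set_zero by simp
qed

lemma DD_all: "u \<in> all_cochains \<Longrightarrow> DD L u \<in> all_cochains"
  by (rule DD_direct_sum[of _ UNIV UNIV]) auto

lemma eta_coeff_superset:
  assumes "finite S" "arity_set C \<subseteq> S"
  shows "eta_coeff s C F n = (\<Sum>p\<in>S. scl L (s ^ p / fact p) (cauchy_eval C (replicate p F) n))"
  unfolding eta_coeff_def
proof (rule sum.mono_neutral_left[OF assms])
  show "\<forall>p\<in>S - arity_set C. scl L (s ^ p / fact p) (cauchy_eval C (replicate p F) n) = 0"
  proof
    fix p assume p: "p \<in> S - arity_set C"
    have "cauchy_eval C (replicate p F) n = cauchy_eval (\<lambda>_. 0) (replicate p F) n"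
    proof (rule cauchy_eval_cong)
      fix Xs assume "list_all2 (\<lambda>X F. \<exists>j\<le>n. X = fps_nth F j) Xs (replicate p F)"
      from list_all2_replicateD[OF this] show "C Xs = 0"
        using p by (auto simp: arity_set_def)
    qed
    then show "scl L (s ^ p / fact p) (cauchy_eval C (replicate p F) n) = 0"
      by (simp add: cauchy_eval_zero)
  qed
qed

lemma eta_coeff_zero [simp]: "eta_coeff s 0 F n = 0"
  by (simp add: eta_coeff_def)

lemma eta_coeff_add:
  assumes "C \<in> all_cochains" "C' \<in> all_cochains"
  shows "eta_coeff s (C + C') F n = eta_coeff s C F n + eta_coeff s C' F n"
proof -
  let ?S = "arity_set C \<union> arity_set C'"
  have S: "finite ?S" using assms finite_arity_set by simp
  have "cauchy_eval (C + C') Fs n = cauchy_eval C Fs n + cauchy_eval C' Fs n" for Fs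
    using cauchy_eval_add[of C C'] by (simp add: plus_fun_def)
  then show ?thesis
    using eta_coeff_superset[OF S, of C] eta_coeff_superset[OF S, of C']
      eta_coeff_superset[OF S arity_set_add]
    by (simp add: vs.scale_right_distrib sum.distrib)
qed

lemma eta_coeff_scl: 
  assumes "C \<in> all_cochains"
  shows "eta_coeff s (\<lambda>Xs. scl L r (C Xs)) F n = scl L r (eta_coeff s C F n)"
proof -
  have "arity_set (\<lambda>Xs. scl L r (C Xs)) \<subseteq> arity_set C" by (auto simp: arity_set_def)
  from eta_coeff_superset[OF finite_arity_set[OF assms] this] show ?thesis
    by (simp add: eta_coeff_def cauchy_eval_scl vs.scale_sum_right mult.commute)
qed

lemma eta_coeff_uminus: "C \<in> all_cochains \<Longrightarrow> eta_coeff s (- C) F n = - eta_coeff s C F n"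
  using eta_coeff_scl[of C s "-1" F n] by (simp add: fun_Compl_def)

lemma eta_coeff_diff:
  "\<lbrakk>C \<in> all_cochains; C' \<in> all_cochains\<rbrakk> \<Longrightarrow>
     eta_coeff s (C - C') F n = eta_coeff s C F n - eta_coeff s C' F n"
  using eta_coeff_add[of C "- C'"] by (simp add: eta_coeff_uminus direct_sum_cochains_uminus)

lemma eta_coeff_sum:
  "(\<And>i. i \<in> A \<Longrightarrow> f i \<in> all_cochains) \<Longrightarrow> eta_coeff s (sum f A) F n = (\<Sum>i\<in>A. eta_coeff s (f i) F n)"
proof (induction A rule: infinite_finite_induct)
  case (insert x A)
  then have "eta_coeff s (f x + sum f A) F n = eta_coeff s (f x) F n + eta_coeff s (sum f A) F n"
    by (intro eta_coeff_add direct_sum_cochains_sum) auto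
  moreover have "eta_coeff s (sum f A) F n = (\<Sum>i\<in>A. eta_coeff s (f i) F n)"
    using insert by blast
  ultimately show ?case unfolding sum.insert[OF insert(1,2)] by metis
qed simp_all

lemma eta_coeff_cochain:
  assumes "K \<in> cochains L (int p - 1, c)"
  shows "eta_coeff s K F n = scl L (s ^ p / fact p) (cauchy_eval K (replicate p F) n)"
  using eta_coeff_superset[OF _ arity_set_cochain[OF assms]] by simp

lemma eta_coeff_coeff_cong:
  assumes "\<forall>j\<le>n. fps_nth F j = fps_nth G j"
  shows "eta_coeff s C F n = eta_coeff s C G n"
  unfolding eta_coeff_def
  using cauchy_eval_coeff_cong[of n "replicate p F" "replicate p G" C for p] assms
  by (simp add: list_all2_conv_all_nth)

lemma sum_list_replicate_vec: "sum_list (replicate p x) = int p *s x" for x :: "int ^ 'm"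
  by (induction p) (simp_all add: vec_eq_iff algebra_simps)

lemma cauchy_eval_cochain_gr:
  assumes K: "K \<in> cochains L (k, c)" and F: "\<And>i. i \<le> n \<Longrightarrow> fps_nth F i \<in> gr L \<theta>"
  shows "cauchy_eval K (replicate p F) n \<in> gr L (c + int p *s \<theta>)"
proof (rule cauchy_eval_gr)
  fix Xs assume "list_all2 (\<lambda>X F. \<exists>j\<le>n. X = fps_nth F j) Xs (replicate p F)"
  from list_all2_replicateD[OF this] have Xs: "length Xs = p" "\<forall>X\<in>set Xs. X \<in> gr L \<theta>"
    using F by auto
  then have "homs (map (Pair \<theta>) Xs)" by auto
  from cochain_degree[OF K this] show "K Xs \<in> gr L (c + int p *s \<theta>)"
    using Xs by (simp add: comp_def sum_list_replicate_vec map_replicate_const)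
qed

text \<open>
  The degrees of cochains which map copies of elements of degree \<open>\<theta>\<close> to degree \<open>\<theta>\<close>.
\<close>

definition degs0 :: "int ^ 'n \<Rightarrow> (int \<times> (int ^ 'n)) set" where
  "degs0 \<theta> = {(k, c). k *s \<theta> + c = 0}"

text \<open>
  The degrees of cochains which map copies of elements of degree \<open>\<theta>\<close> to degree \<open>0\<close>.
\<close>

definition degs1 :: "int ^ 'n \<Rightarrow> (int \<times> (int ^ 'n)) set" where
  "degs1 \<theta> = {(k, c). (k + 1) *s \<theta> + c = 0}"

lemma eta_coeff_gr:
  assumes "C \<in> direct_sum I (cochains L)" and F: "\<And>i. i \<le> n \<Longrightarrow> fps_nth F i \<in> gr L \<theta>"
    and I: "\<And>k c. (k, c) \<in> I \<Longrightarrow> (k + 1) *s \<theta> + c = x"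
  shows "eta_coeff s C F n \<in> gr L x"
proof -
  have "C \<in> all_cochains \<and> eta_coeff s C F n \<in> gr L x"
    using assms(1)
  proof (induction rule: direct_sum_induct)
    case zero
    show ?case unfolding eta_coeff_zero by (intro conjI direct_sum_zero gr_0)
  next
    case (homogeneous g u)
    obtain k c where g: "g = (k, c)" by (cases g)
    have u: "u \<in> cochains L (k, c)" using homogeneous g by simp
    then have "eta_coeff s u F n \<in> gr L x"
    proof (cases rule: cochain_arity_cases)
      case (2 p)
      have "c + int p *s \<theta> = x"
        using I[of k c] homogeneous(1) g 2(1) by (simp add: add.commute)
      then show ?thesis
        using cauchy_eval_cochain_gr[OF 2(2) F, of n p] eta_coeff_cochain[OF 2(2)] by (simp add: gr_scl)
    next
      case 1
      show ?thesis unfolding 1 eta_coeff_zero by simp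
    qed
    moreover have "u \<in> all_cochains"
      using u by (intro direct_sum_homogeneous[of "(k, c)"]) auto
    ultimately show ?case by blast
  next
    case (add u w)
    have uw: "u \<in> all_cochains" "w \<in> all_cochains"
      and gr: "eta_coeff s u F n \<in> gr L x" "eta_coeff s w F n \<in> gr L x"
      using add by blast+
    have "eta_coeff s (u + w) F n \<in> gr L x"
      unfolding eta_coeff_add[OF uw] by (rule gr_add[OF gr])
    then show ?case
      using direct_sum_cochains_add[OF uw] by blast
  qed
  then show ?thesis by blast
qed

lemma eta_coeff_degs0:
  assumes "C \<in> direct_sum (degs0 \<theta>) (cochains L)" "\<And>i. i \<le> n \<Longrightarrow> fps_nth F i \<in> gr L \<theta>"
  shows "eta_coeff s C F n \<in> gr L \<theta>"
proof (rule eta_coeff_gr[OF assms])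
  fix k c assume "(k, c) \<in> degs0 \<theta>"
  then show "(k + 1) *s \<theta> + c = \<theta>" by (simp add: degs0_def vec_eq_iff algebra_simps)
qed

lemma eta_coeff_degs1:
  assumes "C \<in> direct_sum (degs1 \<theta>) (cochains L)" "\<And>i. i \<le> n \<Longrightarrow> fps_nth F i \<in> gr L \<theta>"
  shows "eta_coeff s C F n \<in> gr L 0"
  by (rule eta_coeff_gr[OF assms]) (simp_all add: degs1_def)

definition square_coeff :: "'e fps \<Rightarrow> nat \<Rightarrow> 'e" where
  "square_coeff F n = (\<Sum>j\<le>n. brk L (fps_nth F j) (fps_nth F (n - j)))"

lemma square_coeff_eq: "fps_nth (fps_brk L F F) n = square_coeff F n"
  by (simp add: fps_brk_def square_coeff_def)

text \<open>
  A coboundary acts on Maurer-Cartan elements by the adjoint action. For these degrees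
  \<open>\<langle>c, \<theta>\<rangle>\<close> has the parity of the number of arguments of \<open>A\<close>.
\<close>

theorem eta_coeff_DD:
  assumes \<theta>: "odd (ip \<theta> \<theta>)" and F: "\<And>i. fps_nth F i \<in> gr L \<theta>"
    and S: "\<And>i. i \<le> n \<Longrightarrow> square_coeff F i = 0"
    and A: "A \<in> direct_sum (degs1 \<theta>) (cochains L)" and m: "m \<le> n"
  shows "eta_coeff 1 (DD L A) F m = - (\<Sum>j\<le>m. brk L (fps_nth F j) (eta_coeff (-1) A F (m - j)))"
proof -
  have "A \<in> all_cochains \<and> ?thesis"
    using A
  proof (induction rule: direct_sum_induct)
    case zero
    have "eta_coeff 1 (DD L 0) F m = - (\<Sum>j\<le>m. brk L (fps_nth F j) (eta_coeff (-1) 0 F (m - j)))"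
      unfolding DD_zero eta_coeff_zero by simp
    then show ?case using direct_sum_zero by blast
  next
    case (homogeneous g u)
    obtain k c where g: "g = (k, c)" by (cases g)
    have u: "u \<in> cochains L (k, c)" using homogeneous g by simp
    have "eta_coeff 1 (DD L u) F m = - (\<Sum>j\<le>m. brk L (fps_nth F j) (eta_coeff (-1) u F (m - j)))"
      using u
    proof (cases rule: cochain_arity_cases)
      case 1
      show ?thesis unfolding 1 DD_zero eta_coeff_zero by simp
    next
      case (2 p)
      have "c = (- int p) *s \<theta>"
        using homogeneous(1) g 2(1) by (simp add: degs1_def vec_eq_iff eq_neg_iff_add_eq_0 add.commute)
      then have "ip c \<theta> = - (int p * ip \<theta> \<theta>)" by (simp only: ip_smult_left)
      then have sgn: "msgn (ip c \<theta>) = ((-1) ^ p :: 'k)"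
        using \<theta> by (simp add: msgn_eq)
      have D: "DD L u \<in> cochains L (int (Suc p) - 1, c)"
        using DD_cochain[OF 2(2)] by simp
      have "eta_coeff 1 (DD L u) F m = - scl L (1 / fact (Suc p) * (of_nat (Suc p) * (-1) ^ p))
          (\<Sum>j\<le>m. brk L (fps_nth F j) (cauchy_eval u (replicate p F) (m - j)))"
        unfolding eta_coeff_cochain[OF D] sgn[symmetric]
        using cauchy_eval_DD[OF \<theta> F S[unfolded square_coeff_def] 2(2) m] by (simp del: fact_Suc of_nat_Suc replicate_Suc)
      also have "1 / fact (Suc p) * (of_nat (Suc p) * (-1) ^ p) = ((-1) ^ p / fact p :: 'k)"
        by (simp del: of_nat_Suc)
      finally show ?thesis
        unfolding eta_coeff_cochain[OF 2(2)] by (simp add: brk_scl_right vs.scale_sum_right)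
    qed
    moreover have "u \<in> all_cochains"
      using u by (intro direct_sum_homogeneous[of "(k, c)"]) auto
    ultimately show ?case by blast
  next
    case (add u w)
    have uw: "u \<in> all_cochains" "w \<in> all_cochains"
      and eq: "eta_coeff 1 (DD L u) F m = - (\<Sum>j\<le>m. brk L (fps_nth F j) (eta_coeff (-1) u F (m - j)))"
        "eta_coeff 1 (DD L w) F m = - (\<Sum>j\<le>m. brk L (fps_nth F j) (eta_coeff (-1) w F (m - j)))"
      using add by blast+
    have "eta_coeff 1 (DD L (u + w)) F m = - (\<Sum>j\<le>m. brk L (fps_nth F j) (eta_coeff (-1) (u + w) F (m - j)))"
      unfolding DD_add[OF uw] eta_coeff_add[OF DD_all[OF uw(1)] DD_all[OF uw(2)]] eta_coeff_add[OF uw] eq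
        brk_add_right sum.distrib by simp
    then show ?case using direct_sum_cochains_add[OF uw] by blast
  qed
  then show ?thesis by blast
qed

text \<open>
  The sign and the factor in the evaluation of \<open>DD K\<close> depend on the degree of \<open>K\<close>, but for a cocycle they
  can be cancelled in each component.
\<close>

theorem eta_coeff_cocycle:
  assumes \<theta>: "odd (ip \<theta> \<theta>)" and F: "\<And>i. fps_nth F i \<in> gr L \<theta>"
    and S: "\<And>i. i \<le> n \<Longrightarrow> square_coeff F i = 0"
    and C: "C \<in> direct_sum I (cochains L)" "DD L C = 0" and m: "m \<le> n"
  shows "(\<Sum>j\<le>m. brk L (fps_nth F j) (eta_coeff 1 C F (m - j))) = 0"
proof -
  have "C \<in> all_cochains \<and> ?thesis"
    using cocycle_components[OF C]
  proof (induction rule: direct_sum_induct)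
    case zero
    have "(\<Sum>j\<le>m. brk L (fps_nth F j) (eta_coeff 1 0 F (m - j))) = 0"
      unfolding eta_coeff_zero by simp
    then show ?case using direct_sum_zero by blast
  next
    case (homogeneous g u)
    obtain k c where g: "g = (k, c)" by (cases g)
    have u: "u \<in> cochains L (k, c)" and d: "DD L u = 0" using homogeneous g by auto
    have "(\<Sum>j\<le>m. brk L (fps_nth F j) (eta_coeff 1 u F (m - j))) = 0"
      using u
    proof (cases rule: cochain_arity_cases)
      case 1
      show ?thesis unfolding 1 eta_coeff_zero by simp
    next
      case (2 p)
      have "cauchy_eval (0 :: 'e list \<Rightarrow> 'e) (replicate (Suc p) F) m = 0"
        using cauchy_eval_zero[of "replicate (Suc p) F" m] by (simp only: zero_fun_def)
      then have "scl L (of_nat (Suc p) * msgn (ip c \<theta>))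
          (\<Sum>j\<le>m. brk L (fps_nth F j) (cauchy_eval u (replicate p F) (m - j))) = 0"
        using cauchy_eval_DD[OF \<theta> F S[unfolded square_coeff_def] 2(2) m] unfolding d
        by (simp del: of_nat_Suc replicate_Suc)
      then have "(\<Sum>j\<le>m. brk L (fps_nth F j) (cauchy_eval u (replicate p F) (m - j))) = 0"
        by (simp del: of_nat_Suc)
      then show ?thesis
        unfolding eta_coeff_cochain[OF 2(2)] by (simp add: brk_scl_right vs.scale_sum_right[symmetric])
    qed
    moreover have "u \<in> all_cochains"
      using u by (intro direct_sum_homogeneous[of "(k, c)"]) auto
    ultimately show ?case by blast
  next
    case (add u w)
    have uw: "u \<in> all_cochains" "w \<in> all_cochains"
      and eq: "(\<Sum>j\<le>m. brk L (fps_nth F j) (eta_coeff 1 u F (m - j))) = 0"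
        "(\<Sum>j\<le>m. brk L (fps_nth F j) (eta_coeff 1 w F (m - j))) = 0"
      using add by blast+
    have "(\<Sum>j\<le>m. brk L (fps_nth F j) (eta_coeff 1 (u + w) F (m - j))) = 0"
      unfolding eta_coeff_add[OF uw] brk_add_right sum.distrib eq by simp
    then show ?case using direct_sum_cochains_add[OF uw] by blast
  qed
  then show ?thesis by blast
qed

end

section \<open>Flows\<close>

lemma course_of_values_recursion:
  fixes \<Phi> :: "(nat \<Rightarrow> 'x) \<Rightarrow> nat \<Rightarrow> 'x"
  assumes "\<And>a b n. (\<And>j. j < n \<Longrightarrow> a j = b j) \<Longrightarrow> \<Phi> a n = \<Phi> b n"
  obtains a where "\<And>n. a n = \<Phi> a n"
proof
  let ?a = "wfrec less_than \<Phi>"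
  fix n
  have "?a n = \<Phi> (cut ?a less_than n) n" by (rule wfrec) simp
  also have "\<dots> = \<Phi> ?a n" by (rule assms) (simp add: cut_apply)
  finally show "?a n = \<Phi> ?a n" .
qed

context graded_lie_algebra
begin

text \<open>
  The product rule for formal power series in \<open>\<lambda>\<close>: \<open>n + 1 = j + (n + 1 - j)\<close> distributes the derivative.
\<close>

lemma leibniz_sum:
  "scl L (of_nat (Suc n)) (\<Sum>j\<le>Suc n. f j (Suc n - j))
    = (\<Sum>j\<le>n. scl L (of_nat (Suc j)) (f (Suc j) (n - j)))
      + (\<Sum>j\<le>n. scl L (of_nat (Suc (n - j))) (f j (Suc (n - j))))"
proof -
  have "scl L (of_nat (Suc n)) (f j (Suc n - j))
      = scl L (of_nat j) (f j (Suc n - j)) + scl L (of_nat (Suc n - j)) (f j (Suc n - j))"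
    if "j \<le> Suc n" for j
    using that by (simp add: vs.scale_left_distrib[symmetric] of_nat_add[symmetric] del: of_nat_Suc vs.scale_left_distrib of_nat_add)
  then have "scl L (of_nat (Suc n)) (\<Sum>j\<le>Suc n. f j (Suc n - j))
      = (\<Sum>j\<le>Suc n. scl L (of_nat j) (f j (Suc n - j))) + (\<Sum>j\<le>Suc n. scl L (of_nat (Suc n - j)) (f j (Suc n - j)))"
    unfolding vs.scale_sum_right sum.distrib[symmetric] by (intro sum.cong refl) simp
  also have "(\<Sum>j\<le>Suc n. scl L (of_nat j) (f j (Suc n - j))) = (\<Sum>j\<le>n. scl L (of_nat (Suc j)) (f (Suc j) (n - j)))"
    by (subst sum.atMost_Suc_shift) (simp del: of_nat_Suc)
  also have "(\<Sum>j\<le>Suc n. scl L (of_nat (Suc n - j)) (f j (Suc n - j))) = (\<Sum>j\<le>n. scl L (of_nat (Suc (n - j))) (f j (Suc (n - j))))"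
    unfolding sum.atMost_Suc by (simp add: Suc_diff_le del: of_nat_Suc)
  finally show ?thesis .
qed

text \<open>
  The coefficients of the solution of \<open>\<phi>' = ad(a) \<phi>\<close> with \<open>\<phi>_0 = id\<close>.
\<close>

fun flow :: "(nat \<Rightarrow> 'e) \<Rightarrow> nat \<Rightarrow> 'e \<Rightarrow> 'e" where
  "flow a 0 X = X"
| "flow a (Suc n) X = scl L (1 / of_nat (Suc n)) (\<Sum>j\<le>n. brk L (a j) (flow a (n - j) X))"

text \<open>
  The coefficients of the solution of \<open>T' = L_a T\<close> with \<open>T_0 = id\<close>.
\<close>

fun cflow :: "(nat \<Rightarrow> 'e) \<Rightarrow> nat \<Rightarrow> ('e list \<Rightarrow> 'e) \<Rightarrow> 'e list \<Rightarrow> 'e" where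
  "cflow a 0 K = K"
| "cflow a (Suc n) K = (\<lambda>Xs. scl L (1 / of_nat (Suc n)) ((\<Sum>j\<le>n. lie_act (a j) (cflow a (n - j) K)) Xs))"

declare flow.simps(2) [simp del] cflow.simps(2) [simp del]

lemma flow_Suc: "scl L (of_nat (Suc n)) (flow a (Suc n) X) = (\<Sum>j\<le>n. brk L (a j) (flow a (n - j) X))"
  by (simp add: flow.simps(2) del: of_nat_Suc)

lemma cflow_Suc: "scl L (of_nat (Suc n)) (cflow a (Suc n) K Xs) = (\<Sum>j\<le>n. lie_act (a j) (cflow a (n - j) K) Xs)"
  by (simp add: cflow.simps(2) sum_fun_apply del: of_nat_Suc)

lemma flow_cong: "(\<And>j. j < n \<Longrightarrow> a j = b j) \<Longrightarrow> flow a n X = flow b n X"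
proof (induction n arbitrary: X rule: less_induct)
  case (less n)
  show ?case
  proof (cases n)
    case (Suc m)
    have "(\<Sum>j\<le>m. brk L (a j) (flow a (m - j) X)) = (\<Sum>j\<le>m. brk L (b j) (flow b (m - j) X))"
      using less Suc by (intro sum.cong refl arg_cong2[where f = "brk L"]) auto
    then show ?thesis using Suc by (simp add: flow.simps(2))
  qed simp
qed

lemma cflow_cong: "(\<And>j. j < n \<Longrightarrow> a j = b j) \<Longrightarrow> cflow a n K = cflow b n K"
proof (induction n rule: less_induct)
  case (less n)
  show ?case
  proof (cases n)
    case (Suc m)
    have "(\<Sum>j\<le>m. lie_act (a j) (cflow a (m - j) K)) = (\<Sum>j\<le>m. lie_act (b j) (cflow b (m - j) K))"
      using less Suc by (intro sum.cong refl arg_cong2[where f = lie_act]) auto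
    then show ?thesis using Suc by (simp only: cflow.simps(2))
  qed simp
qed

lemma flow_lin: "flow a n (scl L r X + Y) = scl L r (flow a n X) + flow a n Y"
proof (induction n rule: less_induct)
  case (less n)
  show ?case
  proof (cases n)
    case (Suc m)
    have "(\<Sum>j\<le>m. brk L (a j) (flow a (m - j) (scl L r X + Y)))
        = (\<Sum>j\<le>m. scl L r (brk L (a j) (flow a (m - j) X)) + brk L (a j) (flow a (m - j) Y))"
      using less Suc by (intro sum.cong refl) (simp add: brk_add_right brk_scl_right)
    then show ?thesis
      using Suc by (simp add: flow.simps(2) sum.distrib vs.scale_sum_right vs.scale_right_distrib mult.commute)
  qed simp
qed

lemma flow_add: "flow a n (X + Y) = flow a n X + flow a n Y"
  using flow_lin[of a n 1] by simp

lemma flow_zero [simp]: "flow a n 0 = 0"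
  using flow_lin[of a n 1 0 0] by simp

lemma flow_scl: "flow a n (scl L r X) = scl L r (flow a n X)"
  using flow_lin[of a n r X 0] by simp

lemma flow_minus: "flow a n (- X) = - flow a n X"
  using flow_scl[of a n "-1"] by simp

lemma flow_sum: "flow a n (sum f S) = (\<Sum>i\<in>S. flow a n (f i))"
  by (induction S rule: infinite_finite_induct) (simp_all add: flow_add)

lemma flow_gr: "\<lbrakk>\<And>j. j < n \<Longrightarrow> a j \<in> gr L 0; X \<in> gr L x\<rbrakk> \<Longrightarrow> flow a n X \<in> gr L x"
proof (induction n rule: less_induct)
  case (less n)
  show ?case
  proof (cases n)
    case (Suc m)
    have "brk L (a j) (flow a (m - j) X) \<in> gr L x" if "j \<le> m" for j
      using degree[of "a j" 0 "flow a (m - j) X" x] less Suc that by simp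
    then show ?thesis using Suc by (auto simp: flow.simps(2) intro!: gr_scl gr_sum)
  qed (use less in simp)
qed

lemma multilinear_lie_act: "multilinear K \<Longrightarrow> multilinear (lie_act A K)"
  using multilinear_insert_brk[of K 1 A]
  by (simp add: multilinear_def lie_act_def brk_add_right brk_scl_right vs.scale_right_diff_distrib)

lemma multilinear_cflow:
  assumes "multilinear K" shows "multilinear (cflow a n K)"
proof (induction n rule: less_induct)
  case (less n)
  show ?case
  proof (cases n)
    case (Suc m)
    have "multilinear (lie_act (a j) (cflow a (m - j) K))" if "j \<le> m" for j
      using less Suc by (intro multilinear_lie_act) simp
    then show ?thesis
      unfolding Suc cflow.simps(2) sum_fun_apply multilinear_def
      by (simp add: sum.distrib vs.scale_sum_right vs.scale_right_distrib mult.commute)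
  qed (use assms in simp)
qed

lemma lie_act_length: "(\<And>Ys. length Ys = length Xs \<Longrightarrow> K Ys = 0) \<Longrightarrow> lie_act A K Xs = 0"
  by (simp add: lie_act_def insert_brk_length)

lemma cflow_length: "(\<And>Ys. length Ys = p \<Longrightarrow> K Ys = 0) \<Longrightarrow> length Xs = p \<Longrightarrow> cflow a n K Xs = 0"
proof (induction n arbitrary: Xs rule: less_induct)
  case (less n)
  show ?case
  proof (cases n)
    case (Suc m)
    have "lie_act (a j) (cflow a (m - j) K) Xs = 0" if "j \<le> m" for j
      using less Suc by (intro lie_act_length) simp
    then show ?thesis unfolding Suc cflow.simps(2) sum_fun_apply by simp
  qed (use less in simp)
qed

lemma cflow_Nil: "cflow a n K [] = flow a n (K [])"
proof (induction n rule: less_induct)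
  case (less n)
  show ?case
  proof (cases n)
    case (Suc m)
    have "lie_act (a j) (cflow a (m - j) K) [] = brk L (a j) (flow a (m - j) (K []))" if "j \<le> m" for j
      using less Suc by (simp add: lie_act_def)
    then show ?thesis unfolding Suc cflow.simps(2) sum_fun_apply flow.simps(2) by simp
  qed simp
qed

lemma lie_act_contr: "lie_act A (\<lambda>Ys. M (Y # Ys)) Xs = lie_act A M (Y # Xs) + M (brk L A Y # Xs)"
  by (simp add: lie_act_def)

text \<open>
  As power series, the contraction of \<open>T K\<close> with \<open>\<phi> X\<close> is \<open>T (i_X K)\<close>: both solve the same differential
  equation, since \<open>L_a (i_Y M) = i_Y (L_a M) + i_[a,Y] M\<close>. Comparing coefficients of order \<open>m\<close> after
  multiplication with \<open>m\<close> gives the induction.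
\<close>

lemma cflow_contr:
  assumes K: "multilinear K"
  shows "cflow a m (\<lambda>Ys. K (X # Ys)) Xs = (\<Sum>j\<le>m. cflow a j K (flow a (m - j) X # Xs))"
proof (induction m arbitrary: Xs rule: less_induct)
  case (less m)
  show ?case
  proof (cases m)
    case (Suc n)
    note ml = multilinear_cflow[OF K, of a]
    let ?c = "cflow a" and ?f = "\<lambda>n. flow a n X"
    have IH: "?c (n - l) (\<lambda>Ys. K (X # Ys)) = (\<Sum>j\<le>n - l. (\<lambda>Ys. ?c j K (?f (n - l - j) # Ys)))" for l
      using less[of "n - l"] Suc by (intro ext) (simp add: sum_fun_apply)
    have "scl L (of_nat (Suc n)) (?c (Suc n) (\<lambda>Ys. K (X # Ys)) Xs)
        = (\<Sum>l\<le>n. \<Sum>j\<le>n - l. lie_act (a l) (\<lambda>Ys. ?c j K (?f (n - l - j) # Ys)) Xs)"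
      unfolding cflow_Suc IH lie_act_sum sum_fun_apply ..
    also have "\<dots> = (\<Sum>l\<le>n. \<Sum>j\<le>n - l. lie_act (a l) (?c j K) (?f (n - l - j) # Xs))
        + (\<Sum>l\<le>n. \<Sum>j\<le>n - l. ?c j K (brk L (a l) (?f (n - l - j)) # Xs))"
      unfolding lie_act_contr sum.distrib ..
    also have "(\<Sum>l\<le>n. \<Sum>j\<le>n - l. lie_act (a l) (?c j K) (?f (n - l - j) # Xs))
        = (\<Sum>r\<le>n. \<Sum>l\<le>r. lie_act (a l) (?c (r - l) K) (?f (n - l - (r - l)) # Xs))"
      by (rule triangle_sum_diagonal)
    also have "\<dots> = (\<Sum>r\<le>n. scl L (of_nat (Suc r)) (?c (Suc r) K (?f (n - r) # Xs)))"
      unfolding cflow_Suc by (intro sum.cong refl) simp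
    also have "(\<Sum>l\<le>n. \<Sum>j\<le>n - l. ?c j K (brk L (a l) (?f (n - l - j)) # Xs))
        = (\<Sum>j\<le>n. \<Sum>l\<le>n - j. ?c j K (brk L (a l) (?f (n - l - j)) # Xs))"
      by (rule triangle_sum_swap)
    also have "\<dots> = (\<Sum>j\<le>n. ?c j K ((\<Sum>l\<le>n - j. brk L (a l) (?f (n - j - l))) # Xs))"
      unfolding multilinear_sum0[OF ml] by (simp add: add.commute)
    also have "\<dots> = (\<Sum>j\<le>n. scl L (of_nat (Suc (n - j))) (?c j K (?f (Suc (n - j)) # Xs)))"
      unfolding flow_Suc[symmetric] multilinear_scl0[OF ml] ..
    also have "(\<Sum>r\<le>n. scl L (of_nat (Suc r)) (?c (Suc r) K (?f (n - r) # Xs)))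
        + (\<Sum>j\<le>n. scl L (of_nat (Suc (n - j))) (?c j K (?f (Suc (n - j)) # Xs)))
        = scl L (of_nat (Suc n)) (\<Sum>j\<le>Suc n. ?c j K (?f (Suc n - j) # Xs))"
      by (rule leibniz_sum[symmetric])
    finally show ?thesis unfolding Suc by (simp del: of_nat_Suc)
  qed simp
qed

definition flow_fps :: "(nat \<Rightarrow> 'e) \<Rightarrow> 'e fps \<Rightarrow> 'e fps" where
  "flow_fps a F = Abs_fps (\<lambda>n. \<Sum>j\<le>n. flow a j (fps_nth F (n - j)))"

lemma flow_fps_nth: "fps_nth (flow_fps a F) n = (\<Sum>j\<le>n. flow a j (fps_nth F (n - j)))"
  by (simp add: flow_fps_def)

text \<open>
  Equivariance of evaluation under the flows. Fixing the first argument reduces the number of arguments by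
  \<open>cflow_contr\<close>; the rest is a rearrangement of triple Cauchy products.
\<close>

theorem flow_cauchy_eval:
  assumes "multilinear K"
  shows "(\<Sum>j\<le>n. flow a j (cauchy_eval K Fs (n - j)))
     = (\<Sum>j\<le>n. cauchy_eval (cflow a j K) (map (flow_fps a) Fs) (n - j))"
  using assms
proof (induction Fs arbitrary: K n)
  case Nil
  have "(\<Sum>j\<le>n. flow a j (if n - j = 0 then K [] else 0)) = (\<Sum>j\<le>n. if n - j = 0 then cflow a j K [] else 0)"
    by (intro sum.cong refl) (simp add: cflow_Nil)
  then show ?case by simp
next
  case (Cons F Fs)
  note K = \<open>multilinear K\<close>
  let ?f = "fps_nth F" and ?Gs = "map (flow_fps a) Fs"
  let ?T = "\<lambda>j r l. cauchy_eval (\<lambda>Xs. cflow a j K (flow a r (?f l) # Xs)) ?Gs (n - l - (j + r))"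
  have "(\<Sum>j\<le>n. flow a j (cauchy_eval K (F # Fs) (n - j)))
      = (\<Sum>j\<le>n. \<Sum>l\<le>n - j. flow a j (cauchy_eval (\<lambda>Xs. K (?f l # Xs)) Fs (n - j - l)))"
    by (simp add: flow_sum)
  also have "\<dots> = (\<Sum>l\<le>n. \<Sum>j\<le>n - l. flow a j (cauchy_eval (\<lambda>Xs. K (?f l # Xs)) Fs (n - j - l)))"
    by (rule triangle_sum_swap)
  also have "\<dots> = (\<Sum>l\<le>n. \<Sum>j\<le>n - l. flow a j (cauchy_eval (\<lambda>Xs. K (?f l # Xs)) Fs (n - l - j)))"
    by (simp add: add.commute)
  also have "\<dots> = (\<Sum>l\<le>n. \<Sum>m\<le>n - l. cauchy_eval (cflow a m (\<lambda>Xs. K (?f l # Xs))) ?Gs (n - l - m))"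
    by (intro sum.cong refl Cons.IH multilinear_Cons K)
  also have "\<dots> = (\<Sum>l\<le>n. \<Sum>m\<le>n - l. \<Sum>j\<le>m. ?T j (m - j) l)"
    unfolding cflow_contr[OF K] cauchy_eval_sum by (intro sum.cong refl) simp
  also have "\<dots> = (\<Sum>l\<le>n. \<Sum>j\<le>n - l. \<Sum>r\<le>n - l - j. ?T j r l)"
    unfolding triangle_sum_diagonal ..
  also have "\<dots> = (\<Sum>j\<le>n. \<Sum>l\<le>n - j. \<Sum>r\<le>n - l - j. ?T j r l)"
    by (rule triangle_sum_swap)
  also have "\<dots> = (\<Sum>j\<le>n. \<Sum>l\<le>n - j. \<Sum>r\<le>n - j - l. ?T j r l)"
    by (simp add: add.commute)
  also have "\<dots> = (\<Sum>j\<le>n. \<Sum>r\<le>n - j. \<Sum>l\<le>n - j - r. ?T j r l)"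
    by (intro sum.cong refl triangle_sum_swap)
  also have "\<dots> = (\<Sum>j\<le>n. \<Sum>i\<le>n - j. \<Sum>r\<le>i. ?T j r (i - r))"
    unfolding triangle_sum_diagonal ..
  also have "\<dots> = (\<Sum>j\<le>n. \<Sum>i\<le>n - j. cauchy_eval (\<lambda>Xs. cflow a j K (fps_nth (flow_fps a F) i # Xs)) ?Gs (n - j - i))"
  proof (intro sum.cong refl)
    fix j i assume "j \<in> {..n}" "i \<in> {..n - j}"
    then have "n - (i - r) - (j + r) = n - j - i" if "r \<le> i" for r using that by auto
    then show "(\<Sum>r\<le>i. ?T j r (i - r)) = cauchy_eval (\<lambda>Xs. cflow a j K (fps_nth (flow_fps a F) i # Xs)) ?Gs (n - j - i)"
      unfolding flow_fps_nth multilinear_sum0[OF multilinear_cflow[OF K]] cauchy_eval_sum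
      by (intro sum.cong refl) simp
  qed
  finally show ?case by simp
qed

lemma all_cochains_multilinear: "C \<in> all_cochains \<Longrightarrow> multilinear C"
proof (induction rule: direct_sum_induct)
  case zero
  then show ?case by (simp add: multilinear_def)
next
  case (homogeneous g u)
  then show ?case using cochain_multilinear[of u "fst g" "snd g"] by simp
next
  case (add u w)
  then show ?case using multilinear_lin[of u w 1 1] by (simp add: plus_fun_def)
qed

theorem flow_eta_coeff:
  assumes C: "C \<in> all_cochains"
  shows "(\<Sum>j\<le>n. flow a j (eta_coeff s C F (n - j))) = (\<Sum>j\<le>n. eta_coeff s (cflow a j C) (flow_fps a F) (n - j))"
proof -
  let ?S = "arity_set C"
  have sub: "arity_set (cflow a j C) \<subseteq> ?S" for j
  proof
    fix p assume "p \<in> arity_set (cflow a j C)"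
    then obtain Xs where "length Xs = p" "cflow a j C Xs \<noteq> 0" by (auto simp: arity_set_def)
    then have "\<exists>Ys. length Ys = p \<and> C Ys \<noteq> 0" using cflow_length[where K = C and p = p and Xs = Xs and a = a and n = j] by blast
    then show "p \<in> ?S" by (simp add: arity_set_def)
  qed
  have "(\<Sum>j\<le>n. flow a j (eta_coeff s C F (n - j)))
      = (\<Sum>p\<in>?S. scl L (s ^ p / fact p) (\<Sum>j\<le>n. flow a j (cauchy_eval C (replicate p F) (n - j))))"
    unfolding eta_coeff_def flow_sum flow_scl vs.scale_sum_right by (rule sum.swap)
  also have "\<dots> = (\<Sum>p\<in>?S. scl L (s ^ p / fact p) (\<Sum>j\<le>n. cauchy_eval (cflow a j C) (replicate p (flow_fps a F)) (n - j)))"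
    unfolding flow_cauchy_eval[OF all_cochains_multilinear[OF C]] by simp
  also have "\<dots> = (\<Sum>j\<le>n. eta_coeff s (cflow a j C) (flow_fps a F) (n - j))"
    unfolding eta_coeff_superset[OF finite_arity_set[OF C] sub] vs.scale_sum_right by (rule sum.swap)
  finally show ?thesis .
qed

definition cflow_fps :: "(nat \<Rightarrow> 'e) \<Rightarrow> ('e list \<Rightarrow> 'e) fps \<Rightarrow> ('e list \<Rightarrow> 'e) fps" where
  "cflow_fps a C = Abs_fps (\<lambda>n. \<Sum>j\<le>n. cflow a (n - j) (fps_nth C j))"

lemma flow_eta_fps:
  assumes C: "\<And>i. fps_nth C i \<in> all_cochains" "\<And>i j. cflow a j (fps_nth C i) \<in> all_cochains"
  shows "(\<Sum>j\<le>n. flow a j (fps_nth (eta_fps L C F) (n - j))) = fps_nth (eta_fps L (cflow_fps a C) (flow_fps a F)) n"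
proof -
  let ?c = "fps_nth C" and ?G = "flow_fps a F"
  have "(\<Sum>j\<le>n. flow a j (fps_nth (eta_fps L C F) (n - j)))
      = (\<Sum>j\<le>n. \<Sum>i\<le>n - j. flow a j (eta_coeff 1 (?c i) F (n - j - i)))"
    unfolding eta_fps_nth flow_sum ..
  also have "\<dots> = (\<Sum>i\<le>n. \<Sum>j\<le>n - i. flow a j (eta_coeff 1 (?c i) F (n - j - i)))"
    by (rule triangle_sum_swap)
  also have "\<dots> = (\<Sum>i\<le>n. \<Sum>j\<le>n - i. flow a j (eta_coeff 1 (?c i) F (n - i - j)))"
    by (simp add: add.commute)
  also have "\<dots> = (\<Sum>i\<le>n. \<Sum>j\<le>n - i. eta_coeff 1 (cflow a j (?c i)) ?G (n - i - j))"
    unfolding flow_eta_coeff[OF C(1)] ..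
  also have "\<dots> = (\<Sum>r\<le>n. \<Sum>i\<le>r. eta_coeff 1 (cflow a (r - i) (?c i)) ?G (n - i - (r - i)))"
    by (rule triangle_sum_diagonal)
  also have "\<dots> = (\<Sum>r\<le>n. \<Sum>i\<le>r. eta_coeff 1 (cflow a (r - i) (?c i)) ?G (n - r))"
    by (intro sum.cong refl) simp
  also have "\<dots> = (\<Sum>r\<le>n. eta_coeff 1 (fps_nth (cflow_fps a C) r) ?G (n - r))"
    using C(2) by (simp add: cflow_fps_def eta_coeff_sum)
  finally show ?thesis unfolding eta_fps_nth .
qed

text \<open>
  The differential equation for \<open>H = \<phi> F\<close>, namely \<open>H' = [a, H] + \<phi> F'\<close>.
\<close>

lemma flow_fps_derivative:
  "scl L (of_nat (Suc n)) (fps_nth (flow_fps a F) (Suc n))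
     = (\<Sum>j\<le>n. brk L (a j) (fps_nth (flow_fps a F) (n - j)))
       + (\<Sum>j\<le>n. flow a j (scl L (of_nat (Suc (n - j))) (fps_nth F (Suc (n - j)))))"
proof -
  have "(\<Sum>j\<le>n. brk L (a j) (fps_nth (flow_fps a F) (n - j)))
      = (\<Sum>l\<le>n. \<Sum>i\<le>n - l. brk L (a l) (flow a i (fps_nth F (n - l - i))))"
    unfolding flow_fps_nth brk_sum_right ..
  also have "\<dots> = (\<Sum>j\<le>n. \<Sum>l\<le>j. brk L (a l) (flow a (j - l) (fps_nth F (n - l - (j - l)))))"
    by (rule triangle_sum_diagonal)
  also have "\<dots> = (\<Sum>j\<le>n. scl L (of_nat (Suc j)) (flow a (Suc j) (fps_nth F (n - j))))"
    unfolding flow_Suc by (intro sum.cong refl) simp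
  finally show ?thesis
    unfolding flow_fps_nth[of a F "Suc n"] leibniz_sum[of n "\<lambda>j i. flow a j (fps_nth F i)"] flow_scl by simp
qed

definition unary :: "('e \<Rightarrow> 'e) \<Rightarrow> 'e list \<Rightarrow> 'e" where
  "unary f Xs = (if length Xs = 1 then f (hd Xs) else 0)"

lemma unary_single [simp]: "unary f [X] = f X"
  by (simp add: unary_def)

lemma unary_cochain:
  assumes lin: "\<And>r X Y. f (scl L r X + Y) = scl L r (f X) + f Y"
    and deg: "\<And>x X. X \<in> gr L x \<Longrightarrow> f X \<in> gr L (x + c)"
  shows "unary f \<in> cochains L (0, c)"
  unfolding cochains_iff multilin_iff
proof (intro conjI allI impI)
  show "unary f Xs = 0" if "int (length Xs) \<noteq> 0 + 1" for Xs
    using that by (simp add: unary_def)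
  show "multilinear (unary f)"
    unfolding multilinear_def
  proof (intro allI)
    fix us r X Y vs
    show "unary f (us @ (scl L r X + Y) # vs) = scl L r (unary f (us @ X # vs)) + unary f (us @ Y # vs)"
      by (cases "us = [] \<and> vs = []") (auto simp: unary_def lin)
  qed
  show "lift (unary f) zs \<in> gr L (c + sum_list (map fst zs))" if "homs zs" for zs
    using that deg by (cases "length zs = 1") (auto simp: unary_def length_Suc_conv add.commute)
  show "alternating (lift (unary f))"
    by (rule alternatingI) (simp add: unary_def)
qed

lemma lie_act_brk:
  assumes A: "A \<in> gr L 0" shows "lie_act A (brk_cochain L) = 0"
proof (rule cochains_eqI[OF lie_act_cochain[OF brk_cochain_in_cochains A] cochains_zero])
  fix zs :: "((int ^ 'n) \<times> 'e) list" assume zs: "homs zs" "int (length zs) = 1 + 1"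
  then obtain x y where "zs = [x, y]" by (auto simp: numeral_2_eq_2 length_Suc_conv)
  then show "lift (lie_act A (brk_cochain L)) zs = lift 0 zs"
    using jacobi_deg0[OF A, of "snd x" "fst x" "snd y" "fst y"] zs
    by (simp add: lie_act_def brk_cochain_def)
qed

lemma cflow_brk:
  assumes "\<And>j. a j \<in> gr L 0"
  shows "cflow a n (brk_cochain L) = (if n = 0 then brk_cochain L else 0)"
proof (induction n rule: less_induct)
  case (less n)
  show ?case
  proof (cases n)
    case (Suc m)
    have "lie_act (a j) (cflow a (m - j) (brk_cochain L)) = 0" if "j \<le> m" for j
    proof -
      have "cflow a (m - j) (brk_cochain L) = (if m - j = 0 then brk_cochain L else 0)"
        by (rule less) (use Suc in simp)
      then show ?thesis
        by (cases "m - j = 0") (simp_all only: if_True if_False lie_act_brk[OF assms] lie_act_zero simp_thms)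
    qed
    then have "cflow a (Suc m) (brk_cochain L) Xs = 0" for Xs
      unfolding cflow.simps(2) sum_fun_apply by simp
    then show ?thesis using Suc by (auto simp: fun_eq_iff)
  qed simp
qed

lemma cauchy_eval_brk_cochain:
  "cauchy_eval (brk_cochain L) [F, G] n = (\<Sum>j\<le>n. brk L (fps_nth F j) (fps_nth G (n - j)))"
proof -
  have "(\<Sum>i\<le>m. if m - i = 0 then f i else 0) = f m" for m and f :: "nat \<Rightarrow> 'e"
  proof -
    have "(\<Sum>i\<le>m. if m - i = 0 then f i else 0) = (\<Sum>i\<in>{m}. f i)"
      by (rule sum.mono_neutral_cong_right) auto
    then show ?thesis by simp
  qed
  note last = this
  have "brk_cochain L [X, Y] = brk L X Y" for X Y by (simp add: brk_cochain_def)
  then show ?thesis unfolding cauchy_eval.simps last by simp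
qed

text \<open>
  The bracket is itself a cochain, and it is invariant under the flow by the Jacobi identity; so this is the
  equivariance of evaluation.
\<close>

lemma flow_fps_brk:
  assumes a: "\<And>j. a j \<in> gr L 0"
  shows "flow_fps a (fps_brk L F G) = fps_brk L (flow_fps a F) (flow_fps a G)"
proof (rule fps_ext)
  fix n
  have "fps_nth (flow_fps a (fps_brk L F G)) n = (\<Sum>j\<le>n. flow a j (cauchy_eval (brk_cochain L) [F, G] (n - j)))"
    unfolding cauchy_eval_brk_cochain by (simp add: flow_fps_nth fps_brk_def)
  also have "\<dots> = (\<Sum>j\<le>n. cauchy_eval (cflow a j (brk_cochain L)) [flow_fps a F, flow_fps a G] (n - j))"
    using flow_cauchy_eval[OF cochain_multilinear[OF brk_cochain_in_cochains], of a "[F, G]" n] by simp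
  also have "\<dots> = (\<Sum>j\<in>{0}. cauchy_eval (cflow a j (brk_cochain L)) [flow_fps a F, flow_fps a G] (n - j))"
  proof (rule sum.mono_neutral_right)
    show "\<forall>j\<in>{..n} - {0}. cauchy_eval (cflow a j (brk_cochain L)) [flow_fps a F, flow_fps a G] (n - j) = 0"
    proof
      fix j assume "j \<in> {..n} - {0}"
      then have "cflow a j (brk_cochain L) = (\<lambda>_. 0)"
        using cflow_brk[OF a, where n = j] by (simp add: zero_fun_def)
      then show "cauchy_eval (cflow a j (brk_cochain L)) [flow_fps a F, flow_fps a G] (n - j) = 0"
        using cauchy_eval_zero by metis
    qed
  qed auto
  also have "\<dots> = fps_nth (fps_brk L (flow_fps a F) (flow_fps a G)) n"
    using cauchy_eval_brk_cochain[of "flow_fps a F" "flow_fps a G" n] by (simp add: fps_brk_def)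
  finally show "fps_nth (flow_fps a (fps_brk L F G)) n = fps_nth (fps_brk L (flow_fps a F) (flow_fps a G)) n" .
qed

end

lemma sum_atMost_rev: "(\<Sum>j\<le>n. f (n - j)) = (\<Sum>j\<le>n. f j)" for n :: nat
  by (rule sum.reindex_bij_witness[of _ "\<lambda>i. n - i" "\<lambda>i. n - i"]) auto

context graded_lie_algebra
begin

section \<open>Solutions are deformations\<close>

lemma deformation_cocycle_iff:
  "deformation_cocycle L \<theta> C \<longleftrightarrow>
     (\<forall>i. fps_nth C i \<in> direct_sum (degs0 \<theta>) (cochains L) \<and> DD L (fps_nth C i) = 0)"
  by (auto simp: deformation_cocycle_def fps_over_def degs0_def DD_fps_def fps_eq_iff)

lemma cohomologous_iff:
  "cohomologous L \<theta> C C' \<longleftrightarrow>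
     (\<exists>A. \<forall>i. fps_nth A i \<in> direct_sum (degs1 \<theta>) (cochains L)
        \<and> fps_nth C' i = fps_nth C i + DD L (fps_nth A i))"
proof -
  have "C' - C = DD_fps L A \<longleftrightarrow> (\<forall>i. fps_nth C' i = fps_nth C i + DD L (fps_nth A i))" for A
    unfolding fps_eq_iff by (auto simp: DD_fps_def diff_eq_eq add.commute)
  then show ?thesis
    unfolding cohomologous_def fps_over_def degs1_def by auto
qed

lemma solution_iff:
  "solution L \<theta> P C F \<longleftrightarrow> fps_nth F 0 = P \<and> (\<forall>i. fps_nth F i \<in> gr L \<theta>) \<and>
     (\<forall>n. scl L (of_nat (Suc n)) (fps_nth F (Suc n)) = - fps_nth (eta_fps L C F) n)"
  by (auto simp: solution_def fps_over_def fps_derivative_def fps_eq_iff eq_neg_iff_add_eq_0 simp del: of_nat_Suc)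

lemma eta_fps_cong:
  "(\<And>j. j \<le> n \<Longrightarrow> fps_nth F j = fps_nth G j) \<Longrightarrow> fps_nth (eta_fps L C F) n = fps_nth (eta_fps L C G) n"
  unfolding eta_fps_nth by (intro sum.cong refl eta_coeff_coeff_cong) auto

lemma eta_fps_gr:
  assumes "\<And>i. fps_nth C i \<in> direct_sum (degs0 \<theta>) (cochains L)" "\<And>i. i \<le> n \<Longrightarrow> fps_nth F i \<in> gr L \<theta>"
  shows "fps_nth (eta_fps L C F) n \<in> gr L \<theta>"
  unfolding eta_fps_nth using assms by (intro gr_sum eta_coeff_degs0) auto

lemma solution_unique:
  assumes "solution L \<theta> P C F" "solution L \<theta> P C G" shows "F = G"
proof (rule fps_ext)
  fix n show "fps_nth F n = fps_nth G n"
  proof (induction n rule: less_induct)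
    case (less n)
    show ?case
    proof (cases n)
      case (Suc m)
      have "fps_nth (eta_fps L C F) m = fps_nth (eta_fps L C G) m"
        using less Suc by (intro eta_fps_cong) auto
      then have "scl L (of_nat (Suc m)) (fps_nth F (Suc m)) = scl L (of_nat (Suc m)) (fps_nth G (Suc m))"
        using assms by (simp only: solution_iff)
      then show ?thesis using Suc by (simp del: of_nat_Suc)
    qed (use assms in \<open>simp add: solution_iff\<close>)
  qed
qed

lemma solution_exists:
  assumes C: "deformation_cocycle L \<theta> C" and P: "P \<in> gr L \<theta>"
  obtains F where "solution L \<theta> P C F"
proof -
  have C: "fps_nth C i \<in> direct_sum (degs0 \<theta>) (cochains L)" for i
    using C by (simp add: deformation_cocycle_iff)
  obtain a where a: "\<And>n. a n = (if n = 0 then P else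
      scl L (- 1 / of_nat n) (fps_nth (eta_fps L C (Abs_fps a)) (n - 1)))"
  proof (rule course_of_values_recursion)
    fix a b :: "nat \<Rightarrow> 'e" and n assume ab: "\<And>j. j < n \<Longrightarrow> a j = b j"
    have "fps_nth (eta_fps L C (Abs_fps a)) (n - 1) = fps_nth (eta_fps L C (Abs_fps b)) (n - 1)" if "n \<noteq> 0"
      using ab that by (intro eta_fps_cong) auto
    then show "(if n = 0 then P else scl L (- 1 / of_nat n) (fps_nth (eta_fps L C (Abs_fps a)) (n - 1)))
        = (if n = 0 then P else scl L (- 1 / of_nat n) (fps_nth (eta_fps L C (Abs_fps b)) (n - 1)))"
      by simp
  qed blast
  have "a n \<in> gr L \<theta>" for n
  proof (induction n rule: less_induct)
    case (less n)
    show ?case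
    proof (cases "n = 0")
      case True
      then show ?thesis using P by (subst a) simp
    next
      case False
      then have "fps_nth (eta_fps L C (Abs_fps a)) (n - 1) \<in> gr L \<theta>"
        using less by (intro eta_fps_gr[OF C]) simp
      then show ?thesis using False by (subst a) (simp only: if_False gr_scl)
    qed
  qed
  moreover have "scl L (of_nat (Suc n)) (a (Suc n)) = - fps_nth (eta_fps L C (Abs_fps a)) n" for n
    by (subst a) (simp del: of_nat_Suc)
  ultimately have "solution L \<theta> P C (Abs_fps a)"
    unfolding solution_iff using a[of 0] by simp
  then show ?thesis by (rule that)
qed

text \<open>
  A cocycle maps a Maurer-Cartan element to a tangent direction that preserves \<open>[F, F] = 0\<close>.
\<close>

lemma brk_eta_fps:
  assumes \<theta>: "odd (ip \<theta> \<theta>)" and F: "\<And>i. fps_nth F i \<in> gr L \<theta>"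
    and S: "\<And>i. i \<le> n \<Longrightarrow> square_coeff F i = 0"
    and C: "\<And>i. i \<le> n \<Longrightarrow> fps_nth C i \<in> direct_sum I (cochains L) \<and> DD L (fps_nth C i) = 0"
  shows "(\<Sum>j\<le>n. brk L (fps_nth F j) (fps_nth (eta_fps L C F) (n - j))) = 0"
proof -
  have "(\<Sum>j\<le>n. brk L (fps_nth F j) (fps_nth (eta_fps L C F) (n - j)))
      = (\<Sum>j\<le>n. \<Sum>i\<le>n - j. brk L (fps_nth F j) (eta_coeff 1 (fps_nth C i) F (n - j - i)))"
    unfolding eta_fps_nth brk_sum_right ..
  also have "\<dots> = (\<Sum>i\<le>n. \<Sum>j\<le>n - i. brk L (fps_nth F j) (eta_coeff 1 (fps_nth C i) F (n - j - i)))"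
    by (rule triangle_sum_swap)
  also have "\<dots> = (\<Sum>i\<le>n. \<Sum>j\<le>n - i. brk L (fps_nth F j) (eta_coeff 1 (fps_nth C i) F (n - i - j)))"
    by (simp add: add.commute)
  also have "\<dots> = 0"
  proof (rule sum.neutral, rule ballI)
    fix i assume "i \<in> {..n}"
    then have "fps_nth C i \<in> direct_sum I (cochains L)" "DD L (fps_nth C i) = 0" using C by auto
    from eta_coeff_cocycle[OF \<theta> F S this, of n "n - i"]
    show "(\<Sum>j\<le>n - i. brk L (fps_nth F j) (eta_coeff 1 (fps_nth C i) F (n - i - j))) = 0"
      by simp
  qed
  finally show ?thesis .
qed

lemma brk_sym:
  assumes \<theta>: "odd (ip \<theta> \<theta>)" and "X \<in> gr L \<theta>" "Y \<in> gr L \<theta>" shows "brk L X Y = brk L Y X"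
proof -
  have "swap_sign \<theta> \<theta> = (1 :: 'k)" using \<theta> by (simp add: swap_sign_def msgn_eq)
  then show ?thesis using brk_swap[OF assms(2,3)] by simp
qed

lemma square_coeff_derivative:
  assumes \<theta>: "odd (ip \<theta> \<theta>)" and F: "\<And>i. fps_nth F i \<in> gr L \<theta>"
  shows "scl L (of_nat (Suc n)) (square_coeff F (Suc n)) =
     scl L 2 (\<Sum>j\<le>n. brk L (fps_nth F j) (scl L (of_nat (Suc (n - j))) (fps_nth F (Suc (n - j)))))"
proof -
  have "(\<Sum>j\<le>n. scl L (of_nat (Suc j)) (brk L (fps_nth F (Suc j)) (fps_nth F (n - j))))
      = (\<Sum>j\<le>n. scl L (of_nat (Suc (n - j))) (brk L (fps_nth F (Suc (n - j))) (fps_nth F (n - (n - j)))))"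
    by (rule sum_atMost_rev[symmetric])
  also have "\<dots> = (\<Sum>j\<le>n. scl L (of_nat (Suc (n - j))) (brk L (fps_nth F j) (fps_nth F (Suc (n - j)))))"
  proof (intro sum.cong refl)
    fix j assume "j \<in> {..n}"
    then have "n - (n - j) = j" by simp
    then show "scl L (of_nat (Suc (n - j))) (brk L (fps_nth F (Suc (n - j))) (fps_nth F (n - (n - j))))
        = scl L (of_nat (Suc (n - j))) (brk L (fps_nth F j) (fps_nth F (Suc (n - j))))"
      using brk_sym[OF \<theta> F F] by metis
  qed
  finally show ?thesis
    unfolding square_coeff_def leibniz_sum[of n "\<lambda>j i. brk L (fps_nth F j) (fps_nth F i)"] scl_two brk_scl_right by simp
qed

text \<open>
  The differential equation determines the coefficients of \<open>[F, F]\<close> successively, and all of them vanish.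
\<close>

theorem solution_deformation:
  assumes \<theta>: "odd (ip \<theta> \<theta>)" and C: "deformation_cocycle L \<theta> C" and P: "P \<in> mc_elements L \<theta>"
    and sol: "solution L \<theta> P C F"
  shows "deformation L \<theta> P F"
proof -
  have F: "fps_nth F i \<in> gr L \<theta>" and F0: "fps_nth F 0 = P"
    and ode: "scl L (of_nat (Suc n)) (fps_nth F (Suc n)) = - fps_nth (eta_fps L C F) n" for i n
    using sol unfolding solution_iff by blast+
  have C: "fps_nth C i \<in> direct_sum (degs0 \<theta>) (cochains L) \<and> DD L (fps_nth C i) = 0" for i
    using C by (simp add: deformation_cocycle_iff)
  have "square_coeff F n = 0" for n
  proof (induction n rule: less_induct)
    case (less n)
    show ?case
    proof (cases n)
      case 0
      then show ?thesis using F0 P by (simp add: square_coeff_def mc_elements_def)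
    next
      case (Suc m)
      have "(\<Sum>j\<le>m. brk L (fps_nth F j) (fps_nth (eta_fps L C F) (m - j))) = 0"
        using less Suc by (intro brk_eta_fps[OF \<theta> F _ C]) auto
      then have "scl L (of_nat (Suc m)) (square_coeff F (Suc m)) = 0"
        unfolding square_coeff_derivative[OF \<theta> F] ode brk_minus_right sum_negf by simp
      then show ?thesis using Suc by (simp del: of_nat_Suc)
    qed
  qed
  then have "fps_brk L F F = 0"
    by (intro fps_ext) (simp add: square_coeff_eq)
  then show ?thesis
    using F F0 by (simp add: deformation_def fps_over_def)
qed

section \<open>The flow of a cocycle is cohomologous to it\<close>

lemma contr_direct_sum:
  assumes K: "K \<in> direct_sum (degs0 \<theta>) (cochains L)" and A: "A \<in> gr L 0"
  shows "(\<lambda>Xs. K (A # Xs)) \<in> direct_sum (degs1 \<theta>) (cochains L)"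
  using K
proof (induction rule: direct_sum_induct)
  case zero
  have "(\<lambda>Xs. (0 :: 'e list \<Rightarrow> 'e) (A # Xs)) = 0" by (simp add: zero_fun_def)
  then show ?case by (simp only: direct_sum_zero)
next
  case (homogeneous g u)
  then have "(fst g - 1, snd g) \<in> degs1 \<theta>" by (auto simp: degs0_def degs1_def)
  moreover have "(\<lambda>Xs. u (A # Xs)) \<in> cochains L (fst g - 1, snd g)"
    using contr_cochain[of u "fst g" "snd g" A 0] homogeneous A by simp
  ultimately show ?case by (rule direct_sum_homogeneous)
next
  case (add u w)
  then show ?case using direct_sum_cochains_add[OF add] by (simp add: plus_fun_def)
qed

lemma lie_act_direct_sum:
  assumes K: "K \<in> direct_sum I (cochains L)" and A: "A \<in> gr L 0"
  shows "lie_act A K \<in> direct_sum I (cochains L) \<and> DD L (lie_act A K) = lie_act A (DD L K)"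
proof -
  have "K \<in> all_cochains \<and> ?thesis" using K
  proof (induction rule: direct_sum_induct)
    case zero
    show ?case unfolding lie_act_zero DD_zero by (intro conjI direct_sum_zero refl)
  next
    case (homogeneous g u)
    then have u: "u \<in> cochains L (fst g, snd g)" by simp
    from lie_act_cochain[OF u A] have "lie_act A u \<in> direct_sum I (cochains L)"
      using homogeneous(1) by (intro direct_sum_homogeneous[of g]) auto
    moreover have "u \<in> all_cochains" using homogeneous by (intro direct_sum_homogeneous[of g]) auto
    ultimately show ?case using DD_lie_act[OF u A] by blast
  next
    case (add u w)
    have uw: "u \<in> all_cochains" "w \<in> all_cochains" and
      l: "lie_act A u \<in> direct_sum I (cochains L)" "lie_act A w \<in> direct_sum I (cochains L)" and
      d: "DD L (lie_act A u) = lie_act A (DD L u)" "DD L (lie_act A w) = lie_act A (DD L w)"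
      using add by blast+
    have "DD L (lie_act A (u + w)) = lie_act A (DD L (u + w))"
      unfolding lie_act_add DD_add[OF l[THEN direct_sum_all]] DD_add[OF uw] d ..
    moreover have "lie_act A (u + w) \<in> direct_sum I (cochains L)"
      unfolding lie_act_add by (rule direct_sum_cochains_add[OF l])
    ultimately show ?case using direct_sum_cochains_add[OF uw] by blast
  qed
  then show ?thesis by blast
qed

lemma lie_act_cocycle_sum:
  assumes K: "K \<in> direct_sum (degs0 \<theta>) (cochains L)" "DD L K = 0" and A: "A \<in> gr L 0"
  shows "lie_act A K = - DD L (\<lambda>Xs. K (A # Xs))"
proof -
  have "K \<in> direct_sum (degs0 \<theta>) (cochains L) \<and> ?thesis" using cocycle_components[OF K]
  proof (induction rule: direct_sum_induct)
    case zero
    have "(\<lambda>Xs. (0 :: 'e list \<Rightarrow> 'e) (A # Xs)) = 0" by (simp add: zero_fun_def)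
    then show ?case unfolding lie_act_zero by (simp only: DD_zero neg_0_equal_iff_equal direct_sum_zero minus_zero simp_thms)
  next
    case (homogeneous g u)
    then have u: "u \<in> cochains L (fst g, snd g)" and d: "DD L u = 0" by auto
    have "u \<in> direct_sum (degs0 \<theta>) (cochains L)"
      using homogeneous by (intro direct_sum_homogeneous[of g]) auto
    then show ?case using lie_act_cocycle[OF u A d] by blast
  next
    case (add u w)
    have uw: "u \<in> direct_sum (degs0 \<theta>) (cochains L)" "w \<in> direct_sum (degs0 \<theta>) (cochains L)"
      and l: "lie_act A u = - DD L (\<lambda>Xs. u (A # Xs))" "lie_act A w = - DD L (\<lambda>Xs. w (A # Xs))"
      using add by blast+
    have "(\<lambda>Xs. (u + w) (A # Xs)) = (\<lambda>Xs. u (A # Xs)) + (\<lambda>Xs. w (A # Xs))"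
      by (simp add: plus_fun_def)
    then have "lie_act A (u + w) = - DD L (\<lambda>Xs. (u + w) (A # Xs))"
      unfolding lie_act_add l
      by (simp only: DD_add[OF contr_direct_sum[OF uw(1) A, THEN direct_sum_all] contr_direct_sum[OF uw(2) A, THEN direct_sum_all]]
        minus_add_distrib)
    then show ?case using direct_sum_cochains_add[OF uw] by blast
  qed
  then show ?thesis by blast
qed

text \<open>
  The Lie derivative commutes with the differential.
\<close>

lemma cflow_cocycle:
  assumes a: "\<And>j. j < n \<Longrightarrow> a j \<in> gr L 0" and K: "K \<in> direct_sum I (cochains L)" "DD L K = 0"
  shows "cflow a n K \<in> direct_sum I (cochains L) \<and> DD L (cflow a n K) = 0"
  using a
proof (induction n rule: less_induct)
  case (less n)
  show ?case
  proof (cases n)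
    case 0
    show ?thesis unfolding 0 cflow.simps using K by blast
  next
    case (Suc m)
    have t: "cflow a (m - j) K \<in> direct_sum I (cochains L)" "DD L (cflow a (m - j) K) = 0" if "j \<le> m" for j
      using less that Suc by auto
    have l: "lie_act (a j) (cflow a (m - j) K) \<in> direct_sum I (cochains L)"
      "DD L (lie_act (a j) (cflow a (m - j) K)) = 0" if "j \<le> m" for j
      using lie_act_direct_sum[OF t(1)[OF that] less.prems[of j]] that Suc unfolding t(2)[OF that] lie_act_zero
      by auto
    have s: "(\<Sum>j\<le>m. lie_act (a j) (cflow a (m - j) K)) \<in> direct_sum I (cochains L)"
      using l(1) by (intro direct_sum_cochains_sum) auto
    have "DD L (\<Sum>j\<le>m. lie_act (a j) (cflow a (m - j) K)) = (\<Sum>j\<le>m. DD L (lie_act (a j) (cflow a (m - j) K)))"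
      using l(1) direct_sum_all by (intro DD_sum_all) auto
    also have "\<dots> = 0" using l(2) by (intro sum.neutral) auto
    finally have "DD L (cflow a (Suc m) K) = 0"
      unfolding cflow.simps(2) DD_scl[OF direct_sum_all[OF s]] by (simp add: zero_fun_def)
    moreover have "cflow a (Suc m) K \<in> direct_sum I (cochains L)"
      unfolding cflow.simps(2) by (rule direct_sum_cochains_scl[OF s])
    ultimately show ?thesis unfolding Suc by blast
  qed
qed

text \<open>
  The primitive of \<open>K - T K\<close>: integrating \<open>(T K)' = L_a (T K) = - DD (i_a T K)\<close> divides the coefficient of
  order \<open>n - 1\<close> by \<open>n\<close>. The part of order \<open>n\<close> involves only coefficients of \<open>a\<close> of lower order.
\<close>

definition homotopy :: "(nat \<Rightarrow> 'e) \<Rightarrow> nat \<Rightarrow> ('e list \<Rightarrow> 'e) \<Rightarrow> 'e list \<Rightarrow> 'e" where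
  "homotopy a n K = (if n = 0 then 0 else
     (\<lambda>Xs. scl L (1 / of_nat n) ((\<Sum>j<n. (\<lambda>Xs. cflow a (n - 1 - j) K (a j # Xs))) Xs)))"

lemma homotopy_cong: "(\<And>j. j < n \<Longrightarrow> a j = b j) \<Longrightarrow> homotopy a n K = homotopy b n K"
proof -
  assume ab: "\<And>j. j < n \<Longrightarrow> a j = b j"
  have "(\<Sum>j<n. (\<lambda>Xs. cflow a (n - 1 - j) K (a j # Xs))) = (\<Sum>j<n. (\<lambda>Xs. cflow b (n - 1 - j) K (b j # Xs)))"
  proof (intro sum.cong refl)
    fix j assume "j \<in> {..<n}"
    then have "cflow a (n - 1 - j) K = cflow b (n - 1 - j) K" "a j = b j"
      using ab by (auto intro: cflow_cong)
    then show "(\<lambda>Xs. cflow a (n - 1 - j) K (a j # Xs)) = (\<lambda>Xs. cflow b (n - 1 - j) K (b j # Xs))" by simp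
  qed
  then show ?thesis by (simp only: homotopy_def)
qed

theorem cflow_homotopy:
  assumes a: "\<And>j. j < n \<Longrightarrow> a j \<in> gr L 0" and K: "K \<in> direct_sum (degs0 \<theta>) (cochains L)" "DD L K = 0"
  shows "homotopy a n K \<in> direct_sum (degs1 \<theta>) (cochains L)"
    and "cflow a n K = (if n = 0 then K else 0) - DD L (homotopy a n K)"
proof -
  have c: "(\<lambda>Xs. cflow a (n - 1 - j) K (a j # Xs)) \<in> direct_sum (degs1 \<theta>) (cochains L)"
    and l: "lie_act (a j) (cflow a (n - 1 - j) K) = - DD L (\<lambda>Xs. cflow a (n - 1 - j) K (a j # Xs))" if "j < n" for j
    using contr_direct_sum[of "cflow a (n - 1 - j) K"] lie_act_cocycle_sum[of "cflow a (n - 1 - j) K"]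
      cflow_cocycle[OF _ K, of "n - 1 - j" a] a that by auto
  let ?s = "\<Sum>j<n. (\<lambda>Xs. cflow a (n - 1 - j) K (a j # Xs))"
  have s: "?s \<in> direct_sum (degs1 \<theta>) (cochains L)"
    using c by (intro direct_sum_cochains_sum) auto
  show "homotopy a n K \<in> direct_sum (degs1 \<theta>) (cochains L)"
  proof (cases "n = 0")
    case True
    then show ?thesis by (simp only: homotopy_def if_True simp_thms direct_sum_zero)
  next
    case False
    then show ?thesis using direct_sum_cochains_scl[OF s] by (simp only: homotopy_def if_False)
  qed
  show "cflow a n K = (if n = 0 then K else 0) - DD L (homotopy a n K)"
  proof (cases n)
    case 0
    then show ?thesis by (simp only: homotopy_def DD_zero cflow.simps if_True diff_0_right simp_thms)
  next
    case (Suc m)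
    have "DD L ?s = (\<Sum>j<n. DD L (\<lambda>Xs. cflow a (n - 1 - j) K (a j # Xs)))"
      using c direct_sum_all by (intro DD_sum_all) auto
    also have "\<dots> = (\<Sum>j<n. - lie_act (a j) (cflow a (n - 1 - j) K))"
      using l by (intro sum.cong refl) (metis lessThan_iff minus_minus)
    finally have D: "DD L ?s = - (\<Sum>j\<le>m. lie_act (a j) (cflow a (m - j) K))"
      unfolding Suc by (simp only: sum_negf lessThan_Suc_atMost diff_Suc_1)
    have "DD L (homotopy a n K) = (\<lambda>Xs. scl L (1 / of_nat n) (DD L ?s Xs))"
      using DD_scl[OF direct_sum_all[OF s]] Suc by (simp only: homotopy_def if_False nat.distinct simp_thms)
    then have "DD L (homotopy a n K) Xs = - cflow a n K Xs" for Xs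
      unfolding D cflow.simps(2)[of a m K, folded Suc] by simp
    then show ?thesis using Suc by (simp add: fun_eq_iff)
  qed
qed

text \<open>
  The primitive for a cocycle whose coefficients depend on \<open>\<lambda>\<close>; the flow acts \<open>\<lambda>\<close>-linearly.
\<close>

definition homotopy_fps :: "(nat \<Rightarrow> 'e) \<Rightarrow> ('e list \<Rightarrow> 'e) fps \<Rightarrow> nat \<Rightarrow> 'e list \<Rightarrow> 'e" where
  "homotopy_fps a C n = (\<Sum>j\<le>n. homotopy a (n - j) (fps_nth C j))"

lemma cflow_fps_homotopy:
  assumes a: "\<And>j. j < n \<Longrightarrow> a j \<in> gr L 0" and C: "deformation_cocycle L \<theta> C"
  shows "homotopy_fps a C n \<in> direct_sum (degs1 \<theta>) (cochains L)"
    and "fps_nth (cflow_fps a C) n = fps_nth C n - DD L (homotopy_fps a C n)"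
    and "fps_nth (cflow_fps a C) n \<in> direct_sum (degs0 \<theta>) (cochains L)"
    and "DD L (fps_nth (cflow_fps a C) n) = 0"
proof -
  have K: "fps_nth C j \<in> direct_sum (degs0 \<theta>) (cochains L)" "DD L (fps_nth C j) = 0" for j
    using C by (auto simp: deformation_cocycle_iff)
  have h: "homotopy a (n - j) (fps_nth C j) \<in> direct_sum (degs1 \<theta>) (cochains L)"
    "cflow a (n - j) (fps_nth C j) = (if n - j = 0 then fps_nth C j else 0) - DD L (homotopy a (n - j) (fps_nth C j))" for j
    using a by (intro cflow_homotopy[OF _ K]; simp)+
  show h1: "homotopy_fps a C n \<in> direct_sum (degs1 \<theta>) (cochains L)"
    unfolding homotopy_fps_def by (intro direct_sum_cochains_sum h)
  have c: "cflow a (n - j) (fps_nth C j) \<in> direct_sum (degs0 \<theta>) (cochains L)"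
    "DD L (cflow a (n - j) (fps_nth C j)) = 0" for j
    using cflow_cocycle[OF _ K, of "n - j" a] a by auto
  have nth: "fps_nth (cflow_fps a C) n = (\<Sum>j\<le>n. cflow a (n - j) (fps_nth C j))"
    by (simp only: cflow_fps_def fps_nth_Abs_fps)
  have "(\<Sum>j\<le>n. if n - j = 0 then fps_nth C j else 0) = (\<Sum>j\<in>{n}. fps_nth C j)"
    by (rule sum.mono_neutral_cong_right) auto
  then have last: "(\<Sum>j\<le>n. if n - j = 0 then fps_nth C j else 0) = fps_nth C n"
    by simp
  have D: "DD L (\<Sum>j\<le>n. homotopy a (n - j) (fps_nth C j)) = (\<Sum>j\<le>n. DD L (homotopy a (n - j) (fps_nth C j)))"
    by (rule DD_sum_all) (rule direct_sum_all[OF h(1)])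
  show "fps_nth (cflow_fps a C) n = fps_nth C n - DD L (homotopy_fps a C n)"
    unfolding nth h(2) sum_subtractf last homotopy_fps_def D by (rule refl)
  show "fps_nth (cflow_fps a C) n \<in> direct_sum (degs0 \<theta>) (cochains L)"
    unfolding nth by (intro direct_sum_cochains_sum c)
  show "DD L (fps_nth (cflow_fps a C) n) = 0"
  proof -
    have "DD L (\<Sum>j\<le>n. cflow a (n - j) (fps_nth C j)) = (\<Sum>j\<le>n. DD L (cflow a (n - j) (fps_nth C j)))"
      by (rule DD_sum_all) (rule direct_sum_all[OF c(1)])
    then show ?thesis unfolding nth c(2) by simp
  qed
qed

lemma homotopy_fps_cong: "(\<And>j. j < n \<Longrightarrow> a j = b j) \<Longrightarrow> homotopy_fps a C n = homotopy_fps b C n"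
  unfolding homotopy_fps_def by (intro sum.cong refl homotopy_cong) auto

section \<open>Flows are equivalences\<close>

text \<open>
  A series of operators which begins with the identity can be inverted order by order; on the direct sum this
  is done in each degree separately.
\<close>

lemma unipotent_bij:
  fixes \<psi> :: "nat \<Rightarrow> 'e \<Rightarrow> 'e" and U :: "'e fps \<Rightarrow> 'e fps"
  assumes U: "\<And>F n. fps_nth (U F) n = (\<Sum>j\<le>n. \<psi> j (fps_nth F (n - j)))"
    and id: "\<And>X. \<psi> 0 X = X" and add: "\<And>n X Y. \<psi> n (X + Y) = \<psi> n X + \<psi> n Y"
    and deg: "\<And>n x X. X \<in> gr L x \<Longrightarrow> \<psi> n X \<in> gr L x"
  shows "bij_betw U (fps_space L) (fps_space L)" "U ` fps_over (gr L x) \<subseteq> fps_over (gr L x)"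
proof -
  have zero: "\<psi> n 0 = 0" for n using add[of n 0 0] by simp
  have U_sum: "U (sum f S) = (\<Sum>i\<in>S. U (f i))" if "finite S" for f :: "int ^ 'n \<Rightarrow> 'e fps" and S
    using that
  proof (induction S rule: finite_induct)
    case empty
    show ?case by (rule fps_ext) (simp add: U zero)
  next
    case (insert i S)
    have "U (f i + sum f S) = U (f i) + U (sum f S)"
      by (rule fps_ext) (simp add: U add sum.distrib)
    then show ?case using insert by simp
  qed
  show over: "U ` fps_over (gr L x) \<subseteq> fps_over (gr L x)" for x
    by (auto simp: fps_over_def U intro!: gr_sum deg)
  have split: "fps_nth (U F) n = fps_nth F n + (\<Sum>j<n. \<psi> (n - j) (fps_nth F j))" for F n
  proof -
    have "(\<Sum>j\<le>n. \<psi> j (fps_nth F (n - j))) = (\<Sum>j\<le>n. \<psi> (n - j) (fps_nth F (n - (n - j))))"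
      by (rule sum_atMost_rev[symmetric])
    also have "\<dots> = (\<Sum>j\<le>n. \<psi> (n - j) (fps_nth F j))" by (intro sum.cong refl) simp
    finally show ?thesis unfolding U by (simp add: lessThan_Suc_atMost[symmetric] id add.commute)
  qed
  have surj: "\<exists>F \<in> fps_over (gr L x). U F = G" if G: "G \<in> fps_over (gr L x)" for G x
  proof -
    obtain v where v: "\<And>n. v n = fps_nth G n - (\<Sum>j<n. \<psi> (n - j) (v j))"
      by (rule course_of_values_recursion[where \<Phi> = "\<lambda>v n. fps_nth G n - (\<Sum>j<n. \<psi> (n - j) (v j))"]) auto
    have "v n \<in> gr L x" for n
    proof (induction n rule: less_induct)
      case (less n)
      then show ?case
        using G by (subst v) (auto simp: fps_over_def intro!: gr_diff gr_sum deg)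
    qed
    moreover have "U (Abs_fps v) = G"
      by (rule fps_ext) (simp add: split, subst v, simp)
    ultimately show ?thesis by (intro bexI[of _ "Abs_fps v"]) (auto simp: fps_over_def)
  qed
  have inj: "F = G" if "U F = U G" for F G
  proof (rule fps_ext)
    fix n show "fps_nth F n = fps_nth G n"
    proof (induction n rule: less_induct)
      case (less n)
      have "(\<Sum>j<n. \<psi> (n - j) (fps_nth F j)) = (\<Sum>j<n. \<psi> (n - j) (fps_nth G j))"
        using less by (intro sum.cong) auto
      then show ?case using split[of F n] split[of G n] that by simp
    qed
  qed
  show "bij_betw U (fps_space L) (fps_space L)"
    unfolding bij_betw_def
  proof (intro conjI equalityI subsetI)
    show "inj_on U (fps_space L)" using inj by (auto simp: inj_on_def)
  next
    fix G assume "G \<in> U ` fps_space L"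
    then obtain S f where S: "finite S" "\<forall>x\<in>S. f x \<in> fps_over (gr L x)" "G = U (sum f S)"
      unfolding fps_space_def direct_sum_def by blast
    show "G \<in> fps_space L"
      unfolding S(3) U_sum[OF S(1)] fps_space_def using S(1,2) over by (intro direct_sumI) auto
  next
    fix G assume "G \<in> fps_space L"
    then obtain S f where S: "finite S" "\<forall>x\<in>S. f x \<in> fps_over (gr L x)" "G = sum f S"
      unfolding fps_space_def direct_sum_def by blast
    have "\<exists>h. \<forall>x\<in>S. h x \<in> fps_over (gr L x) \<and> U (h x) = f x"
      using S(2) surj by (intro bchoice) blast
    then obtain h where h: "\<forall>x\<in>S. h x \<in> fps_over (gr L x) \<and> U (h x) = f x" by blast
    have "G = U (sum h S)" unfolding S(3) U_sum[OF S(1)] using h by simp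
    moreover have "sum h S \<in> fps_space L"
      unfolding fps_space_def using S(1) h by (intro direct_sumI) auto
    ultimately show "G \<in> U ` fps_space L" by blast
  qed
qed

theorem flow_equivalence:
  assumes a: "\<And>j. a j \<in> gr L 0"
  obtains \<phi> where "equivalence L \<phi>" "\<And>F. apply_fps \<phi> F = flow_fps a F"
proof
  let ?\<phi> = "Abs_fps (\<lambda>n. unary (flow a n))"
  show app: "apply_fps ?\<phi> F = flow_fps a F" for F
    by (rule fps_ext) (simp add: apply_fps_def flow_fps_nth)
  have deg: "X \<in> gr L x \<Longrightarrow> flow a n X \<in> gr L x" for n x X
    using flow_gr[of n a X x] a by blast
  have app': "apply_fps ?\<phi> = flow_fps a" using app by blast
  have "unary (flow a n) \<in> cochains L (0, 0)" for n
    by (rule unary_cochain) (simp_all add: flow_lin deg)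
  then show "equivalence L ?\<phi>"
    unfolding equivalence_def app'
    using unipotent_bij[of "flow_fps a" "flow a", OF flow_fps_nth _ flow_add deg] flow_fps_brk[OF a]
    by (auto simp: fps_over_def)
qed


section \<open>Cohomologous cocycles\<close>

lemma flow_fps_gr:
  "\<lbrakk>\<And>j. j < n \<Longrightarrow> a j \<in> gr L 0; \<And>i. fps_nth F i \<in> gr L x; i \<le> n\<rbrakk> \<Longrightarrow> fps_nth (flow_fps a F) i \<in> gr L x"
  unfolding flow_fps_nth by (intro gr_sum flow_gr) auto

text \<open>
  The equivalence is the flow of a series \<open>a\<close> chosen so that the image \<open>H\<close> of \<open>F\<close> solves the equation for \<open>C'\<close>;
  uniqueness of solutions identifies it with \<open>G\<close>.
\<close>

theorem cohomologous_equivalent: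
  assumes \<theta>: "odd (ip \<theta> \<theta>)" and P: "P \<in> mc_elements L \<theta>"
    and C: "deformation_cocycle L \<theta> C" and coh: "cohomologous L \<theta> C C'"
    and F: "solution L \<theta> P C F" and G: "solution L \<theta> P C' G"
  shows "equivalent L F G"
proof -
  obtain A where A: "\<And>i. fps_nth A i \<in> direct_sum (degs1 \<theta>) (cochains L)"
    and C': "\<And>i. fps_nth C' i = fps_nth C i + DD L (fps_nth A i)"
    using coh unfolding cohomologous_iff by metis
  have Fgr: "fps_nth F i \<in> gr L \<theta>" and F0: "fps_nth F 0 = P"
    and ode: "scl L (of_nat (Suc n)) (fps_nth F (Suc n)) = - fps_nth (eta_fps L C F) n" for i n
    using F unfolding solution_iff by blast+
  have Cd: "fps_nth C i \<in> direct_sum (degs0 \<theta>) (cochains L)" "DD L (fps_nth C i) = 0" for i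
    using C unfolding deformation_cocycle_iff by blast+
  let ?Z = "\<lambda>a j. fps_nth A j + homotopy_fps a C j"
  (* The right side involves only the coefficients of a of order less than n. *)
  obtain a where a: "\<And>n. a n = - (\<Sum>j\<le>n. eta_coeff (-1) (?Z a j) (flow_fps a F) (n - j))"
  proof (rule course_of_values_recursion)
    fix a b :: "nat \<Rightarrow> 'e" and n assume ab: "\<And>j. j < n \<Longrightarrow> a j = b j"
    have "fps_nth (flow_fps a F) i = fps_nth (flow_fps b F) i" if "i \<le> n" for i
      unfolding flow_fps_nth using ab that by (intro sum.cong refl flow_cong) auto
    moreover have "?Z a j = ?Z b j" if "j \<le> n" for j
      using homotopy_fps_cong[of j a b C] ab that by simp
    ultimately have "eta_coeff (-1) (?Z a j) (flow_fps a F) (n - j) = eta_coeff (-1) (?Z b j) (flow_fps b F) (n - j)"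
      if "j \<le> n" for j
      using that eta_coeff_coeff_cong[of "n - j" "flow_fps a F" "flow_fps b F"] by simp
    then show "- (\<Sum>j\<le>n. eta_coeff (-1) (?Z a j) (flow_fps a F) (n - j))
        = - (\<Sum>j\<le>n. eta_coeff (-1) (?Z b j) (flow_fps b F) (n - j))"
      by simp
  qed blast
  have Z: "?Z a j \<in> direct_sum (degs1 \<theta>) (cochains L)" if "\<And>i. i < j \<Longrightarrow> a i \<in> gr L 0" for j
    using A cflow_fps_homotopy(1)[OF that C] by (rule direct_sum_cochains_add)
  have agr: "a n \<in> gr L 0" for n
  proof (induction n rule: less_induct)
    case (less n)
    have "eta_coeff (-1) (?Z a j) (flow_fps a F) (n - j) \<in> gr L 0" if "j \<le> n" for j
      using less that by (intro eta_coeff_degs1[OF Z] flow_fps_gr[of n a F \<theta>] Fgr) auto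
    then show ?case by (subst a) (auto intro!: gr_minus gr_sum)
  qed
  have all: "fps_nth C i \<in> all_cochains" "cflow a j (fps_nth C i) \<in> all_cochains" for i j
    using direct_sum_all[OF Cd(1)] cflow_cocycle[where a = a and n = j, OF agr Cd] direct_sum_all by blast+
  define H where "H = flow_fps a F"
  have Hgr: "fps_nth H i \<in> gr L \<theta>" for i
    unfolding H_def using agr Fgr by (intro flow_fps_gr[of i]) auto
  have "fps_brk L F F = 0"
    using solution_deformation[OF \<theta> C P F] by (simp add: deformation_def)
  then have "fps_brk L H H = 0"
    unfolding H_def flow_fps_brk[where a = a, OF agr, symmetric] by (intro fps_ext) (simp add: flow_fps_nth)
  then have S: "square_coeff H i = 0" for i
    by (metis square_coeff_eq fps_zero_nth)
  have "solution L \<theta> P C' H"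
    unfolding solution_iff
  proof (intro conjI allI)
    show "fps_nth H 0 = P" by (simp add: H_def flow_fps_nth F0)
    show "fps_nth H i \<in> gr L \<theta>" for i by (rule Hgr)
    fix n
    let ?h = "fps_nth H"
    have anti: "brk L (a j) (?h i) = - brk L (?h i) (a j)" for i j
      using brk_swap[OF agr[of j] Hgr[of i]] by (simp add: swap_sign_def)
    have "(\<Sum>j\<le>n. brk L (a j) (?h (n - j))) = (\<Sum>j\<le>n. brk L (a (n - j)) (?h (n - (n - j))))"
      by (rule sum_atMost_rev[symmetric])
    also have "\<dots> = (\<Sum>j\<le>n. brk L (?h j) (- a (n - j)))"
      by (intro sum.cong refl) (simp add: anti brk_minus_right)
    also have "\<dots> = (\<Sum>j\<le>n. \<Sum>i\<le>n - j. brk L (?h j) (eta_coeff (-1) (?Z a i) H (n - j - i)))"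
      unfolding a[of "n - _"] H_def[symmetric] minus_minus brk_sum_right ..
    also have "\<dots> = (\<Sum>i\<le>n. \<Sum>j\<le>n - i. brk L (?h j) (eta_coeff (-1) (?Z a i) H (n - j - i)))"
      by (rule triangle_sum_swap)
    also have "\<dots> = (\<Sum>i\<le>n. \<Sum>j\<le>n - i. brk L (?h j) (eta_coeff (-1) (?Z a i) H (n - i - j)))"
      by (simp add: add.commute)
    also have "\<dots> = (\<Sum>i\<le>n. - eta_coeff 1 (DD L (?Z a i)) H (n - i))"
      using eta_coeff_DD[OF \<theta> Hgr S Z[OF agr] order_refl] by (intro sum.cong refl) (simp only: minus_minus)
    finally have 1: "(\<Sum>j\<le>n. brk L (a j) (?h (n - j))) = - (\<Sum>i\<le>n. eta_coeff 1 (DD L (?Z a i)) H (n - i))"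
      by (simp only: sum_negf)
    have "(\<Sum>j\<le>n. flow a j (scl L (of_nat (Suc (n - j))) (fps_nth F (Suc (n - j)))))
        = - (\<Sum>j\<le>n. flow a j (fps_nth (eta_fps L C F) (n - j)))"
      unfolding ode flow_minus sum_negf ..
    also have "\<dots> = - fps_nth (eta_fps L (cflow_fps a C) H) n"
      unfolding H_def by (subst flow_eta_fps[OF all]) (rule refl)
    finally have 2: "scl L (of_nat (Suc n)) (?h (Suc n))
        = - (\<Sum>i\<le>n. eta_coeff 1 (DD L (?Z a i)) H (n - i)) - (\<Sum>i\<le>n. eta_coeff 1 (fps_nth (cflow_fps a C) i) H (n - i))"
      using flow_fps_derivative[of n a F] 1 unfolding H_def[symmetric] eta_fps_nth by simp
    have "eta_coeff 1 (fps_nth C' i) H (n - i)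
        = eta_coeff 1 (DD L (?Z a i)) H (n - i) + eta_coeff 1 (fps_nth (cflow_fps a C) i) H (n - i)" for i
    proof -
      note c = cflow_fps_homotopy[where a = a and n = i, OF agr C]
      have all: "fps_nth A i \<in> all_cochains" "homotopy_fps a C i \<in> all_cochains"
        using A c(1) direct_sum_all by blast+
      have "fps_nth C' i = DD L (?Z a i) + fps_nth (cflow_fps a C) i"
        unfolding C' c(2) DD_add[OF all] by (simp only: algebra_simps)
      moreover have "DD L (?Z a i) \<in> all_cochains"
        by (rule DD_all[OF direct_sum_all[OF Z[OF agr]]])
      ultimately show ?thesis
        using eta_coeff_add[OF _ direct_sum_all[OF c(3)]] by metis
    qed
    then show "scl L (of_nat (Suc n)) (?h (Suc n)) = - fps_nth (eta_fps L C' H) n"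
      unfolding 2 eta_fps_nth by (simp add: sum.distrib)
  qed
  then have "G = H" using solution_unique[OF G] by blast
  moreover obtain \<phi> where "equivalence L \<phi>" "\<And>F. apply_fps \<phi> F = flow_fps a F"
    using flow_equivalence[where a = a, OF agr] by metis
  ultimately show ?thesis
    unfolding equivalent_def H_def by metis
qed

section \<open>Equivalences as flows of inner derivations\<close>

definition const_cochain :: "'e \<Rightarrow> 'e list \<Rightarrow> 'e" where
  "const_cochain X Xs = (if Xs = [] then X else 0)"

lemma const_cochain_in: "X \<in> gr L x \<Longrightarrow> const_cochain X \<in> cochains L (-1, x)"
  unfolding cochains_iff multilin_iff
  by (auto simp: const_cochain_def multilinear_def intro!: alternatingI)

lemma unary_brk: "X \<in> gr L x \<Longrightarrow> unary (brk L X) \<in> cochains L (0, x)"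
  using degree[of X x] by (intro unary_cochain) (auto simp: brk_add_right brk_scl_right add.commute)

lemma DD_const:
  assumes X: "X \<in> gr L x" shows "DD L (const_cochain X) = unary (brk L X)"
proof (rule cochains_eqI)
  show "DD L (const_cochain X) \<in> cochains L (0, x)"
    using DD_cochain[OF const_cochain_in[OF X]] by simp
  show "unary (brk L X) \<in> cochains L (0, x)" by (rule unary_brk[OF X])
  fix zs :: "((int ^ 'n) \<times> 'e) list" assume zs: "homs zs" "int (length zs) = 0 + 1"
  then obtain z where z: "zs = [z]" by (auto simp: length_Suc_conv)
  have "(\<lambda>Xs. const_cochain X (snd z # Xs)) = 0" by (simp add: const_cochain_def zero_fun_def)
  then have "DD L (\<lambda>Xs. const_cochain X (snd z # Xs)) = 0" by (simp only: DD_zero)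
  then have "DD L (const_cochain X) [snd z] = - scl L (msgn (ip (fst z) x)) (brk L (snd z) X)"
    using DD_contr[OF const_cochain_in[OF X], of z "[]"] zs z by (simp add: const_cochain_def)
  also have "\<dots> = brk L X (snd z)"
    using brk_swap[OF X, of "snd z" "fst z"] zs z by (simp add: swap_sign_def ip_commute)
  finally show "lift (DD L (const_cochain X)) zs = lift (unary (brk L X)) zs" using z by simp
qed

lemma DD_derivation:
  assumes f: "unary f \<in> cochains L (0, 0)"
    and der: "\<And>x X y Y. \<lbrakk>X \<in> gr L x; Y \<in> gr L y\<rbrakk> \<Longrightarrow> f (brk L X Y) = brk L (f X) Y + brk L X (f Y)"
  shows "DD L (unary f) = 0"
proof (rule cochains_eqI[OF DD_cochain[OF f] cochains_zero])
  fix zs :: "((int ^ 'n) \<times> 'e) list" assume zs: "homs zs" "int (length zs) = 0 + 1 + 1"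
  then obtain a z where z: "zs = [a, z]" by (auto simp: length_Suc_conv numeral_2_eq_2)
  have fa: "f (snd a) \<in> gr L (fst a)"
    using cochain_degree[OF f, of "[a]"] zs z by simp
  have "(\<lambda>Xs. unary f (snd a # Xs)) = const_cochain (f (snd a))"
    by (auto simp: unary_def const_cochain_def)
  then have "DD L (\<lambda>Xs. unary f (snd a # Xs)) = unary (brk L (f (snd a)))"
    by (simp only: DD_const[OF fa])
  then have "DD L (unary f) [snd a, snd z] = f (brk L (snd a) (snd z)) - brk L (snd a) (f (snd z)) - brk L (f (snd a)) (snd z)"
    using DD_contr[OF f, of a "[z]"] zs z by simp
  then show "lift (DD L (unary f)) zs = lift 0 zs"
    using der[of "snd a" "fst a" "snd z" "fst z"] zs z by simp
qed

lemma DD_unary_brk: "X \<in> gr L 0 \<Longrightarrow> DD L (unary (brk L X)) = 0"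
  by (rule DD_derivation[OF unary_brk]) (auto intro: jacobi_deg0)

lemma eta_coeff_unary:
  assumes "unary f \<in> cochains L (0, c)"
  shows "eta_coeff 1 (unary f) F n = f (fps_nth F n)"
proof -
  have "(\<Sum>j\<le>n. if n - j = 0 then unary f [fps_nth F j] else 0) = (\<Sum>j\<in>{n}. f (fps_nth F j))"
    by (rule sum.mono_neutral_cong_right) auto
  then show ?thesis
    using eta_coeff_cochain[of "unary f" 1 c 1 F n] assms by simp
qed

definition const_fps :: "'e \<Rightarrow> 'e fps" where
  "const_fps X = Abs_fps (\<lambda>n. if n = 0 then X else 0)"

lemma const_fps_nth: "fps_nth (const_fps X) n = (if n = 0 then X else 0)"
  by (simp add: const_fps_def)

lemma const_fps_space: "X \<in> gr L x \<Longrightarrow> const_fps X \<in> fps_space L"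
  unfolding fps_space_def
  by (rule direct_sum_homogeneous[of x]) (auto simp: fps_over_def const_fps_nth)

text \<open>
  Every coefficient of \<open>\<phi>' \<phi>^(-1)\<close> is a derivation of degree \<open>0\<close> by the product rule for \<open>\<phi>[X, Y] = [\<phi> X, \<phi> Y]\<close>,
  hence a cocycle of degree \<open>(0, 0)\<close>, hence inner. The coefficients are treated successively because the one of order
  \<open>n\<close> is defined through those of lower order.
\<close>

lemma equivalence_flow:
  assumes H0: "coh_part (cochains L) (DD L) (1, 0) 0 = {coh_zero (cochains L) (DD L) (1, 0) 0}"
    and \<phi>: "equivalence L \<phi>"
  obtains a where "\<And>n. a n \<in> gr L 0" "\<And>n X. fps_nth \<phi> n [X] = flow a n X"
proof -
  let ?f = "\<lambda>n X. fps_nth \<phi> n [X]"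
  have c: "fps_nth \<phi> n \<in> cochains L (0, 0)" for n
    using \<phi> by (simp add: equivalence_def fps_over_def)
  have lin: "?f n (scl L r X + Y) = scl L r (?f n X) + ?f n Y" for n r X Y
    by (rule multilinearD0[OF cochain_multilinear[OF c]])
  have zero: "?f n 0 = 0" for n
    by (rule multilinear_zero0[OF cochain_multilinear[OF c]])
  have deg: "?f n X \<in> gr L x" if "X \<in> gr L x" for n x X
    using cochain_degree[OF c, of "[(x, X)]" n] that by simp
  have id: "?f 0 X = X" for X using \<phi> by (simp add: equivalence_def)
  have app: "fps_nth (apply_fps \<phi> (const_fps X)) n = ?f n X" for n X
  proof -
    have "(\<Sum>j\<le>n. ?f j (fps_nth (const_fps X) (n - j))) = (\<Sum>j\<in>{n}. ?f j X)"
      by (rule sum.mono_neutral_cong_right) (auto simp: const_fps_nth zero)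
    then show ?thesis by (simp add: apply_fps_def)
  qed
  have mult: "?f n (brk L X Y) = (\<Sum>j\<le>n. brk L (?f j X) (?f (n - j) Y))" if "X \<in> gr L x" "Y \<in> gr L y" for n X Y x y
  proof -
    have "fps_brk L (const_fps X) (const_fps Y) = const_fps (brk L X Y)"
    proof (rule fps_ext)
      fix n
      have "(\<Sum>j\<le>n. brk L (fps_nth (const_fps X) j) (fps_nth (const_fps Y) (n - j)))
          = (\<Sum>j\<in>{0}. brk L (fps_nth (const_fps X) j) (fps_nth (const_fps Y) (n - j)))"
        by (rule sum.mono_neutral_right) (auto simp: const_fps_nth)
      then show "fps_nth (fps_brk L (const_fps X) (const_fps Y)) n = fps_nth (const_fps (brk L X Y)) n"
        by (simp add: fps_brk_def const_fps_nth)
    qed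
    moreover have "apply_fps \<phi> (fps_brk L (const_fps X) (const_fps Y))
        = fps_brk L (apply_fps \<phi> (const_fps X)) (apply_fps \<phi> (const_fps Y))"
      using \<phi> const_fps_space[OF that(1)] const_fps_space[OF that(2)] unfolding equivalence_def by blast
    ultimately have "?f n (brk L X Y) = fps_nth (fps_brk L (apply_fps \<phi> (const_fps X)) (apply_fps \<phi> (const_fps Y))) n"
      using app[of "brk L X Y" n] by simp
    then show ?thesis by (simp add: fps_brk_def app)
  qed
  let ?D = "\<lambda>a n X. scl L (of_nat (Suc n)) (?f (Suc n) X) - (\<Sum>j<n. brk L (a j) (?f (n - j) X))"
  obtain a where a: "\<And>n. a n = (SOME A. A \<in> gr L 0 \<and> (\<forall>X. brk L A X = ?D a n X))"
  proof (rule course_of_values_recursion)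
    fix a b :: "nat \<Rightarrow> 'e" and n assume "\<And>j. j < n \<Longrightarrow> a j = b j"
    then have "?D a n X = ?D b n X" for X by simp
    then show "(SOME A. A \<in> gr L 0 \<and> (\<forall>X. brk L A X = ?D a n X)) = (SOME A. A \<in> gr L 0 \<and> (\<forall>X. brk L A X = ?D b n X))"
      by simp
  qed blast
  have spec: "a n \<in> gr L 0 \<and> (\<forall>X. brk L (a n) X = ?D a n X)" for n
  proof (induction n rule: less_induct)
    case (less n)
    let ?d = "?D a n"
    (* E l is the coefficient of order l of the logarithmic derivative; the one of order n is not
       yet known to be inner. *)
    define E where "E = (\<lambda>l X. if l < n then brk L (a l) X else ?d X)"
    have dlin: "?d (scl L r X + Y) = scl L r (?d X) + ?d Y" for r X Y
      by (simp add: lin brk_add_right brk_scl_right vs.scale_right_distrib vs.scale_right_diff_distrib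
          sum.distrib vs.scale_sum_right mult.commute)
    have ddeg: "?d X \<in> gr L (x + 0)" if X: "X \<in> gr L x" for x X
    proof -
      have "brk L (a j) (?f (n - j) X) \<in> gr L x" if "j < n" for j
        using degree[of "a j" 0 "?f (n - j) X" x] less[OF that] deg[OF X] by simp
      then show ?thesis using deg[OF X] by (auto intro!: gr_diff gr_scl gr_sum)
    qed
    have E: "scl L (of_nat (Suc j)) (?f (Suc j) X) = (\<Sum>l\<le>j. E l (?f (j - l) X))" if "j \<le> n" for j X
    proof (cases "j = n")
      case True
      have "(\<Sum>l\<le>n. E l (?f (n - l) X)) = (\<Sum>l<n. E l (?f (n - l) X)) + E n (?f 0 X)"
        by (simp add: lessThan_Suc_atMost[symmetric])
      also have "(\<Sum>l<n. E l (?f (n - l) X)) = (\<Sum>l<n. brk L (a l) (?f (n - l) X))"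
        by (intro sum.cong) (auto simp: E_def)
      finally show ?thesis using True by (simp add: E_def id)
    next
      case False
      then have "j < n" using that by simp
      have "(\<Sum>l\<le>j. E l (?f (j - l) X)) = (\<Sum>l<j. brk L (a l) (?f (j - l) X)) + brk L (a j) (?f 0 X)"
        using \<open>j < n\<close> by (simp add: E_def lessThan_Suc_atMost[symmetric])
      then show ?thesis using less[OF \<open>j < n\<close>] by (simp add: id)
    qed
    have "?d (brk L X Y) = brk L (?d X) Y + brk L X (?d Y)" if X: "X \<in> gr L x" and Y: "Y \<in> gr L y" for x X y Y
    proof -
      let ?p = "\<lambda>l. \<Sum>i\<le>n - l. E l (brk L (?f i X) (?f (n - l - i) Y))"
      let ?q = "\<lambda>l. \<Sum>i\<le>n - l. brk L (E l (?f i X)) (?f (n - l - i) Y) + brk L (?f i X) (E l (?f (n - l - i) Y))"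
      have Elin: "E l (sum g S) = (\<Sum>i\<in>S. E l (g i))" if "finite S" for l S and g :: "nat \<Rightarrow> 'e"
      proof (cases "l < n")
        case True
        then show ?thesis by (simp add: E_def brk_sum_right)
      next
        case False
        have d0: "?d 0 = 0" using dlin[of 1 0 0] by simp
        have "?d (sum g S) = (\<Sum>i\<in>S. ?d (g i))" using that
        proof (induction S rule: finite_induct)
          case empty
          show ?case unfolding sum.empty by (rule d0)
        next
          case (insert i S)
          have "?d (g i + sum g S) = ?d (g i) + ?d (sum g S)" using dlin[of 1 "g i" "sum g S"] by simp
          then show ?case unfolding sum.insert[OF insert(1,2)] insert(3) .
        qed
        then show ?thesis using False by (simp only: E_def if_False)
      qed
      have "(\<Sum>l\<le>n. ?p l) = (\<Sum>l\<le>n. E l (?f (n - l) (brk L X Y)))"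
        unfolding mult[OF X Y] using Elin by (intro sum.cong refl) (simp add: diff_diff_left)
      also have "\<dots> = scl L (of_nat (Suc n)) (?f (Suc n) (brk L X Y))" using E[of n] by simp
      also have "\<dots> = (\<Sum>j\<le>n. scl L (of_nat (Suc j)) (brk L (?f (Suc j) X) (?f (n - j) Y)))
          + (\<Sum>j\<le>n. scl L (of_nat (Suc (n - j))) (brk L (?f j X) (?f (Suc (n - j)) Y)))"
        unfolding mult[OF X Y] by (rule leibniz_sum[of n "\<lambda>j i. brk L (?f j X) (?f i Y)"])
      also have "(\<Sum>j\<le>n. scl L (of_nat (Suc j)) (brk L (?f (Suc j) X) (?f (n - j) Y)))
          = (\<Sum>j\<le>n. \<Sum>l\<le>j. brk L (E l (?f (j - l) X)) (?f (n - l - (j - l)) Y))"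
      proof (intro sum.cong refl)
        fix j assume "j \<in> {..n}"
        then have "scl L (of_nat (Suc j)) (brk L (?f (Suc j) X) (?f (n - j) Y)) = (\<Sum>l\<le>j. brk L (E l (?f (j - l) X)) (?f (n - j) Y))"
          using E[of j X] by (simp only: brk_scl_left[symmetric] brk_sum_left atMost_iff)
        also have "\<dots> = (\<Sum>l\<le>j. brk L (E l (?f (j - l) X)) (?f (n - l - (j - l)) Y))"
          by (intro sum.cong refl) simp
        finally show "scl L (of_nat (Suc j)) (brk L (?f (Suc j) X) (?f (n - j) Y)) = \<dots>" .
      qed
      also have "\<dots> = (\<Sum>l\<le>n. \<Sum>i\<le>n - l. brk L (E l (?f i X)) (?f (n - l - i) Y))"
        by (rule triangle_sum_diagonal[symmetric])
      also have "(\<Sum>j\<le>n. scl L (of_nat (Suc (n - j))) (brk L (?f j X) (?f (Suc (n - j)) Y)))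
          = (\<Sum>j\<le>n. \<Sum>l\<le>n - j. brk L (?f j X) (E l (?f (n - j - l) Y)))"
        using E[of "n - _" Y] by (simp only: brk_scl_right[symmetric] brk_sum_right diff_le_self)
      also have "\<dots> = (\<Sum>l\<le>n. \<Sum>j\<le>n - l. brk L (?f j X) (E l (?f (n - j - l) Y)))"
        by (rule triangle_sum_swap)
      also have "\<dots> = (\<Sum>l\<le>n. \<Sum>j\<le>n - l. brk L (?f j X) (E l (?f (n - l - j) Y)))"
        by (simp add: add.commute)
      finally have total: "(\<Sum>l\<le>n. ?p l) = (\<Sum>l\<le>n. ?q l)"
        by (simp only: sum.distrib)
      (* The inner coefficients are derivations, so in the equality of the total sums only the terms
         of order n remain. *)
      have pq: "?p l = ?q l" if l: "l < n" for l
        using l less[OF l] jacobi_deg0[OF _ deg[OF X] deg[OF Y], of "a l"]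
        by (intro sum.cong refl) (simp add: E_def)
      have "(\<Sum>l<n. ?p l) = (\<Sum>l<n. ?q l)"
      proof (rule sum.cong[OF refl])
        fix l assume "l \<in> {..<n}"
        then show "?p l = ?q l" by (intro pq) simp
      qed
      then have "?p n = ?q n"
        using total unfolding lessThan_Suc_atMost[symmetric] sum.lessThan_Suc by (simp only: add_left_cancel)
      then show ?thesis by (simp add: id E_def)
    qed
    moreover have u: "unary ?d \<in> cochains L (0, 0)"
      by (rule unary_cochain[OF dlin ddeg])
    ultimately have DD0: "DD L (unary ?d) = 0"
      by (intro DD_derivation)
    let ?B = "DD L ` cochains L (0 - (1, 0))"
    have "(+) (unary ?d) ` ?B \<in> coh_part (cochains L) (DD L) (1, 0) 0"
      unfolding coh_part_def using u DD0 by (simp add: zero_prod_def)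
    then have B: "(+) (unary ?d) ` ?B = ?B"
      unfolding H0 by (simp add: coh_zero_def)
    have "0 \<in> ?B" using cochains_zero DD_zero by (metis image_eqI)
    then have "unary ?d + 0 \<in> (+) (unary ?d) ` ?B" by (rule imageI)
    then have "unary ?d \<in> ?B" unfolding B by (simp only: add_0_right)
    then obtain M where M: "M \<in> cochains L (-1, 0)" and dM: "unary ?d = DD L M"
      by (auto simp: zero_prod_def minus_prod_def)
    have A: "M [] \<in> gr L 0" using cochain_degree[OF M, of "[]"] by simp
    have "M = const_cochain (M [])"
      by (rule ext) (auto simp: const_cochain_def intro!: cochain_length[OF M])
    then have "DD L M = unary (brk L (M []))" using DD_const[OF A] by metis
    then have "brk L (M []) X = ?d X" for X
      using dM unary_single[of "brk L (M [])" X] unary_single[of ?d X] by metis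
    then have "\<exists>A. A \<in> gr L 0 \<and> (\<forall>X. brk L A X = ?d X)" using A by blast
    from someI_ex[OF this] show ?case unfolding a[of n, symmetric] .
  qed
  have "?f n X = flow a n X" for n X
  proof (induction n arbitrary: X rule: less_induct)
    case (less n)
    show ?case
    proof (cases n)
      case 0
      then show ?thesis by (simp add: id)
    next
      case (Suc m)
      have "scl L (of_nat (Suc m)) (?f (Suc m) X) = (\<Sum>j<m. brk L (a j) (?f (m - j) X)) + brk L (a m) X"
        using spec[of m] by simp
      also have "\<dots> = (\<Sum>j\<le>m. brk L (a j) (?f (m - j) X))"
        by (simp add: lessThan_Suc_atMost[symmetric] id)
      also have "\<dots> = (\<Sum>j\<le>m. brk L (a j) (flow a (m - j) X))"
        using less Suc by (intro sum.cong refl) simp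
      finally have "scl L (of_nat (Suc m)) (?f (Suc m) X) = scl L (of_nat (Suc m)) (flow a (Suc m) X)"
        unfolding flow_Suc .
      then show ?thesis using Suc by (simp del: of_nat_Suc)
    qed
  qed
  then show ?thesis using that spec by blast
qed

text \<open>
  The cocycle is \<open>T C - DD a\<close>: the first term transports \<open>\<eta>(C)\<close>, and the second accounts for \<open>[a, G]\<close>.
\<close>

theorem equivalent_associated:
  assumes H0: "coh_part (cochains L) (DD L) (1, 0) 0 = {coh_zero (cochains L) (DD L) (1, 0) 0}"
    and C: "deformation_cocycle L \<theta> C" and F: "solution L \<theta> P C F" and eq: "equivalent L F G"
  obtains C' where "deformation_cocycle L \<theta> C'" "cohomologous L \<theta> C C'" "solution L \<theta> P C' G"
proof -
  obtain \<phi> where \<phi>: "equivalence L \<phi>" and G: "G = apply_fps \<phi> F"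
    using eq by (auto simp: equivalent_def)
  obtain a where agr: "\<And>n. a n \<in> gr L 0" and f: "\<And>n X. fps_nth \<phi> n [X] = flow a n X"
    using equivalence_flow[OF H0 \<phi>] by metis
  have G: "G = flow_fps a F"
    unfolding G by (rule fps_ext) (simp add: apply_fps_def flow_fps_nth f)
  have Fgr: "fps_nth F i \<in> gr L \<theta>" and F0: "fps_nth F 0 = P"
    and ode: "scl L (of_nat (Suc n)) (fps_nth F (Suc n)) = - fps_nth (eta_fps L C F) n" for i n
    using F unfolding solution_iff by blast+
  have Cd: "fps_nth C i \<in> direct_sum (degs0 \<theta>) (cochains L)" "DD L (fps_nth C i) = 0" for i
    using C unfolding deformation_cocycle_iff by blast+
  have all: "fps_nth C i \<in> all_cochains" "cflow a j (fps_nth C i) \<in> all_cochains" for i j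
    using direct_sum_all[OF Cd(1)] cflow_cocycle[where a = a and n = j, OF agr Cd] direct_sum_all by blast+
  note c = cflow_fps_homotopy[where a = a, OF agr C]
  let ?u = "\<lambda>i. unary (brk L (a i))"
  have u: "?u i \<in> direct_sum (degs0 \<theta>) (cochains L)" "?u i = DD L (const_cochain (a i))" for i
    using DD_const[OF agr] unary_brk[OF agr] by (auto simp: degs0_def intro!: direct_sum_homogeneous[of "(0, 0)"])
  have k: "const_cochain (a i) \<in> direct_sum (degs1 \<theta>) (cochains L)" for i
    using const_cochain_in[OF agr] by (intro direct_sum_homogeneous[of "(-1, 0)"]) (auto simp: degs1_def)
  define C' where "C' = Abs_fps (\<lambda>i. fps_nth (cflow_fps a C) i - ?u i)"
  have C'_nth: "fps_nth C' i = fps_nth (cflow_fps a C) i - ?u i" for i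
    by (simp only: C'_def fps_nth_Abs_fps)
  have "deformation_cocycle L \<theta> C'"
    unfolding deformation_cocycle_iff
  proof (intro allI conjI)
    fix i
    show "fps_nth C' i \<in> direct_sum (degs0 \<theta>) (cochains L)"
      unfolding C'_nth by (rule direct_sum_cochains_diff[OF c(3) u(1)])
    show "DD L (fps_nth C' i) = 0"
      unfolding C'_nth DD_diff[OF direct_sum_all[OF c(3)] direct_sum_all[OF u(1)]] c(4) DD_unary_brk[OF agr]
      by (rule diff_self)
  qed
  moreover have "cohomologous L \<theta> C C'"
    unfolding cohomologous_iff
  proof (intro exI[of _ "Abs_fps (\<lambda>i. - (homotopy_fps a C i + const_cochain (a i)))"] allI)
    fix i
    let ?A = "- (homotopy_fps a C i + const_cochain (a i))"
    have A: "homotopy_fps a C i + const_cochain (a i) \<in> direct_sum (degs1 \<theta>) (cochains L)"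
      by (rule direct_sum_cochains_add[OF c(1) k])
    have "fps_nth C' i = fps_nth C i + DD L ?A"
      unfolding C'_nth c(2) u(2) DD_uminus[OF direct_sum_all[OF A]]
        DD_add[OF direct_sum_all[OF c(1)] direct_sum_all[OF k]]
      by (simp only: add_uminus_conv_diff diff_diff_eq)
    then show "fps_nth (Abs_fps (\<lambda>i. - (homotopy_fps a C i + const_cochain (a i)))) i \<in> direct_sum (degs1 \<theta>) (cochains L)
        \<and> fps_nth C' i = fps_nth C i + DD L (fps_nth (Abs_fps (\<lambda>i. - (homotopy_fps a C i + const_cochain (a i)))) i)"
      unfolding fps_nth_Abs_fps using direct_sum_cochains_uminus[OF A] by blast
  qed
  moreover have "solution L \<theta> P C' G"
    unfolding solution_iff
  proof (intro conjI allI)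
    show "fps_nth G 0 = P" by (simp add: G flow_fps_nth F0)
    show "fps_nth G i \<in> gr L \<theta>" for i
      unfolding G using agr Fgr by (intro flow_fps_gr[of i]) auto
    fix n
    have "(\<Sum>j\<le>n. flow a j (scl L (of_nat (Suc (n - j))) (fps_nth F (Suc (n - j)))))
        = - (\<Sum>j\<le>n. flow a j (fps_nth (eta_fps L C F) (n - j)))"
      unfolding ode flow_minus sum_negf ..
    also have "\<dots> = - fps_nth (eta_fps L (cflow_fps a C) G) n"
      unfolding G by (subst flow_eta_fps[OF all]) (rule refl)
    finally have 2: "scl L (of_nat (Suc n)) (fps_nth G (Suc n))
        = (\<Sum>j\<le>n. brk L (a j) (fps_nth G (n - j))) - (\<Sum>i\<le>n. eta_coeff 1 (fps_nth (cflow_fps a C) i) G (n - i))"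
      using flow_fps_derivative[of n a F] unfolding G[symmetric] eta_fps_nth by simp
    have "eta_coeff 1 (fps_nth C' i) G (n - i) = eta_coeff 1 (fps_nth (cflow_fps a C) i) G (n - i) - brk L (a i) (fps_nth G (n - i))" for i
      unfolding C'_nth eta_coeff_diff[OF direct_sum_all[OF c(3)] direct_sum_all[OF u(1)]]
        eta_coeff_unary[OF unary_brk[OF agr]] ..
    then show "scl L (of_nat (Suc n)) (fps_nth G (Suc n)) = - fps_nth (eta_fps L C' G) n"
      unfolding 2 eta_fps_nth by (simp add: sum_subtractf)
  qed
  ultimately show ?thesis by (rule that)
qed

end

section \<open>The induced map in cohomology\<close>

lemma coset_eq_iff:
  fixes z :: "'v::ab_group_add"
  assumes "0 \<in> B" and diff: "\<And>u v. u \<in> B \<Longrightarrow> v \<in> B \<Longrightarrow> u - v \<in> B"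
  shows "(+) z ` B = B \<longleftrightarrow> z \<in> B"
proof
  assume "(+) z ` B = B"
  moreover have "z + 0 \<in> (+) z ` B" using assms(1) by (rule imageI)
  ultimately show "z \<in> B" by simp
next
  assume z: "z \<in> B"
  have neg: "- u \<in> B" if "u \<in> B" for u using diff[OF assms(1) that] by simp
  have add: "u + v \<in> B" if "u \<in> B" "v \<in> B" for u v using diff[OF that(1) neg[OF that(2)]] by simp
  show "(+) z ` B = B"
  proof (intro equalityI subsetI)
    fix u assume "u \<in> B"
    then have "u = z + (u - z)" "u - z \<in> B" using diff z by auto
    then show "u \<in> (+) z ` B" by (rule image_eqI)
  qed (use add z in auto)
qed

text \<open>
  Representatives of the finitely many nonzero components of a class are added up; the other components
  are represented by \<open>0\<close>, so the sum is finite.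
\<close>

lemma representative_exists:
  fixes G :: "'g::ab_group_add \<Rightarrow> 'v::ab_group_add set"
  assumes G: "independent_family G" and d0: "d 0 = 0"
    and d: "\<And>S f. finite S \<Longrightarrow> (\<And>g. f g \<in> G g) \<Longrightarrow> d (sum f S) = (\<Sum>g\<in>S. d (f g))"
    and \<xi>: "\<xi> \<in> cohomology G d t"
  obtains z where "z \<in> cocycles G d" "coh_class G d t z = \<xi>"
proof -
  have "\<exists>z. z \<in> G x \<and> d z = 0 \<and> (+) z ` d ` G (x - t) = \<xi> x \<and> (\<xi> x = coh_zero G d t x \<longrightarrow> z = 0)" for x
  proof (cases "\<xi> x = coh_zero G d t x")
    case True
    have "(+) 0 ` d ` G (x - t) = \<xi> x" unfolding True coh_zero_def by (simp add: image_image)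
    then show ?thesis using G d0 by (intro exI[of _ 0]) (simp add: independent_family_def)
  next
    case False
    have "\<xi> x \<in> coh_part G d t x" using \<xi> by (simp add: cohomology_def)
    then show ?thesis using False unfolding coh_part_def by auto
  qed
  then obtain z where z: "\<And>x. z x \<in> G x" "\<And>x. d (z x) = 0" "\<And>x. (+) (z x) ` d ` G (x - t) = \<xi> x"
    "\<And>x. \<xi> x = coh_zero G d t x \<Longrightarrow> z x = 0" by metis
  let ?S = "{x. \<xi> x \<noteq> coh_zero G d t x}"
  have S: "finite ?S" using \<xi> by (simp add: cohomology_def)
  have "hdecomp G (sum z ?S) z"
    unfolding hdecomp_iff using z S by (intro conjI exI[of _ ?S]) auto
  then have hc: "hcomp G (sum z ?S) = z" by (rule hcomp_eq[OF G])
  have "d (sum z ?S) = 0" using d[OF S z(1)] z(2) by simp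
  moreover have "sum z ?S \<in> direct_sum UNIV G" by (rule direct_sumI[OF S]) (simp_all add: z)
  ultimately have "sum z ?S \<in> cocycles G d" by (simp add: cocycles_def)
  moreover have "coh_class G d t (sum z ?S) = \<xi>"
    unfolding coh_class_def hc using z(3) by auto
  ultimately show ?thesis by (rule that)
qed

context graded_lie_algebra
begin

lemma hcomp_zero: "hcomp (gr L) 0 x = 0"
  using hcomp_homogeneous[OF independent_gr gr_0[of undefined]] by simp

lemma hcomp_sum: "hcomp (gr L) (sum f S) x = (\<Sum>i\<in>S. hcomp (gr L) (f i) x)"
proof (induction S rule: infinite_finite_induct)
  case (insert i S)
  then show ?case using hcomp_lin[of 1 "f i" "sum f S" x] by simp
qed (simp_all add: hcomp_zero)

lemma hcomp_brk:
  assumes P: "P \<in> gr L \<theta>" shows "hcomp (gr L) (brk L P Y) x = brk L P (hcomp (gr L) Y (x - \<theta>))"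
proof -
  let ?S = "hsupp (gr L) Y"
  have "brk L P Y = (\<Sum>y\<in>?S. brk L P (hcomp (gr L) Y y))"
    unfolding brk_sum_right[symmetric] using sum_hcomp[of ?S Y] by simp
  then have "hcomp (gr L) (brk L P Y) x = (\<Sum>y\<in>?S. hcomp (gr L) (brk L P (hcomp (gr L) Y y)) x)"
    using hcomp_sum by metis
  also have "\<dots> = (\<Sum>y\<in>?S. if x = \<theta> + y then brk L P (hcomp (gr L) Y y) else 0)"
    by (intro sum.cong refl) (simp add: hcomp_homogeneous[OF independent_gr degree[OF P hcomp_in_gr]])
  also have "\<dots> = (\<Sum>y\<in>?S. if y = x - \<theta> then brk L P (hcomp (gr L) Y y) else 0)"
    by (intro sum.cong refl) (auto simp: algebra_simps)
  also have "\<dots> = (if x - \<theta> \<in> ?S then brk L P (hcomp (gr L) Y (x - \<theta>)) else 0)"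
    by (rule sum.delta) simp
  also have "\<dots> = brk L P (hcomp (gr L) Y (x - \<theta>))"
    by (simp add: hsupp_def)
  finally show ?thesis .
qed

lemma boundaries_diff:
  "\<lbrakk>u \<in> brk L P ` gr L y; v \<in> brk L P ` gr L y\<rbrakk> \<Longrightarrow> u - v \<in> brk L P ` gr L y"
  by (auto simp: brk_diff_right[symmetric] intro!: imageI gr_diff)

lemma boundaries_zero: "0 \<in> brk L P ` gr L y"
  by (rule image_eqI[of _ _ 0]) simp_all

lemma coh_class_boundary:
  assumes P: "P \<in> gr L \<theta>" shows "coh_class (gr L) (brk L P) \<theta> (brk L P Y) = coh_zero (gr L) (brk L P) \<theta>"
proof
  fix x
  have "brk L P (hcomp (gr L) Y (x - \<theta>)) \<in> brk L P ` gr L (x - \<theta>)" by (rule imageI) simp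
  then show "coh_class (gr L) (brk L P) \<theta> (brk L P Y) x = coh_zero (gr L) (brk L P) \<theta> x"
    unfolding coh_class_def coh_zero_def hcomp_brk[OF P]
    by (subst coset_eq_iff) (auto intro: boundaries_zero boundaries_diff)
qed

lemma coh_class_in_cohomology:
  assumes P: "P \<in> gr L \<theta>" and w: "brk L P w = 0"
  shows "coh_class (gr L) (brk L P) \<theta> w \<in> cohomology (gr L) (brk L P) \<theta>"
  unfolding cohomology_def
proof (intro CollectI conjI allI)
  fix x
  have "brk L P (hcomp (gr L) w x) = hcomp (gr L) (brk L P w) (x + \<theta>)"
    by (simp add: hcomp_brk[OF P])
  also have "\<dots> = 0" unfolding w by (rule hcomp_zero)
  finally show "coh_class (gr L) (brk L P) \<theta> w x \<in> coh_part (gr L) (brk L P) \<theta> x"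
    unfolding coh_class_def coh_part_def by simp
next
  have "coh_class (gr L) (brk L P) \<theta> w x = coh_zero (gr L) (brk L P) \<theta> x" if "x \<notin> hsupp (gr L) w" for x
    using that by (simp add: coh_class_def coh_zero_def hsupp_def image_image)
  then have "{x. coh_class (gr L) (brk L P) \<theta> w x \<noteq> coh_zero (gr L) (brk L P) \<theta> x} \<subseteq> hsupp (gr L) w" by blast
  then show "finite {x. coh_class (gr L) (brk L P) \<theta> w x \<noteq> coh_zero (gr L) (brk L P) \<theta> x}"
    by (rule finite_subset) simp
qed

lemma coh_class_eqD:
  assumes "coh_class (gr L) (brk L P) \<theta> u = coh_class (gr L) (brk L P) \<theta> w"
  shows "\<exists>e \<in> gr L (x - \<theta>). hcomp (gr L) u x = hcomp (gr L) w x + brk L P e"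
proof -
  let ?B = "brk L P ` gr L (x - \<theta>)"
  have "hcomp (gr L) u x + 0 \<in> (+) (hcomp (gr L) u x) ` ?B" by (intro imageI boundaries_zero)
  also have "\<dots> = (+) (hcomp (gr L) w x) ` ?B"
    using fun_cong[OF assms, of x] by (simp add: coh_class_def)
  finally show ?thesis by auto
qed

lemma square_const_fps:
  assumes "P \<in> mc_elements L \<theta>" shows "square_coeff (const_fps P) 0 = 0"
  using assms by (simp add: square_coeff_def const_fps_nth mc_elements_def)

lemma const_fps_gr: "P \<in> gr L \<theta> \<Longrightarrow> fps_nth (const_fps P) i \<in> gr L \<theta>"
  by (simp add: const_fps_nth)

lemma eta_const: "eta L C P = eta_coeff 1 C (const_fps P) 0"
  by (rule eta_eq_eta_coeff) (simp add: const_fps_nth)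

lemma brk_eta_cocycle:
  assumes \<theta>: "odd (ip \<theta> \<theta>)" and P: "P \<in> mc_elements L \<theta>" and z: "z \<in> all_cochains" "DD L z = 0"
  shows "brk L P (eta L z P) = 0"
proof -
  have "P \<in> gr L \<theta>" using P by (simp add: mc_elements_def)
  from eta_coeff_cocycle[OF \<theta> const_fps_gr[OF this] _ z, of 0 0] square_const_fps[OF P]
  show ?thesis by (simp add: eta_const const_fps_nth)
qed

lemma cocycles_HHH:
  assumes "\<xi> \<in> HHH L"
  shows "coh_rep (cochains L) (DD L) (1, 0) \<xi> \<in> cocycles (cochains L) (DD L)"
proof -
  obtain z where "z \<in> cocycles (cochains L) (DD L)" "coh_class (cochains L) (DD L) (1, 0) z = \<xi>"
    using representative_exists[OF independent_cochains DD_zero DD_sum assms] by metis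
  then show ?thesis unfolding coh_rep_def by (metis (mono_tags, lifting) someI_ex)
qed

lemma cocycles_HP:
  assumes "\<xi> \<in> HP L \<theta> P"
  shows "coh_rep (gr L) (brk L P) \<theta> \<xi> \<in> cocycles (gr L) (brk L P)"
    and "coh_class (gr L) (brk L P) \<theta> (coh_rep (gr L) (brk L P) \<theta> \<xi>) = \<xi>"
proof -
  obtain z where "z \<in> cocycles (gr L) (brk L P) \<and> coh_class (gr L) (brk L P) \<theta> z = \<xi>"
    using representative_exists[OF independent_gr brk_zero_right _ assms] brk_sum_right by metis
  from someI[of "\<lambda>z. z \<in> cocycles (gr L) (brk L P) \<and> coh_class (gr L) (brk L P) \<theta> z = \<xi>", OF this]
  show "coh_rep (gr L) (brk L P) \<theta> \<xi> \<in> cocycles (gr L) (brk L P)"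
    "coh_class (gr L) (brk L P) \<theta> (coh_rep (gr L) (brk L P) \<theta> \<xi>) = \<xi>"
    unfolding coh_rep_def by blast+
qed

lemma range_brk_add: "\<lbrakk>u \<in> range (brk L P); v \<in> range (brk L P)\<rbrakk> \<Longrightarrow> u + v \<in> range (brk L P)"
  by (auto simp: brk_add_right[symmetric])

lemma range_brk_scl: "u \<in> range (brk L P) \<Longrightarrow> scl L r u \<in> range (brk L P)"
  by (auto simp: brk_scl_right[symmetric])

lemma range_brk_zero: "0 \<in> range (brk L P)"
  by (rule image_eqI[of _ _ 0]) simp_all

lemma range_brk_sum: "(\<And>i. i \<in> S \<Longrightarrow> f i \<in> range (brk L P)) \<Longrightarrow> sum f S \<in> range (brk L P)"
  by (induction S rule: infinite_finite_induct) (auto simp: range_brk_zero intro: range_brk_add)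

text \<open>
  The Cartan formula at \<open>(v, P, \<dots>, P)\<close> for a cocycle: the Lie derivative has no terms with inner brackets because
  \<open>[v, P] = 0\<close>, and the differential of the contraction with \<open>v\<close>, evaluated at \<open>P\<close>, is a boundary.
\<close>

lemma brk_eta_central:
  assumes \<theta>: "odd (ip \<theta> \<theta>)" and P: "P \<in> mc_elements L \<theta>" and z: "z \<in> all_cochains" "DD L z = 0"
    and v: "v \<in> gr L y" and Pv: "brk L P v = 0"
  shows "brk L (eta L z P) v \<in> range (brk L P)"
proof -
  have Pgr: "P \<in> gr L \<theta>" using P by (simp add: mc_elements_def)
  have vP: "brk L v P = 0" using brk_swap[OF v Pgr] Pv by simp
  have "z \<in> all_cochains \<and> brk L (eta L z P) v \<in> range (brk L P)"
    using cocycle_components[OF z]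
  proof (induction rule: direct_sum_induct)
    case zero
    show ?case unfolding eta_const eta_coeff_zero brk_zero_left by (intro conjI direct_sum_zero range_brk_zero)
  next
    case (homogeneous g u)
    obtain k c where g: "g = (k, c)" by (cases g)
    have u: "u \<in> cochains L (k, c)" and d: "DD L u = 0" using homogeneous g by auto
    have "brk L (eta L u P) v \<in> range (brk L P)"
      using u
    proof (cases rule: cochain_arity_cases)
      case 1
      show ?thesis unfolding 1 eta_const eta_coeff_zero brk_zero_left by (rule range_brk_zero)
    next
      case (2 p)
      let ?zs = "replicate p (\<theta>, P)" and ?Ps = "replicate p P"
      have map: "map snd ?zs = ?Ps" by simp
      have ins: "insert_brk s v K (replicate q P) = 0" if "multilinear K" for s K q
        using that
      proof (induction q arbitrary: K)
        case (Suc q)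
        show ?case using Suc.IH[OF multilinear_Cons[OF Suc.prems]] multilinear_zero0[OF Suc.prems]
          by (simp add: vP)
      qed simp
      have "act_sum (y, v) (lift u) ?zs = insert_brk (msgn (ip y \<theta>)) (snd (y, v)) u (map snd ?zs)"
        by (rule act_sum_lift) auto
      then have act: "act_sum (y, v) (lift u) ?zs = 0"
        using ins[OF cochain_multilinear[OF u], of "msgn (ip y \<theta>)" p] by simp
      let ?K = "\<lambda>Xs. u (v # Xs)"
      have K: "?K \<in> cochains L (int p - 1 - 1, c + y)" using contr_cochain[OF 2(2) v] .
      have bd: "DD L ?K ?Ps \<in> range (brk L P)"
      proof (cases p)
        case 0
        then have "?K = 0" using cochain_length[OF 2(2)] by (intro ext) simp
        then have "DD L ?K = 0" by (simp only: DD_zero)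
        then show ?thesis by (simp add: range_brk_zero)
      next
        case (Suc q)
        then have "?K \<in> cochains L (int q - 1, c + y)" using K by simp
        from cauchy_eval_DD[OF \<theta> const_fps_gr[OF Pgr] _ this, of 0 0] square_const_fps[OF P]
        have "cauchy_eval (DD L ?K) (replicate (Suc q) (const_fps P)) 0
          = - scl L (of_nat (Suc q) * msgn (ip (c + y) \<theta>)) (brk L P (cauchy_eval ?K (replicate q (const_fps P)) 0))"
          by (simp add: square_coeff_def const_fps_nth del: replicate_Suc of_nat_Suc)
        also have "cauchy_eval (DD L ?K) (replicate (Suc q) (const_fps P)) 0 = DD L ?K ?Ps"
          unfolding Suc by (rule cauchy_eval_const) (simp add: const_fps_nth)
        finally show ?thesis
          by (simp only: vs.scale_minus_left[symmetric]) (intro range_brk_scl rangeI)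
      qed
      have "DD L u (snd (y, v) # map snd ?zs) = act_sum (y, v) (lift u) ?zs
          - scl L (msgn (ip y c)) (brk L v (lift u ?zs)) - lift (DD L ?K) ?zs"
        using DD_contr[OF 2(2), of "(y, v)" ?zs] v Pgr by simp
      then have "DD L ?K ?Ps = - scl L (msgn (ip y c)) (brk L v (u ?Ps))"
        unfolding d act map by simp
      then have "scl L (msgn (ip y c)) (brk L v (u ?Ps)) = scl L (-1) (DD L ?K ?Ps)" by simp
      then have "scl L (msgn (ip y c)) (scl L (msgn (ip y c)) (brk L v (u ?Ps))) \<in> range (brk L P)"
        using range_brk_scl[OF range_brk_scl[OF bd]] by metis
      then have vu: "brk L v (u ?Ps) \<in> range (brk L P)" by simp
      have "homs ?zs" using Pgr by simp
      from cochain_degree[OF u this] have "u ?Ps \<in> gr L (c + sum_list (map fst ?zs))" by simp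
      from brk_swap[OF this v] have "brk L (u ?Ps) v \<in> range (brk L P)"
        using range_brk_scl[OF vu] by metis
      then show ?thesis
        unfolding eta_const eta_coeff_cochain[OF 2(2)] brk_scl_left
          cauchy_eval_const[of "const_fps P" P u p, OF const_fps_nth[of P 0, simplified]]
        by (rule range_brk_scl)
    qed
    moreover have "u \<in> all_cochains"
      using u by (intro direct_sum_homogeneous[of "(k, c)"]) auto
    ultimately show ?case by blast
  next
    case (add u w)
    have uw: "u \<in> all_cochains" "w \<in> all_cochains"
      and r: "brk L (eta L u P) v \<in> range (brk L P)" "brk L (eta L w P) v \<in> range (brk L P)"
      using add by blast+
    have "brk L (eta L (u + w) P) v \<in> range (brk L P)"
      unfolding eta_const eta_coeff_add[OF uw] brk_add_left
      by (rule range_brk_add[OF r[unfolded eta_const]])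
    then show ?case using direct_sum_cochains_add[OF uw] by blast
  qed
  then show ?thesis by blast
qed

text \<open>
  The induced bracket uses some representatives of the classes, which differ from \<open>\<eta>(z)(P)\<close> by boundaries
  \<open>[P, e]\<close>; and \<open>[[P, e], v] = [P, [e, v]]\<close> if \<open>[P, v] = 0\<close>.
\<close>

theorem eta_sharp_central:
  assumes \<theta>: "odd (ip \<theta> \<theta>)" and P: "P \<in> mc_elements L \<theta>" and \<xi>: "\<xi> \<in> HHH L"
  shows "eta_sharp L \<theta> P \<xi> \<in> HP_center L \<theta> P"
proof -
  have Pgr: "P \<in> gr L \<theta>" using P by (simp add: mc_elements_def)
  define z where "z = coh_rep (cochains L) (DD L) (1, 0) \<xi>"
  have z: "z \<in> all_cochains" "DD L z = 0"
    using cocycles_HHH[OF \<xi>] by (auto simp: z_def cocycles_def)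
  define w where "w = eta L z P"
  have eta: "eta_sharp L \<theta> P \<xi> = coh_class (gr L) (brk L P) \<theta> w"
    by (simp add: eta_sharp_def z_def w_def)
  have HP: "eta_sharp L \<theta> P \<xi> \<in> HP L \<theta> P"
    unfolding eta by (rule coh_class_in_cohomology[OF Pgr]) (simp add: w_def brk_eta_cocycle[OF \<theta> P z])
  have "HP_brk L \<theta> P (eta_sharp L \<theta> P \<xi>) \<zeta> = coh_zero (gr L) (brk L P) \<theta>" if \<zeta>: "\<zeta> \<in> HP L \<theta> P" for \<zeta>
  proof -
    define u where "u = coh_rep (gr L) (brk L P) \<theta> (eta_sharp L \<theta> P \<xi>)"
    define v where "v = coh_rep (gr L) (brk L P) \<theta> \<zeta>"
    have u: "coh_class (gr L) (brk L P) \<theta> u = coh_class (gr L) (brk L P) \<theta> w"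
      using cocycles_HP(2)[OF HP] by (simp add: u_def eta)
    have v: "brk L P v = 0" using cocycles_HP(1)[OF \<zeta>] by (simp add: v_def cocycles_def)
    have "brk L P (hcomp (gr L) v y) = 0" for y
      using hcomp_brk[OF Pgr, of v "y + \<theta>"] v by (simp add: hcomp_zero)
    note vy = this
    obtain e where e: "\<And>x. e x \<in> gr L (x - \<theta>)" "\<And>x. hcomp (gr L) u x = hcomp (gr L) w x + brk L P (e x)"
      using coh_class_eqD[OF u] by metis
    define S where "S = hsupp (gr L) u \<union> hsupp (gr L) w"
    have us: "u = sum (hcomp (gr L) u) S" by (rule sum_hcomp) (auto simp: S_def)
    have ws: "w = sum (hcomp (gr L) w) S" by (rule sum_hcomp) (auto simp: S_def)
    have "(\<Sum>x\<in>S. hcomp (gr L) u x) = (\<Sum>x\<in>S. hcomp (gr L) w x + brk L P (e x))"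
      by (intro sum.cong refl e(2))
    also have "\<dots> = (\<Sum>x\<in>S. hcomp (gr L) w x) + (\<Sum>x\<in>S. brk L P (e x))"
      by (rule sum.distrib)
    finally have "u = w + (\<Sum>x\<in>S. brk L P (e x))"
      unfolding us[symmetric] ws[symmetric] .
    have r1: "brk L (brk L P (e x)) (hcomp (gr L) v y) \<in> range (brk L P)" for x y
      using jacobi_msgn[OF Pgr e(1)[of x] hcomp_in_gr[of v y]] vy[of y]
      by (intro image_eqI[of _ _ "brk L (e x) (hcomp (gr L) v y)"]) simp_all
    have r2: "brk L w (hcomp (gr L) v y) \<in> range (brk L P)" for y
      unfolding w_def by (rule brk_eta_central[OF \<theta> P z hcomp_in_gr vy])
    have uvy: "brk L u (hcomp (gr L) v y) \<in> range (brk L P)" for y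
      unfolding \<open>u = w + _\<close> brk_add_left brk_sum_left by (intro range_brk_add range_brk_sum r1 r2)
    have vs: "v = sum (hcomp (gr L) v) (hsupp (gr L) v)" by (rule sum_hcomp) auto
    have "brk L u (sum (hcomp (gr L) v) (hsupp (gr L) v)) \<in> range (brk L P)"
      unfolding brk_sum_right by (intro range_brk_sum uvy)
    then have "brk L u v \<in> range (brk L P)" unfolding vs[symmetric] .
    then obtain Y where "brk L u v = brk L P Y" by blast
    then show ?thesis
      unfolding HP_brk_def u_def[symmetric] v_def[symmetric] using coh_class_boundary[OF Pgr] by simp
  qed
  then show ?thesis using HP by (simp add: HP_center_def)
qed

section \<open>Deformations associated to cocycles\<close>

text \<open>
  The hypothesis gives a cocycle of mixed degree whose value at \<open>P\<close> has component \<open>R + [P, e]\<close> in degree \<open>\<theta>\<close>. Only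
  its components with degree in \<open>degs0\<close> contribute there; adding the inner derivation of \<open>e\<close> removes \<open>[P, e]\<close>.
\<close>

lemma cocycle_with_value:
  assumes \<theta>: "odd (ip \<theta> \<theta>)" and P: "P \<in> mc_elements L \<theta>"
    and im: "coh_summand (gr L) (brk L P) \<theta> \<theta> \<subseteq> eta_sharp L \<theta> P ` HHH L"
    and R: "R \<in> gr L \<theta>" "brk L P R = 0"
  shows "\<exists>c. c \<in> direct_sum (degs0 \<theta>) (cochains L) \<and> DD L c = 0 \<and> eta L c P = - R"
proof -
  have Pgr: "P \<in> gr L \<theta>" using P by (simp add: mc_elements_def)
  have hR: "hcomp (gr L) R = (\<lambda>x. if x = \<theta> then R else 0)"
    by (rule hcomp_homogeneous[OF independent_gr R(1)])
  have "coh_class (gr L) (brk L P) \<theta> R \<in> coh_summand (gr L) (brk L P) \<theta> \<theta>"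
    unfolding coh_summand_def using coh_class_in_cohomology[OF Pgr R(2)]
    by (auto simp: coh_class_def hR coh_zero_def image_image)
  then obtain \<xi> where \<xi>: "\<xi> \<in> HHH L" "coh_class (gr L) (brk L P) \<theta> R = eta_sharp L \<theta> P \<xi>"
    using im by blast
  define z where "z = coh_rep (cochains L) (DD L) (1, 0) \<xi>"
  have z: "z \<in> all_cochains" "DD L z = 0"
    using cocycles_HHH[OF \<xi>(1)] by (auto simp: z_def cocycles_def)
  have "coh_class (gr L) (brk L P) \<theta> (eta L z P) = coh_class (gr L) (brk L P) \<theta> R"
    using \<xi>(2) by (simp add: eta_sharp_def z_def)
  from coh_class_eqD[OF this, of \<theta>] obtain e
    where e: "e \<in> gr L 0" "hcomp (gr L) (eta L z P) \<theta> = R + brk L P e"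
    by (auto simp: hR)
  have "\<exists>z'. z' \<in> direct_sum (degs0 \<theta>) (cochains L) \<and> DD L z' = 0 \<and> eta L z' P = hcomp (gr L) (eta L z P) \<theta>"
  proof -
    have "z \<in> all_cochains \<and> ?thesis"
      using cocycle_components[OF z]
    proof (induction rule: direct_sum_induct)
      case zero
      have "eta L 0 P = hcomp (gr L) (eta L 0 P) \<theta>"
        unfolding eta_const eta_coeff_zero hcomp_zero by simp
      then show ?case using direct_sum_zero DD_zero by blast
    next
      case (homogeneous g u)
      obtain k c where g: "g = (k, c)" by (cases g)
      have u: "u \<in> cochains L (k, c)" and d: "DD L u = 0" using homogeneous g by auto
      have all: "u \<in> all_cochains"
        using u by (intro direct_sum_homogeneous[of "(k, c)"]) auto
      have deg: "eta L u P \<in> gr L ((k + 1) *s \<theta> + c)"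
        unfolding eta_const
        by (rule eta_coeff_gr[of u "{(k, c)}"]) (use u Pgr in \<open>auto intro: direct_sum_homogeneous const_fps_gr\<close>)
      show ?case
      proof (cases "(k, c) \<in> degs0 \<theta>")
        case True
        then have "(k + 1) *s \<theta> + c = \<theta>" by (simp add: degs0_def vec_eq_iff algebra_simps)
        then have "eta L u P = hcomp (gr L) (eta L u P) \<theta>"
          using hcomp_homogeneous[OF independent_gr deg] by simp
        moreover have "u \<in> direct_sum (degs0 \<theta>) (cochains L)" using True u by (rule direct_sum_homogeneous)
        ultimately show ?thesis using all d by blast
      next
        case False
        then have "(k + 1) *s \<theta> + c \<noteq> \<theta>" by (auto simp: degs0_def vec_eq_iff algebra_simps)
        then have "eta L 0 P = hcomp (gr L) (eta L u P) \<theta>"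
          using hcomp_homogeneous[OF independent_gr deg] unfolding eta_const[of 0] eta_coeff_zero by simp
        then show ?thesis using all direct_sum_zero DD_zero by blast
      qed
    next
      case (add u w)
      have uw: "u \<in> all_cochains" "w \<in> all_cochains" using add by blast+
      obtain u' w' where u': "u' \<in> direct_sum (degs0 \<theta>) (cochains L)" "DD L u' = 0" "eta L u' P = hcomp (gr L) (eta L u P) \<theta>"
        and w': "w' \<in> direct_sum (degs0 \<theta>) (cochains L)" "DD L w' = 0" "eta L w' P = hcomp (gr L) (eta L w P) \<theta>"
        using add by blast
      have "eta L (u' + w') P = hcomp (gr L) (eta L (u + w) P) \<theta>"
        using u'(3) w'(3) hcomp_lin[of 1 "eta L u P" "eta L w P" \<theta>]
        unfolding eta_const eta_coeff_add[OF uw] eta_coeff_add[OF u'(1)[THEN direct_sum_all] w'(1)[THEN direct_sum_all]]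
        by simp
      moreover have "DD L (u' + w') = 0"
        unfolding DD_add[OF u'(1)[THEN direct_sum_all] w'(1)[THEN direct_sum_all]] u'(2) w'(2) by (rule add_0_left)
      ultimately show ?case
        using direct_sum_cochains_add[OF uw] direct_sum_cochains_add[OF u'(1) w'(1)] by blast
    qed
    then show ?thesis by blast
  qed
  then obtain z' where z': "z' \<in> direct_sum (degs0 \<theta>) (cochains L)" "DD L z' = 0" "eta L z' P = R + brk L P e"
    using e(2) by auto
  let ?u = "unary (brk L e)"
  have u: "?u \<in> direct_sum (degs0 \<theta>) (cochains L)"
    using unary_brk[OF e(1)] by (intro direct_sum_homogeneous[of "(0, 0)"]) (auto simp: degs0_def)
  have anti: "brk L e P = - brk L P e"
    using brk_swap[OF e(1) Pgr] by (simp add: swap_sign_def)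
  have zu: "z' + ?u \<in> direct_sum (degs0 \<theta>) (cochains L)" by (rule direct_sum_cochains_add[OF z'(1) u])
  have "eta L (z' + ?u) P = R"
    using z'(3) unfolding eta_const eta_coeff_add[OF direct_sum_all[OF z'(1)] direct_sum_all[OF u]]
      eta_coeff_unary[OF unary_brk[OF e(1)]] by (simp add: const_fps_nth anti)
  then have "eta L (- (z' + ?u)) P = - R"
    unfolding eta_const eta_coeff_uminus[OF direct_sum_all[OF zu]] by simp
  moreover have "DD L (z' + ?u) = 0"
    unfolding DD_add[OF direct_sum_all[OF z'(1)] direct_sum_all[OF u]] z'(2) DD_unary_brk[OF e(1)] by (rule add_0_left)
  then have "DD L (- (z' + ?u)) = 0"
    unfolding DD_uminus[OF direct_sum_all[OF zu]] by (simp only: minus_zero)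
  ultimately show ?thesis using direct_sum_cochains_uminus[OF zu] by blast
qed

text \<open>
  The coefficients of the cocycle are chosen successively. The defect of order \<open>n\<close> is \<open>\<partial>_P\<close>-closed because both
  \<open>[F, F']\<close> and \<open>[F, \<eta>(C)(F)]\<close> vanish and all lower defects are zero.
\<close>

theorem deformation_associated:
  assumes \<theta>: "odd (ip \<theta> \<theta>)" and P: "P \<in> mc_elements L \<theta>"
    and im: "coh_summand (gr L) (brk L P) \<theta> \<theta> \<subseteq> eta_sharp L \<theta> P ` HHH L"
    and F: "deformation L \<theta> P F"
  shows "\<exists>C. associated L \<theta> P C F"
proof -
  have Fgr: "fps_nth F i \<in> gr L \<theta>" and F0: "fps_nth F 0 = P" for i
    using F by (auto simp: deformation_def fps_over_def)
  have "fps_brk L F F = 0" using F by (simp add: deformation_def)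
  then have S: "square_coeff F i = 0" for i
    by (metis square_coeff_eq fps_zero_nth)
  let ?R = "\<lambda>C n. scl L (of_nat (Suc n)) (fps_nth F (Suc n)) + (\<Sum>j<n. eta_coeff 1 (C j) F (n - j))"
  let ?good = "\<lambda>C n c. c \<in> direct_sum (degs0 \<theta>) (cochains L) \<and> DD L c = 0 \<and> eta L c P = - ?R C n"
  obtain C where C: "\<And>n. C n = (SOME c. ?good C n c)"
  proof (rule course_of_values_recursion)
    fix a b :: "nat \<Rightarrow> 'e list \<Rightarrow> 'e" and n assume "\<And>j. j < n \<Longrightarrow> a j = b j"
    then have "?R a n = ?R b n" by simp
    then show "(SOME c. ?good a n c) = (SOME c. ?good b n c)" by simp
  qed blast
  have good: "?good C n (C n)" for n
  proof (induction n rule: less_induct)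
    case (less n)
    (* The coefficients already known, as a cocycle in its own right. *)
    let ?C = "Abs_fps (\<lambda>j. if j < n then C j else 0)"
    have nth: "fps_nth ?C j = (if j < n then C j else 0)" for j by simp
    have cC: "fps_nth ?C j \<in> direct_sum (degs0 \<theta>) (cochains L) \<and> DD L (fps_nth ?C j) = 0" for j
    proof (cases "j < n")
      case True
      then show ?thesis unfolding nth using less[OF True] by (simp only: if_True simp_thms)
    next
      case False
      then show ?thesis unfolding nth by (simp only: if_False direct_sum_zero DD_zero simp_thms)
    qed
    have En: "fps_nth (eta_fps L ?C F) n = (\<Sum>j<n. eta_coeff 1 (C j) F (n - j))"
    proof -
      have "fps_nth (eta_fps L ?C F) n = (\<Sum>j<n. eta_coeff 1 (fps_nth ?C j) F (n - j)) + eta_coeff 1 (fps_nth ?C n) F 0"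
        unfolding eta_fps_nth by (simp add: lessThan_Suc_atMost[symmetric] del: fps_nth_Abs_fps)
      moreover have "eta_coeff 1 (fps_nth ?C n) F 0 = 0"
        unfolding nth by (simp only: less_irrefl if_False eta_coeff_zero)
      moreover have "(\<Sum>j<n. eta_coeff 1 (fps_nth ?C j) F (n - j)) = (\<Sum>j<n. eta_coeff 1 (C j) F (n - j))"
        unfolding nth by (intro sum.cong refl) simp
      ultimately show ?thesis by simp
    qed
    have low: "scl L (of_nat (Suc i)) (fps_nth F (Suc i)) = - fps_nth (eta_fps L ?C F) i" if i: "i < n" for i
    proof -
      have "fps_nth (eta_fps L ?C F) i = (\<Sum>j\<le>i. eta_coeff 1 (C j) F (i - j))"
        unfolding eta_fps_nth nth using i by (intro sum.cong refl) simp
      also have "\<dots> = (\<Sum>j<i. eta_coeff 1 (C j) F (i - j)) + eta_coeff 1 (C i) F 0"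
        by (simp add: lessThan_Suc_atMost[symmetric])
      also have "eta_coeff 1 (C i) F 0 = - ?R C i"
        using less[OF i] eta_eq_eta_coeff[OF F0] by metis
      finally show ?thesis by simp
    qed
    have Rgr: "?R C n \<in> gr L \<theta>"
      using less Fgr by (auto intro!: gr_add gr_scl gr_sum eta_coeff_degs0)
    have "scl L (of_nat (Suc n)) (square_coeff F (Suc n)) = 0" unfolding S by simp
    then have 1: "(\<Sum>j\<le>n. brk L (fps_nth F j) (scl L (of_nat (Suc (n - j))) (fps_nth F (Suc (n - j))))) = 0"
      unfolding square_coeff_derivative[OF \<theta> Fgr] by simp
    have 2: "(\<Sum>j\<le>n. brk L (fps_nth F j) (fps_nth (eta_fps L ?C F) (n - j))) = 0"
      by (rule brk_eta_fps[OF \<theta> Fgr S cC])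
    have "0 = (\<Sum>j\<le>n. brk L (fps_nth F j) (scl L (of_nat (Suc (n - j))) (fps_nth F (Suc (n - j))) + fps_nth (eta_fps L ?C F) (n - j)))"
      unfolding brk_add_right sum.distrib 1 2 by simp
    also have "\<dots> = (\<Sum>j\<in>{0}. brk L (fps_nth F j) (scl L (of_nat (Suc (n - j))) (fps_nth F (Suc (n - j))) + fps_nth (eta_fps L ?C F) (n - j)))"
    proof (rule sum.mono_neutral_right)
      show "\<forall>j\<in>{..n} - {0}. brk L (fps_nth F j) (scl L (of_nat (Suc (n - j))) (fps_nth F (Suc (n - j))) + fps_nth (eta_fps L ?C F) (n - j)) = 0"
      proof
        fix j assume "j \<in> {..n} - {0}"
        then have "n - j < n" by auto
        show "brk L (fps_nth F j) (scl L (of_nat (Suc (n - j))) (fps_nth F (Suc (n - j))) + fps_nth (eta_fps L ?C F) (n - j)) = 0"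
          unfolding low[OF \<open>n - j < n\<close>] by simp
      qed
    qed auto
    also have "\<dots> = brk L P (?R C n)" by (simp add: F0 En del: of_nat_Suc)
    finally have "brk L P (?R C n) = 0" by simp
    from cocycle_with_value[OF \<theta> P im Rgr this] have "\<exists>c. ?good C n c" .
    from someI_ex[OF this] show ?case unfolding C[of n, symmetric] .
  qed
  have "deformation_cocycle L \<theta> (Abs_fps C)"
    unfolding deformation_cocycle_iff fps_nth_Abs_fps using good by blast
  moreover have "solution L \<theta> P (Abs_fps C) F"
    unfolding solution_iff
  proof (intro conjI allI F0 Fgr)
    fix n
    have "fps_nth (eta_fps L (Abs_fps C) F) n = (\<Sum>j<n. eta_coeff 1 (C j) F (n - j)) + eta_coeff 1 (C n) F 0"
      unfolding eta_fps_nth by (simp add: lessThan_Suc_atMost[symmetric])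
    moreover have "eta_coeff 1 (C n) F 0 = - ?R C n"
      using good[of n] eta_eq_eta_coeff[OF F0] by metis
    ultimately show "scl L (of_nat (Suc n)) (fps_nth F (Suc n)) = - fps_nth (eta_fps L (Abs_fps C) F) n"
      by simp
  qed
  ultimately show ?thesis unfolding associated_def by blast
qed

end

theorem theorem5p6:
  fixes L :: "('k::field_char_0, 'e::ab_group_add, 'n::finite) graded_algebra"
    and \<theta> :: "int ^ 'n"
  assumes "graded_lie_algebra L"
    and "(ip \<theta> \<theta> + 1) mod 2 = 0"
  shows
    "(\<forall>C P. deformation_cocycle L \<theta> C \<and> P \<in> mc_elements L \<theta> \<longrightarrow>
        (\<exists>!F. solution L \<theta> P C F) \<and>
        (\<forall>F. solution L \<theta> P C F \<longrightarrow> deformation L \<theta> P F)) \<and>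
     (\<forall>P \<in> mc_elements L \<theta>. \<forall>C C' F F'.
        deformation_cocycle L \<theta> C \<and> deformation_cocycle L \<theta> C' \<and> cohomologous L \<theta> C C' \<and>
        associated L \<theta> P C F \<and> associated L \<theta> P C' F' \<longrightarrow> equivalent L F F') \<and>
     (coh_part (cochains L) (DD L) (1, 0) 0 = {coh_zero (cochains L) (DD L) (1, 0) 0} \<longrightarrow>
        (\<forall>P \<in> mc_elements L \<theta>. \<forall>C F F'.
           associated L \<theta> P C F \<and> deformation L \<theta> P F' \<and> equivalent L F F' \<longrightarrow>
           (\<exists>C'. deformation_cocycle L \<theta> C' \<and> cohomologous L \<theta> C C' \<and>
                 associated L \<theta> P C' F'))) \<and>
     (\<forall>P \<in> mc_elements L \<theta>.
        eta_sharp L \<theta> P ` HHH L \<subseteq> HP_center L \<theta> P \<and>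
        (coh_summand (gr L) (brk L P) \<theta> \<theta> \<subseteq> eta_sharp L \<theta> P ` HHH L \<longrightarrow>
           (\<forall>F. deformation L \<theta> P F \<longrightarrow> (\<exists>C. associated L \<theta> P C F))))"
proof -
  interpret graded_lie_algebra L by (rule assms(1))
  have \<theta>: "odd (ip \<theta> \<theta>)" using assms(2) by presburger
  show ?thesis
  proof (intro conjI allI impI ballI)
    fix C P assume CP: "deformation_cocycle L \<theta> C \<and> P \<in> mc_elements L \<theta>"
    then have "P \<in> gr L \<theta>" by (simp add: mc_elements_def)
    then obtain F where "solution L \<theta> P C F" using solution_exists CP by blast
    then show "\<exists>!F. solution L \<theta> P C F" using solution_unique by blast
    fix F assume "solution L \<theta> P C F"
    then show "deformation L \<theta> P F" using solution_deformation[OF \<theta>] CP by blast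
  next
    fix P C C' F F'
    assume "P \<in> mc_elements L \<theta>" "deformation_cocycle L \<theta> C \<and> deformation_cocycle L \<theta> C' \<and> cohomologous L \<theta> C C' \<and>
        associated L \<theta> P C F \<and> associated L \<theta> P C' F'"
    then show "equivalent L F F'"
      using cohomologous_equivalent[OF \<theta>] unfolding associated_def by blast
  next
    fix P C F F'
    assume H0: "coh_part (cochains L) (DD L) (1, 0) 0 = {coh_zero (cochains L) (DD L) (1, 0) 0}"
      and F: "associated L \<theta> P C F \<and> deformation L \<theta> P F' \<and> equivalent L F F'"
    from F have "deformation_cocycle L \<theta> C" "solution L \<theta> P C F" "equivalent L F F'"
      unfolding associated_def by blast+
    then obtain C' where "deformation_cocycle L \<theta> C'" "cohomologous L \<theta> C C'" "solution L \<theta> P C' F'"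
      using equivalent_associated[OF H0] by metis
    then show "\<exists>C'. deformation_cocycle L \<theta> C' \<and> cohomologous L \<theta> C C' \<and> associated L \<theta> P C' F'"
      unfolding associated_def by blast
  next
    fix P assume "P \<in> mc_elements L \<theta>"
    then show "eta_sharp L \<theta> P ` HHH L \<subseteq> HP_center L \<theta> P"
      using eta_sharp_central[OF \<theta>] by blast
  next
    fix P F assume "P \<in> mc_elements L \<theta>" "coh_summand (gr L) (brk L P) \<theta> \<theta> \<subseteq> eta_sharp L \<theta> P ` HHH L"
      "deformation L \<theta> P F"
    then show "\<exists>C. associated L \<theta> P C F" by (rule deformation_associated[OF \<theta>])
  qed
qed

end
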